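(* Let $a,b>0$, let $n_2,n_3$ be positive integers, and let $\mathcal{F}_1,\mathcal{F}_2,\mathcal{F}_3$ be the free linkages in the plane where $\mathcal{F}_1$ has length vector $(a,b)$, $\mathcal{F}_2$ has $n_2$ edges all of length $1$, and $\mathcal{F}_3$ has $n_3$ edges all of length $1$. Suppose that any one of the following three conditions is satisfied: (1) the interval $[\,|a-b|,a+b\,]$ does not intersect the odd integers, and $\mathcal{F}_2$ and $\mathcal{F}_3$ both have an odd number of edges; (2) the interval $[\,|a-b|,a+b\,]$ does not intersect the even integers, and $\mathcal{F}_2$ and $\mathcal{F}_3$ both have an even number of edges; (3) the interval $[\,|a-b|,a+b\,]$ does not intersect the integers, and $\mathcal{F}_2$ and $\mathcal{F}_3$ have opposite parity of number of edges. Then the map $p:M(\mathcal{F}_1,\mathcal{F}_2,\mathcal{F}_3)\to S^1$ is a locally trivial fibration, and therefore $\chi(M(\mathcal{F}_1,\mathcal{F}_2,\mathcal{F}_3))=0$.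
   Context: A free linkage $\mathcal{F}$ in $\mathbb{R}^2$ with length vector $(d_1,\ldots,d_n)$, $d_i>0$, has configurations $(x_1,\ldots,x_{n+1})\in(\mathbb{R}^2)^{n+1}$ with $|x_i-x_{i+1}|=d_i$ for $i=1,\ldots,n$; $x_1$ is the initial and $x_{n+1}$ the terminal vertex. $C(\mathcal{F}_1,\mathcal{F}_2,\mathcal{F}_3)$ is the space of triples of configurations of $\mathcal{F}_1,\mathcal{F}_2,\mathcal{F}_3$ with all initial vertices at the origin and all terminal vertices coinciding, and $M(\mathcal{F}_1,\mathcal{F}_2,\mathcal{F}_3)=C(\mathcal{F}_1,\mathcal{F}_2,\mathcal{F}_3)/SO(2)$. It is identified with the set of triples in which the first edge of $\mathcal{F}_1$ (of length $a$) lies on the positive $x$-axis. Let $\theta\in\mathbb{R}/2\pi\mathbb{Z}$ be the angle from the positive $x$-axis to the second edge of $\mathcal{F}_1$ (of length $b$, directed from the second to the third vertex), and let $\theta_1=\pi-\theta$ be the angle from $b$ to $a$. The map $p$ sends a configuration to its angle $\theta_1$. $\chi$ denotes the Euler characteristic. *)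

theory Defs
  imports "HOL-Analysis.Analysis" "HOL-Homology.Homology"
begin

section \<open>Linkage configuration spaces\<close>

text \<open>The Euclidean plane is represented by the type of complex numbers; SO(2) is then the group
  of unit complex numbers acting by multiplication, and the circle of angles modulo \<open>2\<pi>\<close>
  is the unit circle, the class of \<open>t\<close> corresponding to \<open>cis t\<close>.

  A free linkage is given by its length vector \<open>d\<close>. Its vertices are numbered from \<open>0\<close> (initial)
  to \<open>length d\<close> (terminal); a configuration is an extensional function on \<open>{..length d}\<close>.\<close>

definition free_configs :: "real list \<Rightarrow> (nat \<Rightarrow> complex) set" where
  "free_configs d =
     {x \<in> {..length d} \<rightarrow>\<^sub>E UNIV. \<forall>i<length d. dist (x i) (x (Suc i)) = d ! i}"

definition free_config_space :: "real list \<Rightarrow> (nat \<Rightarrow> complex) topology" where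
  "free_config_space d =
     subtopology (product_topology (\<lambda>_. euclidean) {..length d}) (free_configs d)"

type_synonym triple_config = "(nat \<Rightarrow> complex) \<times> (nat \<Rightarrow> complex) \<times> (nat \<Rightarrow> complex)"

definition C_space :: "real list \<Rightarrow> real list \<Rightarrow> real list \<Rightarrow> triple_config topology" where
  "C_space d1 d2 d3 =
     subtopology
       (prod_topology (free_config_space d1)
         (prod_topology (free_config_space d2) (free_config_space d3)))
       {(x, y, z). x 0 = 0 \<and> y 0 = 0 \<and> z 0 = 0 \<and>
          x (length d1) = y (length d2) \<and> y (length d2) = z (length d3)}"

definition rotate_config :: "nat \<Rightarrow> complex \<Rightarrow> (nat \<Rightarrow> complex) \<Rightarrow> (nat \<Rightarrow> complex)" where
  "rotate_config n u x = (\<lambda>i\<in>{..n}. u * x i)"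

definition SO2_orbit ::
    "real list \<Rightarrow> real list \<Rightarrow> real list \<Rightarrow> triple_config \<Rightarrow> triple_config set" where
  "SO2_orbit d1 d2 d3 = (\<lambda>(x, y, z).
     {(rotate_config (length d1) u x, rotate_config (length d2) u y,
       rotate_config (length d3) u z) | u. norm u = 1})"

text \<open>The quotient (identification) topology on the image of \<open>f\<close>.\<close>

definition quotient_topology :: "'a topology \<Rightarrow> ('a \<Rightarrow> 'b) \<Rightarrow> 'b topology" where
  "quotient_topology X f =
     topology (\<lambda>U. U \<subseteq> f ` topspace X \<and> openin X {x \<in> topspace X. f x \<in> U})"

lemma openin_quotient_topology:
  "openin (quotient_topology X f) U \<longleftrightarrow>
     U \<subseteq> f ` topspace X \<and> openin X {x \<in> topspace X. f x \<in> U}"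
proof -
  let ?P = "\<lambda>U. U \<subseteq> f ` topspace X \<and> openin X {x \<in> topspace X. f x \<in> U}"
  have "istopology ?P"
    unfolding istopology_def
  proof (intro conjI allI impI)
    fix S T assume "?P S" "?P T"
    moreover have "{x \<in> topspace X. f x \<in> S \<inter> T} =
        {x \<in> topspace X. f x \<in> S} \<inter> {x \<in> topspace X. f x \<in> T}"
      by blast
    ultimately show "S \<inter> T \<subseteq> f ` topspace X" "openin X {x \<in> topspace X. f x \<in> S \<inter> T}"
      by (auto intro: openin_Int)
  next
    fix K assume K: "\<forall>k\<in>K. ?P k"
    have "{x \<in> topspace X. f x \<in> \<Union>K} = (\<Union>k\<in>K. {x \<in> topspace X. f x \<in> k})"
      by blast
    then show "openin X {x \<in> topspace X. f x \<in> \<Union>K}"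
      using K by (metis (no_types, lifting) openin_Union imageE)
    show "\<Union>K \<subseteq> f ` topspace X" using K by blast
  qed
  then show ?thesis
    unfolding quotient_topology_def by (simp add: topology_inverse')
qed

lemma topspace_quotient_topology: "topspace (quotient_topology X f) = f ` topspace X"
proof -
  have "{x \<in> topspace X. f x \<in> f ` topspace X} = topspace X" by blast
  then have "openin (quotient_topology X f) (f ` topspace X)"
    by (simp add: openin_quotient_topology)
  then show ?thesis
    by (metis openin_quotient_topology openin_subset openin_topspace subset_antisym)
qed

lemma quotient_map_quotient_topology: "quotient_map X (quotient_topology X f) f"
  unfolding quotient_map_def topspace_quotient_topology by (simp add: openin_quotient_topology)

definition M_space :: "real list \<Rightarrow> real list \<Rightarrow> real list \<Rightarrow> triple_config set topology" where
  "M_space d1 d2 d3 = quotient_topology (C_space d1 d2 d3) (SO2_orbit d1 d2 d3)"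

text \<open>The angle map for a first linkage with two edges. An orbit contains exactly one triple whose
  first edge points along the positive x-axis; \<open>\<theta>\<close> is the angle from that axis to the
  second edge of this triple, and the value of the map is the class of \<open>\<pi> - \<theta>\<close>.\<close>

definition p_map :: "triple_config set \<Rightarrow> complex" where
  "p_map Q = (THE w. \<exists>x y z. (x, y, z) \<in> Q \<and> Im (x 1 - x 0) = 0 \<and> Re (x 1 - x 0) > 0 \<and>
                w = cis (pi - Arg (x 2 - x 1)))"

lemma p_map_orbit:
  assumes c: "(x, y, z) \<in> topspace (C_space [a, b] d2 d3)" and "a > 0"
  shows "p_map (SO2_orbit [a, b] d2 d3 (x, y, z)) = cis (pi - Arg ((x 2 - x 1) / (x 1 - x 0)))"
proof -
  have x0: "x 0 = 0" and "dist (x 0) (x 1) = a"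
    using c by (auto simp: C_space_def free_config_space_def free_configs_def)
  then have n1: "norm (x 1) = a" by (simp add: dist_norm)
  then have nz: "x 1 \<noteq> 0" using \<open>a > 0\<close> by auto
  have key: "u * (x 2 - x 1) = of_real a * ((x 2 - x 1) / x 1)"
    if "norm u = 1" "Im (u * x 1) = 0" "Re (u * x 1) > 0" for u
  proof -
    have "norm (u * x 1) = a" using that n1 by (simp add: norm_mult)
    then have "u * x 1 = of_real a"
      using that by (simp add: complex_eq_iff cmod_eq_Re)
    then have "u = of_real a / x 1" using nz by (simp add: field_simps)
    then show ?thesis by simp
  qed
  have Arg: "Arg (of_real a * ((x 2 - x 1) / x 1)) = Arg ((x 2 - x 1) / x 1)"
    using \<open>a > 0\<close> by (simp only: Arg_times_of_real)
  have key': "Arg (u * x 2 - u * x 1) = Arg ((x 2 - x 1) / (x 1 - x 0))"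
    if "norm u = 1" "Im (u * x 1) = 0" "Re (u * x 1) > 0" for u
    using key[OF that] Arg by (simp only: right_diff_distrib x0 diff_zero)
  define u0 where "u0 = of_real a / x 1"
  have u0: "norm u0 = 1" "u0 * x 1 = of_real a"
    using n1 nz \<open>a > 0\<close> by (auto simp: u0_def norm_divide)
  show ?thesis
    unfolding p_map_def
  proof (rule the_equality)
    show "\<exists>x' y' z'. (x', y', z') \<in> SO2_orbit [a, b] d2 d3 (x, y, z) \<and> Im (x' 1 - x' 0) = 0 \<and>
        Re (x' 1 - x' 0) > 0 \<and>
        cis (pi - Arg ((x 2 - x 1) / (x 1 - x 0))) = cis (pi - Arg (x' 2 - x' 1))"
    proof (intro exI conjI)
      show "(rotate_config 2 u0 x, rotate_config (length d2) u0 y, rotate_config (length d3) u0 z)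
          \<in> SO2_orbit [a, b] d2 d3 (x, y, z)"
        using u0(1) by (auto simp: SO2_orbit_def numeral_2_eq_2)
      show "cis (pi - Arg ((x 2 - x 1) / (x 1 - x 0))) =
          cis (pi - Arg (rotate_config 2 u0 x 2 - rotate_config 2 u0 x 1))"
      proof -
        have r: "rotate_config 2 u0 x 2 = u0 * x 2" "rotate_config 2 u0 x 1 = u0 * x 1"
          by (simp_all add: rotate_config_def)
        have "Im (u0 * x 1) = 0" "Re (u0 * x 1) > 0"
          unfolding u0(2) using \<open>a > 0\<close> by simp_all
        then show ?thesis
          unfolding r using key'[of u0] u0(1) by metis
      qed
    qed (use u0 \<open>a > 0\<close> in \<open>auto simp: rotate_config_def x0\<close>)
  next
    fix w
    assume "\<exists>x' y' z'. (x', y', z') \<in> SO2_orbit [a, b] d2 d3 (x, y, z) \<and> Im (x' 1 - x' 0) = 0 \<and>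
        Re (x' 1 - x' 0) > 0 \<and> w = cis (pi - Arg (x' 2 - x' 1))"
    then obtain u where u: "norm u = 1" "Im (u * x 1) = 0" "Re (u * x 1) > 0"
        "w = cis (pi - Arg (u * x 2 - u * x 1))"
      by (auto simp: SO2_orbit_def rotate_config_def x0)
    then show "w = cis (pi - Arg ((x 2 - x 1) / (x 1 - x 0)))"
      using key'[of u] by metis
  qed
qed

section \<open>Locally trivial fibrations\<close>

text \<open>A model fibre over a neighbourhood of \<open>b\<close> is necessarily homeomorphic to the fibre over
  \<open>b\<close>, so the latter is used as the model. Fibres may be empty.\<close>

definition locally_trivial_fibration :: "'a topology \<Rightarrow> 'b topology \<Rightarrow> ('a \<Rightarrow> 'b) \<Rightarrow> bool" where
  "locally_trivial_fibration E B p \<longleftrightarrow>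
     continuous_map E B p \<and>
     (\<forall>b\<in>topspace B. \<exists>U h. openin B U \<and> b \<in> U \<and>
        homeomorphic_map
          (subtopology E {e \<in> topspace E. p e \<in> U})
          (prod_topology (subtopology B U) (subtopology E {e \<in> topspace E. p e = b})) h \<and>
        (\<forall>e\<in>topspace E. p e \<in> U \<longrightarrow> fst (h e) = p e))"

section \<open>Euler characteristic\<close>

definition int_independent :: "('a, 'b) monoid_scheme \<Rightarrow> 'a set \<Rightarrow> bool" where
  "int_independent G S \<longleftrightarrow>
     finite S \<and> S \<subseteq> carrier G \<and>
     (\<forall>c :: 'a \<Rightarrow> int.
        finprod G (\<lambda>x. x [^]\<^bsub>G\<^esub> c x) S = \<one>\<^bsub>G\<^esub> \<longrightarrow> (\<forall>x\<in>S. c x = 0))"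

text \<open>The (torsion-free) rank of a commutative group, in multiplicative notation, exists and
  equals \<open>r\<close>.\<close>

definition has_rank :: "('a, 'b) monoid_scheme \<Rightarrow> nat \<Rightarrow> bool" where
  "has_rank G r \<longleftrightarrow>
     (\<exists>S. int_independent G S \<and> card S = r) \<and> (\<forall>S. int_independent G S \<longrightarrow> card S \<le> r)"

text \<open>The Euler characteristic is the alternating sum of the Betti numbers for integral singular
  homology. The relation includes that it is defined: all Betti numbers are finite and
  almost all of them vanish.\<close>

definition has_euler_characteristic :: "'a topology \<Rightarrow> int \<Rightarrow> bool" where
  "has_euler_characteristic X k \<longleftrightarrow>
     (\<exists>\<beta> N. (\<forall>n. has_rank (homology_group (int n) X) (\<beta> n)) \<and> (\<forall>n\<ge>N. \<beta> n = 0) \<and>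
        k = (\<Sum>n<N. (-1) ^ n * int (\<beta> n)))"

end

theory Submission
  imports Defs
begin

text \<open>Turn every configuration so that the first edge of the first linkage lies on the positive real
axis. What remains is a triple \<open>(w, u, u')\<close>: the point \<open>w = cis \<theta>\<^sub>1\<close> of the circle and the two lists
of unit edge vectors of the other linkages, which are points of tori. The terminal vertex of the
first linkage is \<open>tip w = a - b * cnj w\<close>, and the only condition is that \<open>u\<close> and \<open>u'\<close> both sum to
\<open>tip w\<close>. So the angle map is the projection of a fibre product of two end point maps
\<open>endpoint n u = (\<Sum>i<n. u i)\<close> over the curve \<open>tip\<close>, whose distance from the origin stays in the
interval \<open>{\<bar>a - b\<bar>..a + b}\<close> (lemma \<open>M_homeomorphic_E\<close>). The end point map is singular only at
lists of parallel edges, where the end point has integral norm of the parity of \<open>n\<close>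
(lemma \<open>torus_collinear_endpoint\<close>); the hypotheses say that the curve avoids these values.

Local triviality of a proper submersion usually comes from integrating vector fields. Here an
explicit family of maps does the work: the Moebius transformations
\<open>u \<mapsto> (u + c) / (1 + cnj c * u)\<close>, applied to all edges. The end point depends on \<open>c\<close> with an
invertible derivative as long as the edges are not all parallel, so near a regular fibre there is
exactly one small \<open>c\<close> that moves \<open>u\<close> to a list with a prescribed end point. Because the inverse
transformation has parameter \<open>- c\<close>, moving back is an operation of the same kind, and this is
a local trivialisation (lemmas \<open>parallel_transport_exists\<close>, \<open>edge_space_locally_trivial\<close>).

For the Euler characteristic, ranks are additive in long exact sequences, so the
Euler characteristic satisfies the Mayer-Vietoris formula, including its existence
(lemma \<open>mayer_vietoris_euler\<close>). Finite unions of convex open boxes therefore have an Euler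
characteristic. The same Moebius transport makes a fibre a retract of an open set of tuples of
complex numbers, and as it is compact also of a finite union of boxes; so its Betti numbers are
finite and almost all zero (lemma \<open>euler_polygons_Times\<close>). Finally, covering the circle by arcs
and applying Mayer-Vietoris once more shows that a locally trivial fibration over the circle whose
fibres have an Euler characteristic has Euler characteristic zero
(theorem \<open>euler_characteristic_circle_fibration\<close>).\<close>

section \<open>Rank of commutative groups\<close>

text \<open>Indexed families are easier to count than sets: the lifts and linear combinations that the
rank formula needs come with an index. An independent family is automatically injective, so its
image is an independent set of the same size.\<close>

definition fam_independent :: "('a, 'b) monoid_scheme \<Rightarrow> ('i \<Rightarrow> 'a) \<Rightarrow> 'i set \<Rightarrow> bool" where
  "fam_independent G g I \<longleftrightarrow>
     finite I \<and> g ` I \<subseteq> carrier G \<and>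
     (\<forall>c :: 'i \<Rightarrow> int.
        finprod G (\<lambda>i. g i [^]\<^bsub>G\<^esub> c i) I = \<one>\<^bsub>G\<^esub> \<longrightarrow> (\<forall>i\<in>I. c i = 0))"

context comm_group
begin

lemma finprod_int_pow_pow:
  assumes "g \<in> I \<rightarrow> carrier G"
  shows "finprod G (\<lambda>i. g i [^] (c i :: int)) I [^] (k::int) = finprod G (\<lambda>i. g i [^] (k * c i)) I"
  using assms
proof (induction I rule: infinite_finite_induct)
  case (insert x F)
  then have "g x \<in> carrier G" "(\<lambda>i. g i [^] c i) \<in> F \<rightarrow> carrier G" "(\<lambda>i. g i [^] (k * c i)) \<in> F \<rightarrow> carrier G"
    by (auto simp: Pi_def)
  with insert show ?case
    by (simp add: int_pow_distrib int_pow_pow mult.commute)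
qed auto

lemma finprod_int_pow_mult:
  assumes "g \<in> I \<rightarrow> carrier G"
  shows "finprod G (\<lambda>i. g i [^] (c i :: int)) I \<otimes> finprod G (\<lambda>i. g i [^] d i) I
       = finprod G (\<lambda>i. g i [^] (c i + d i)) I"
proof -
  have "finprod G (\<lambda>i. g i [^] (c i + d i)) I = finprod G (\<lambda>i. g i [^] c i \<otimes> g i [^] d i) I"
    using assms by (intro finprod_cong') (auto simp: int_pow_mult Pi_iff)
  also have "\<dots> = finprod G (\<lambda>i. g i [^] c i) I \<otimes> finprod G (\<lambda>i. g i [^] d i) I"
    using assms by (intro finprod_multf) (auto simp: Pi_iff)
  finally show ?thesis by simp
qed

text \<open>In additive notation: \<open>\<Sum>j. k j * (\<Sum>i. c j i * g i) = \<Sum>i. (\<Sum>j. k j * c j i) * g i\<close>.\<close>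

lemma finprod_int_pow_sum:
  assumes "g \<in> I \<rightarrow> carrier G" "finite J"
  shows "finprod G (\<lambda>j. finprod G (\<lambda>i. g i [^] (c j i :: int)) I [^] (k j :: int)) J
       = finprod G (\<lambda>i. g i [^] (\<Sum>j\<in>J. k j * c j i)) I"
  using assms(2)
proof (induction J rule: finite_induct)
  case empty
  show ?case by simp
next
  case (insert j J)
  have "finprod G (\<lambda>i. g i [^] (c j i :: int)) I \<in> carrier G" for j
    using assms by (intro finprod_closed) (auto simp: Pi_iff)
  with insert assms show ?case
    by (simp add: finprod_int_pow_pow finprod_int_pow_mult Pi_iff)
qed

text \<open>A repetition \<open>g x = g y\<close> is the relation with coefficients \<open>1\<close> at \<open>x\<close> and \<open>- 1\<close> at \<open>y\<close>.\<close>

lemma fam_independent_imp_inj: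
  assumes "fam_independent G g I" shows "inj_on g I"
proof (rule inj_onI, rule ccontr)
  fix x y assume xy: "x \<in> I" "y \<in> I" "g x = g y" "x \<noteq> y"
  have fin: "finite I" and gc: "g i \<in> carrier G" if "i \<in> I" for i
    using assms that by (auto simp: fam_independent_def)
  have fin: "finite I" using assms by (auto simp: fam_independent_def)
  define c where "c = (\<lambda>i. if i = x then 1 else if i = y then -1 else (0::int))"
  have "finprod G (\<lambda>i. g i [^] c i) I = finprod G (\<lambda>i. g i [^] c i) (insert x (insert y (I - {x,y})))"
    using xy by (intro arg_cong2[where f="finprod G"]) auto
  also have "\<dots> = g x [^] c x \<otimes> (g y [^] c y \<otimes> finprod G (\<lambda>i. g i [^] c i) (I - {x,y}))"
    using xy gc fin by (subst finprod_insert; (subst finprod_insert)?) (auto simp: Pi_iff)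
  also have "finprod G (\<lambda>i. g i [^] c i) (I - {x,y}) = finprod G (\<lambda>i. \<one>) (I - {x,y})"
    by (intro finprod_cong') (auto simp: c_def)
  finally have "finprod G (\<lambda>i. g i [^] c i) I = \<one>"
    using xy gc by (simp add: c_def int_pow_neg int_pow_1)
  then have "c x = 0" using assms xy by (simp only: fam_independent_def)
  then show False by (simp add: c_def)
qed

lemma fam_independent_image:
  assumes "fam_independent G g I" shows "int_independent G (g ` I)" "card (g ` I) = card I"
proof -
  have inj: "inj_on g I" using fam_independent_imp_inj assms .
  then show "card (g ` I) = card I" by (rule card_image)
  show "int_independent G (g ` I)"
    unfolding int_independent_def
  proof (intro conjI allI impI)
    show "finite (g ` I)" "g ` I \<subseteq> carrier G" using assms by (auto simp: fam_independent_def)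
  next
    fix c :: "'a \<Rightarrow> int" assume "finprod G (\<lambda>x. x [^] c x) (g ` I) = \<one>"
    moreover have "finprod G (\<lambda>x. x [^] c x) (g ` I) = finprod G (\<lambda>i. g i [^] c (g i)) I"
      using assms inj by (subst finprod_reindex) (auto simp: fam_independent_def)
    ultimately show "\<forall>x\<in>g ` I. c x = 0"
      using assms by (auto simp: fam_independent_def)
  qed
qed

end

lemma hom_finprod_int_pow:
  assumes "comm_group A" "comm_group B" "f \<in> hom A B" "g \<in> I \<rightarrow> carrier A"
  shows "f (finprod A (\<lambda>i. g i [^]\<^bsub>A\<^esub> (c i :: int)) I) = finprod B (\<lambda>i. f (g i) [^]\<^bsub>B\<^esub> c i) I"
proof -
  interpret A: comm_group A by fact
  interpret B: comm_group B by fact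
  interpret f: group_hom A B f by unfold_locales fact
  show ?thesis
    using assms(4)
  proof (induction I rule: infinite_finite_induct)
    case (insert x F)
    then have "g x \<in> carrier A" "(\<lambda>i. g i [^]\<^bsub>A\<^esub> c i) \<in> F \<rightarrow> carrier A"
        "(\<lambda>i. f (g i) [^]\<^bsub>B\<^esub> c i) \<in> F \<rightarrow> carrier B"
      by (auto simp: Pi_def)
    with insert show ?case by (simp add: f.hom_int_pow)
  qed auto
qed

text \<open>Lift \<open>L\<close> along \<open>f\<close>. Applying \<open>f\<close> to a relation between \<open>K\<close> and the lifts deletes the part
in the kernel, so independence of \<open>L\<close> makes the coefficients of the lifts vanish; what is left is a
relation within \<open>K\<close>.\<close>

lemma independent_extension:
  assumes A: "comm_group A" and B: "comm_group B" and f: "f \<in> hom A B"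
    and K: "int_independent A K" "K \<subseteq> kernel A B f"
    and L: "int_independent B L" "L \<subseteq> f ` carrier A"
  obtains S where "int_independent A S" "card S = card K + card L"
proof -
  interpret A: comm_group A by fact
  interpret B: comm_group B by fact
  interpret f: group_hom A B f by unfold_locales fact
  have "\<forall>s\<in>L. \<exists>x\<in>carrier A. f x = s" using L(2) by auto
  then obtain g where g: "\<And>s. s \<in> L \<Longrightarrow> g s \<in> carrier A" "\<And>s. s \<in> L \<Longrightarrow> f (g s) = s" by metis
  have fin: "finite K" "finite L" using K L by (auto simp: int_independent_def)
  have KA: "K \<subseteq> carrier A" using K by (auto simp: int_independent_def)
  have LB: "L \<subseteq> carrier B" using L by (auto simp: int_independent_def)
  define h where "h = case_sum (\<lambda>x. x) g"
  have h: "h \<in> K <+> L \<rightarrow> carrier A" using KA g by (auto simp: h_def)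
  have split: "finprod A (\<lambda>i. h i [^]\<^bsub>A\<^esub> (c i::int)) (K <+> L) =
      finprod A (\<lambda>x. x [^]\<^bsub>A\<^esub> c (Inl x)) K \<otimes>\<^bsub>A\<^esub> finprod A (\<lambda>s. g s [^]\<^bsub>A\<^esub> c (Inr s)) L" for c
  proof -
    have "finprod A (\<lambda>i. h i [^]\<^bsub>A\<^esub> c i) (Inl ` K \<union> Inr ` L) =
       finprod A (\<lambda>i. h i [^]\<^bsub>A\<^esub> c i) (Inl ` K) \<otimes>\<^bsub>A\<^esub> finprod A (\<lambda>i. h i [^]\<^bsub>A\<^esub> c i) (Inr ` L)"
      using fin h by (intro A.finprod_Un_disjoint) (auto simp: Pi_iff)
    also have "finprod A (\<lambda>i. h i [^]\<^bsub>A\<^esub> c i) (Inl ` K) = finprod A (\<lambda>x. x [^]\<^bsub>A\<^esub> c (Inl x)) K"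
      using KA by (subst A.finprod_reindex) (auto simp: h_def)
    also have "finprod A (\<lambda>i. h i [^]\<^bsub>A\<^esub> c i) (Inr ` L) = finprod A (\<lambda>s. g s [^]\<^bsub>A\<^esub> c (Inr s)) L"
      using g by (subst A.finprod_reindex) (auto simp: h_def)
    finally show ?thesis by (simp add: Plus_def)
  qed
  have "fam_independent A h (K <+> L)"
    unfolding fam_independent_def
  proof (intro conjI allI impI)
    show "finite (K <+> L)" "h ` (K <+> L) \<subseteq> carrier A" using fin h by auto
  next
    fix c :: "_ \<Rightarrow> int"
    assume 1: "finprod A (\<lambda>i. h i [^]\<^bsub>A\<^esub> c i) (K <+> L) = \<one>\<^bsub>A\<^esub>"
    have "f (finprod A (\<lambda>i. h i [^]\<^bsub>A\<^esub> c i) (K <+> L)) =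
       f (finprod A (\<lambda>x. x [^]\<^bsub>A\<^esub> c (Inl x)) K) \<otimes>\<^bsub>B\<^esub> f (finprod A (\<lambda>s. g s [^]\<^bsub>A\<^esub> c (Inr s)) L)"
      unfolding split using KA g by (intro f.hom_mult A.finprod_closed) auto
    also have "f (finprod A (\<lambda>x. x [^]\<^bsub>A\<^esub> c (Inl x)) K) = finprod B (\<lambda>x. f x [^]\<^bsub>B\<^esub> c (Inl x)) K"
      using KA by (intro hom_finprod_int_pow A B f) auto
    also have "\<dots> = finprod B (\<lambda>x. \<one>\<^bsub>B\<^esub>) K"
      using K(2) by (intro B.finprod_cong') (auto simp: kernel_def)
    also have "f (finprod A (\<lambda>s. g s [^]\<^bsub>A\<^esub> c (Inr s)) L) = finprod B (\<lambda>s. f (g s) [^]\<^bsub>B\<^esub> c (Inr s)) L"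
      using g by (intro hom_finprod_int_pow A B f) auto
    also have "\<dots> = finprod B (\<lambda>s. s [^]\<^bsub>B\<^esub> c (Inr s)) L"
      using g LB by (intro B.finprod_cong') auto
    finally have "finprod B (\<lambda>s. s [^]\<^bsub>B\<^esub> c (Inr s)) L = \<one>\<^bsub>B\<^esub>"
      using 1 LB by (simp add: B.finprod_closed Pi_iff subset_iff)
    then have c0: "\<forall>s\<in>L. c (Inr s) = 0"
      using L(1) unfolding int_independent_def by (elim conjE allE[of _ "\<lambda>s. c (Inr s)"]) auto
    then have "finprod A (\<lambda>s. g s [^]\<^bsub>A\<^esub> c (Inr s)) L = finprod A (\<lambda>s. \<one>\<^bsub>A\<^esub>) L"
      by (intro A.finprod_cong') auto
    then have "finprod A (\<lambda>x. x [^]\<^bsub>A\<^esub> c (Inl x)) K = \<one>\<^bsub>A\<^esub>"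
      using 1 KA unfolding split by (simp add: A.finprod_closed Pi_iff subset_iff)
    then have "\<forall>x\<in>K. c (Inl x) = 0"
      using K(1) unfolding int_independent_def by (elim conjE allE[of _ "\<lambda>s. c (Inl s)"]) auto
    with c0 show "\<forall>i\<in>(K <+> L). c i = 0" by auto
  qed
  from A.fam_independent_image[OF this] show thesis
    using that fin by (metis card_Plus)
qed

text \<open>This is the other half of the rank formula. Choose \<open>U \<subseteq> T\<close> of maximal size such that \<open>f\<close> stays
independent on \<open>U\<close>. For every other \<open>t\<close>, maximality gives a relation between the images of \<open>t\<close> and
\<open>U\<close> in which \<open>t\<close> really occurs; the same combination taken in \<open>A\<close> is an element \<open>e t\<close> of the kernel.
The elements \<open>e t\<close> are independent, because \<open>t\<close> occurs in none of the others: a relation between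
them would be a relation in \<open>T\<close>.\<close>

lemma independent_split:
  assumes A: "comm_group A" and B: "comm_group B" and f: "f \<in> hom A B"
    and T: "int_independent A T"
  obtains K L where "int_independent A K" "K \<subseteq> kernel A B f"
    "int_independent B L" "L \<subseteq> f ` carrier A" "card T = card K + card L"
proof -
  interpret A: comm_group A by fact
  interpret B: comm_group B by fact
  interpret f: group_hom A B f by unfold_locales fact
  have fin: "finite T" and TA: "T \<subseteq> carrier A" using T by (auto simp: int_independent_def)
  have "fam_independent B f {}" by (simp add: fam_independent_def)
  then have "\<exists>U. (U \<subseteq> T \<and> fam_independent B f U) \<and> (\<forall>V. V \<subseteq> T \<and> fam_independent B f V \<longrightarrow> card V \<le> card U)"
    using fin card_mono[OF fin]
    by (intro ex_has_greatest_nat[where k="{}" and b="Suc (card T)"]) (auto simp: le_imp_less_Suc)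
  then obtain U where U: "U \<subseteq> T" "fam_independent B f U"
    and mx: "\<And>V. V \<subseteq> T \<Longrightarrow> fam_independent B f V \<Longrightarrow> card V \<le> card U" by blast
  have finU: "finite U" using U fin finite_subset by blast
  have "\<exists>c :: _ \<Rightarrow> int. finprod B (\<lambda>x. f x [^]\<^bsub>B\<^esub> c x) T = \<one>\<^bsub>B\<^esub> \<and> c t \<noteq> 0 \<and> (\<forall>s\<in>T - U. s \<noteq> t \<longrightarrow> c s = 0)"
    if t: "t \<in> T - U" for t
  proof -
    have "\<not> fam_independent B f (insert t U)"
      using mx[of "insert t U"] t U finU by auto
    then obtain c :: "_ \<Rightarrow> int" where c: "finprod B (\<lambda>x. f x [^]\<^bsub>B\<^esub> c x) (insert t U) = \<one>\<^bsub>B\<^esub>"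
      and nz: "\<exists>x\<in>insert t U. c x \<noteq> 0"
      using finU t U TA by (auto simp: fam_independent_def)
    have fU: "(\<lambda>x. f x [^]\<^bsub>B\<^esub> c x) \<in> U \<rightarrow> carrier B" for c :: "_ \<Rightarrow> int"
      using U TA by auto
    have ft: "f t \<in> carrier B" using t TA by auto
    have ct: "c t \<noteq> 0"
    proof
      assume ct: "c t = 0"
      have "finprod B (\<lambda>x. f x [^]\<^bsub>B\<^esub> c x) (insert t U) = finprod B (\<lambda>x. f x [^]\<^bsub>B\<^esub> c x) U"
        using fU[of c] finU t ct ft B.finprod_closed[OF fU[of c]] by (subst B.finprod_insert) auto
      with c have "\<forall>x\<in>U. c x = 0" using U(2) unfolding fam_independent_def by metis
      with nz ct show False by auto
    qed
    define c' where "c' = (\<lambda>x. if x \<in> insert t U then c x else 0)"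
    have "finprod B (\<lambda>x. f x [^]\<^bsub>B\<^esub> c' x) T = finprod B (\<lambda>x. f x [^]\<^bsub>B\<^esub> c' x) (insert t U)"
      using t U TA fin by (intro B.finprod_mono_neutral_cong_left[symmetric]) (auto simp: c'_def)
    also have "\<dots> = finprod B (\<lambda>x. f x [^]\<^bsub>B\<^esub> c x) (insert t U)"
      using t U TA by (intro B.finprod_cong') (auto simp: c'_def)
    finally show ?thesis
      using ct t c by (intro exI[of _ c']) (auto simp: c'_def)
  qed
  then have "\<forall>t\<in>T - U. \<exists>c :: _ \<Rightarrow> int. finprod B (\<lambda>x. f x [^]\<^bsub>B\<^esub> c x) T = \<one>\<^bsub>B\<^esub> \<and> c t \<noteq> 0 \<and>
      (\<forall>s\<in>T - U. s \<noteq> t \<longrightarrow> c s = 0)" by blast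
  then obtain C :: "_ \<Rightarrow> _ \<Rightarrow> int" where "\<forall>t\<in>T - U. finprod B (\<lambda>x. f x [^]\<^bsub>B\<^esub> C t x) T = \<one>\<^bsub>B\<^esub> \<and>
      C t t \<noteq> 0 \<and> (\<forall>s\<in>T - U. s \<noteq> t \<longrightarrow> C t s = 0)"
    by (rule bchoice[THEN exE])
  then have C: "\<And>t. t \<in> T - U \<Longrightarrow> finprod B (\<lambda>x. f x [^]\<^bsub>B\<^esub> C t x) T = \<one>\<^bsub>B\<^esub>"
    "\<And>t. t \<in> T - U \<Longrightarrow> C t t \<noteq> 0" "\<And>t s. t \<in> T - U \<Longrightarrow> s \<in> T - U \<Longrightarrow> s \<noteq> t \<Longrightarrow> C t s = 0"
    by blast+
  define e where "e = (\<lambda>t. finprod A (\<lambda>x. x [^]\<^bsub>A\<^esub> C t x) T)"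
  have idT: "(\<lambda>x. x) \<in> T \<rightarrow> carrier A" using TA by auto
  have e: "e t \<in> kernel A B f" if "t \<in> T - U" for t
    using C(1)[OF that] hom_finprod_int_pow[OF A B f idT, of "C t"] TA
    by (auto simp: kernel_def e_def intro!: A.finprod_closed)
  have ind: "fam_independent A e (T - U)"
    unfolding fam_independent_def
  proof (intro conjI allI impI)
    show "finite (T - U)" using fin by auto
    show "e ` (T - U) \<subseteq> carrier A" using e by (auto simp: kernel_def)
  next
    fix d :: "_ \<Rightarrow> int"
    assume "finprod A (\<lambda>i. e i [^]\<^bsub>A\<^esub> d i) (T - U) = \<one>\<^bsub>A\<^esub>"
    then have "finprod A (\<lambda>i. i [^]\<^bsub>A\<^esub> (\<Sum>j\<in>T-U. d j * C j i)) T = \<one>\<^bsub>A\<^esub>"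
      unfolding e_def using A.finprod_int_pow_sum[OF idT, of "T - U" C d] fin by simp
    then have 0: "(\<Sum>j\<in>T-U. d j * C j i) = 0" if "i \<in> T" for i
      using T that unfolding int_independent_def by (elim conjE allE[of _ "\<lambda>i. \<Sum>j\<in>T-U. d j * C j i"]) auto
    show "\<forall>i\<in>T - U. d i = 0"
    proof
      fix i assume i: "i \<in> T - U"
      have "(\<Sum>j\<in>T-U. d j * C j i) = (\<Sum>j\<in>T-U. if j = i then d i * C i i else 0)"
        using C(3) i by (intro sum.cong) auto
      also have "\<dots> = d i * C i i" using fin i by simp
      finally show "d i = 0" using 0[of i] i C(2)[OF i] by auto
    qed
  qed
  show thesis
  proof (rule that)
    show "int_independent A (e ` (T - U))" "int_independent B (f ` U)"
      using A.fam_independent_image[OF ind] B.fam_independent_image[OF U(2)] by auto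
    show "e ` (T - U) \<subseteq> kernel A B f" using e by auto
    show "f ` U \<subseteq> f ` carrier A" using U TA by auto
    have "card T = card (T - U) + card U"
      using U fin finU by (simp add: card_Diff_subset card_mono)
    then show "card T = card (e ` (T - U)) + card (f ` U)"
      using A.fam_independent_image[OF ind] B.fam_independent_image[OF U(2)] by auto
  qed
qed

text \<open>The rank is needed for kernels and images. In an exact sequence these coincide as subsets of one
group, so it is convenient to attach the rank to a subset and never to form the subgroup.\<close>

definition rank_on :: "('a, 'b) monoid_scheme \<Rightarrow> 'a set \<Rightarrow> nat \<Rightarrow> bool" where
  "rank_on G H r \<longleftrightarrow>
     (\<exists>S. int_independent G S \<and> S \<subseteq> H \<and> card S = r) \<and>
     (\<forall>S. int_independent G S \<and> S \<subseteq> H \<longrightarrow> card S \<le> r)"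

lemma has_rank_iff_rank_on: "has_rank G r \<longleftrightarrow> rank_on G (carrier G) r"
  by (auto simp: has_rank_def rank_on_def int_independent_def)

lemma rank_on_unique: "rank_on G H r \<Longrightarrow> rank_on G H r' \<Longrightarrow> r = r'"
  unfolding rank_on_def by (metis le_antisym)

lemma rank_on_ex:
  assumes "Group.group G" "\<And>S. int_independent G S \<Longrightarrow> S \<subseteq> H \<Longrightarrow> card S \<le> n"
  obtains r where "r \<le> n" "rank_on G H r"
proof -
  interpret Group.group G by fact
  have "int_independent G {}"
    by (simp add: int_independent_def)
  then have "\<exists>S. (int_independent G S \<and> S \<subseteq> H) \<and> (\<forall>T. int_independent G T \<and> T \<subseteq> H \<longrightarrow> card T \<le> card S)"
    using assms(2)
    by (intro ex_has_greatest_nat[where k="{}" and b="Suc n"]) (auto simp: le_imp_less_Suc)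
  then obtain S where "int_independent G S" "S \<subseteq> H"
      "\<And>T. int_independent G T \<Longrightarrow> T \<subseteq> H \<Longrightarrow> card T \<le> card S"
    by blast
  then show thesis
    by (intro that[of "card S"]) (auto simp: rank_on_def assms(2))
qed

lemma rank_nullity:
  assumes "comm_group A" "comm_group B" "f \<in> hom A B"
    and "rank_on A (kernel A B f) k" "rank_on B (f ` carrier A) i"
  shows "has_rank A (k + i)"
  unfolding has_rank_def
proof (intro conjI allI impI)
  obtain K L where "int_independent A K" "K \<subseteq> kernel A B f" "card K = k"
      "int_independent B L" "L \<subseteq> f ` carrier A" "card L = i"
    using assms(4,5) by (auto simp: rank_on_def)
  with independent_extension[OF assms(1-3)] show "\<exists>S. int_independent A S \<and> card S = k + i"
    by metis
next
  fix S assume "int_independent A S"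
  from independent_split[OF assms(1-3) this] show "card S \<le> k + i"
    using assms(4,5) unfolding rank_on_def by (metis add_mono)
qed

text \<open>Finiteness of the rank passes to the kernel, whose independent sets are independent in \<open>A\<close>, and to
the image, whose independent sets lift to \<open>A\<close>.\<close>

lemma rank_nullity_obtain:
  assumes "comm_group A" "comm_group B" "f \<in> hom A B" "has_rank A n"
  obtains k i where "rank_on A (kernel A B f) k" "rank_on B (f ` carrier A) i" "n = k + i"
proof -
  interpret A: comm_group A by fact
  interpret B: comm_group B by fact
  have bound: "card S \<le> n" if "int_independent A S" for S
    using assms(4) that by (auto simp: has_rank_def)
  have e: "int_independent A {}" "int_independent B {}"
    by (auto simp: int_independent_def)
  obtain k where k: "rank_on A (kernel A B f) k"
    using rank_on_ex[OF A.is_group, of "kernel A B f" n] bound by blast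
  have "card L \<le> n" if L: "int_independent B L" "L \<subseteq> f ` carrier A" for L
  proof -
    obtain S where "int_independent A S" "card S = card {} + card L"
      by (rule independent_extension[OF assms(1-3) e(1) _ L]) auto
    then show ?thesis using bound[of S] by simp
  qed
  then obtain i where i: "rank_on B (f ` carrier A) i"
    using rank_on_ex[OF B.is_group, of "f ` carrier A" n] by blast
  have "has_rank A (k + i)" using rank_nullity[OF assms(1-3) k i] .
  then have "n = k + i" using assms(4) rank_on_unique by (metis has_rank_iff_rank_on)
  with k i show thesis by (rule that)
qed

lemma rank_on_one:
  assumes "comm_group G" shows "rank_on G {\<one>\<^bsub>G\<^esub>} 0"
proof -
  interpret comm_group G by fact
  have empty: "S = {}" if S: "int_independent G S" "S \<subseteq> {\<one>\<^bsub>G\<^esub>}" for S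
  proof (rule ccontr)
    assume "S \<noteq> {}"
    then have "S = {\<one>\<^bsub>G\<^esub>}" using S(2) by auto
    moreover from this have "finprod G (\<lambda>x. x [^]\<^bsub>G\<^esub> (1::int)) S = \<one>\<^bsub>G\<^esub>"
      by (simp add: int_pow_1)
    ultimately show False using S(1) unfolding int_independent_def
      by (elim conjE allE[of _ "\<lambda>_. 1"]) auto
  qed
  have "int_independent G {}" by (simp add: int_independent_def)
  then show ?thesis
    unfolding rank_on_def by (intro conjI exI[of _ "{}"] allI impI) (auto dest: empty)
qed

lemma has_rank_inj:
  assumes "comm_group A" "comm_group B" "f \<in> hom A B" "inj_on f (carrier A)" "has_rank B n"
  obtains r where "r \<le> n" "has_rank A r"
proof -
  interpret A: comm_group A by fact
  interpret B: comm_group B by fact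
  interpret f: group_hom A B f by unfold_locales fact
  have ker: "kernel A B f = {\<one>\<^bsub>A\<^esub>}"
    using f.inj_iff_trivial_ker assms(4) by auto
  obtain i where i: "i \<le> n" "rank_on B (f ` carrier A) i"
    using rank_on_ex[OF B.is_group, of "f ` carrier A" n] assms(5) by (auto simp: has_rank_def)
  have "has_rank A (0 + i)"
    by (rule rank_nullity[OF assms(1-3) _ i(2)]) (simp add: ker rank_on_one[OF assms(1)])
  with i show thesis by (auto intro: that)
qed

lemma has_rank_iso:
  assumes "comm_group A" "comm_group B" "A \<cong> B" "has_rank A n"
  shows "has_rank B n"
proof -
  have mono: "\<exists>r\<le>m. has_rank P r" if PQ: "comm_group P" "comm_group Q" "P \<cong> Q" "has_rank Q m"
    for P :: "('x, 'y) monoid_scheme" and Q :: "('z, 'w) monoid_scheme" and m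
  proof -
    obtain f where "f \<in> iso P Q" using PQ(3) by (auto simp: is_iso_def)
    then have "f \<in> hom P Q" "inj_on f (carrier P)" by (auto simp: iso_def bij_betw_def)
    from has_rank_inj[OF PQ(1,2) this PQ(4)] show ?thesis by blast
  qed
  interpret A: comm_group A by fact
  have BA: "B \<cong> A" using assms(3) A.iso_sym by blast
  obtain r where r: "r \<le> n" "has_rank B r" using mono[OF assms(2,1) BA assms(4)] by blast
  obtain s where s: "s \<le> r" "has_rank A s" using mono[OF assms(1,2,3) r(2)] by blast
  have "s = n" using s(2) assms(4) by (metis rank_on_unique has_rank_iff_rank_on)
  with r s show ?thesis by (metis le_antisym)
qed

section \<open>Euler characteristics of graded groups\<close>

text \<open>Stated for any sequence of groups, so that it also covers relative homology.\<close>

definition graded_euler :: "(nat \<Rightarrow> ('a, 'b) monoid_scheme) \<Rightarrow> int \<Rightarrow> bool" where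
  "graded_euler G k \<longleftrightarrow>
     (\<exists>\<beta> N. (\<forall>n. has_rank (G n) (\<beta> n)) \<and> (\<forall>n\<ge>N. \<beta> n = 0) \<and>
        k = (\<Sum>n<N. (-1) ^ n * int (\<beta> n)))"

lemma has_euler_characteristic_iff_graded:
  "has_euler_characteristic X k \<longleftrightarrow> graded_euler (\<lambda>n. homology_group (int n) X) k"
  by (simp add: has_euler_characteristic_def graded_euler_def)

lemma alternating_sum_vanishing_tail:
  fixes \<beta> :: "nat \<Rightarrow> nat"
  assumes "\<forall>n\<ge>N. \<beta> n = 0" "N \<le> N'"
  shows "(\<Sum>n<N. (-1) ^ n * int (\<beta> n)) = (\<Sum>n<N'. (-1) ^ n * int (\<beta> n))"
  using assms by (intro sum.mono_neutral_left) auto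

lemma graded_euler_finite_obtain:
  assumes "graded_euler G k"
  obtains \<beta> N where "\<And>n. has_rank (G n) (\<beta> n)" "\<And>n. n \<ge> N \<Longrightarrow> \<beta> n = 0"
    "\<And>N'. N' \<ge> N \<Longrightarrow> k = (\<Sum>n<N'. (-1) ^ n * int (\<beta> n))"
proof -
  obtain \<beta> N where "\<forall>n. has_rank (G n) (\<beta> n)" "\<forall>n\<ge>N. \<beta> n = 0" "k = (\<Sum>n<N. (-1) ^ n * int (\<beta> n))"
    using assms by (auto simp: graded_euler_def)
  then show thesis
    using alternating_sum_vanishing_tail[of N \<beta>] by (intro that[of \<beta> N]) auto
qed

text \<open>Here \<open>k\<close>, \<open>p\<close>, \<open>q\<close> stand for the ranks of the images of the three kinds of maps in a long exact
sequence. Each rank in the sequence is the sum of two neighbours, so the alternating sum telescopes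
and only the last \<open>k\<close> survives.\<close>

lemma alternating_sum_exact:
  fixes k p q a b c :: "nat \<Rightarrow> nat"
  assumes "\<And>n. a n = k n + p n" "\<And>n. b n = p n + q n" "c 0 = q 0" "\<And>n. c (Suc n) = q (Suc n) + k n"
  shows "(\<Sum>n<Suc N. (-1) ^ n * int (b n)) =
    (\<Sum>n<Suc N. (-1) ^ n * int (a n)) + (\<Sum>n<Suc N. (-1) ^ n * int (c n)) - (-1) ^ N * int (k N)"
proof (induction N)
  case 0
  then show ?case using assms by simp
next
  case (Suc N)
  then show ?case
    by (simp only: sum.lessThan_Suc[of _ "Suc N"] assms(1,2,4)) (simp add: algebra_simps)
qed

text \<open>A long exact sequence ending in \<open>B 0 \<rightarrow> C 0 \<rightarrow> 0\<close>.\<close>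

locale long_exact =
  fixes A :: "nat \<Rightarrow> 'a monoid" and B :: "nat \<Rightarrow> 'b monoid" and C :: "nat \<Rightarrow> 'c monoid"
    and i :: "nat \<Rightarrow> 'a \<Rightarrow> 'b" and j :: "nat \<Rightarrow> 'b \<Rightarrow> 'c" and d :: "nat \<Rightarrow> 'c \<Rightarrow> 'a"
  assumes comm: "comm_group (A n)" "comm_group (B n)" "comm_group (C n)"
    and hom: "i n \<in> hom (A n) (B n)" "j n \<in> hom (B n) (C n)" "d n \<in> hom (C (Suc n)) (A n)"
    and exact_A: "kernel (A n) (B n) (i n) = d n ` carrier (C (Suc n))"
    and exact_B: "kernel (B n) (C n) (j n) = i n ` carrier (A n)"
    and exact_C: "kernel (C (Suc n)) (A n) (d n) = j (Suc n) ` carrier (B (Suc n))"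
    and epi: "j 0 ` carrier (B 0) = carrier (C 0)"
begin

text \<open>Rank and nullity of the maps out of \<open>A\<close> and \<open>C\<close> give the ranks of the images of all three kinds of
maps, and those give the ranks of \<open>B\<close>. The sum is cut off behind the last non-zero rank of
\<open>A\<close> and \<open>C\<close>, where the boundary term of the telescoping sum vanishes.\<close>

lemma euler_middle:
  assumes "graded_euler A x" "graded_euler C y"
  shows "graded_euler B (x + y)"
proof -
  obtain a N where a: "\<And>n. has_rank (A n) (a n)" "\<And>n. n \<ge> N \<Longrightarrow> a n = 0"
      "\<And>N'. N' \<ge> N \<Longrightarrow> x = (\<Sum>n<N'. (-1) ^ n * int (a n))"
    using graded_euler_finite_obtain[OF assms(1)] by metis
  obtain c M where c: "\<And>n. has_rank (C n) (c n)" "\<And>n. n \<ge> M \<Longrightarrow> c n = 0"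
      "\<And>N'. N' \<ge> M \<Longrightarrow> y = (\<Sum>n<N'. (-1) ^ n * int (c n))"
    using graded_euler_finite_obtain[OF assms(2)] by metis
  have "\<exists>k p. rank_on (A n) (kernel (A n) (B n) (i n)) k \<and> rank_on (B n) (i n ` carrier (A n)) p \<and> a n = k + p" for n
    using rank_nullity_obtain[OF comm(1,2) hom(1) a(1)] by metis
  then obtain k p where kp: "\<And>n. rank_on (A n) (kernel (A n) (B n) (i n)) (k n)"
     "\<And>n. rank_on (B n) (i n ` carrier (A n)) (p n)" "\<And>n. a n = k n + p n" by metis
  have "\<exists>q. rank_on (C (Suc n)) (kernel (C (Suc n)) (A n) (d n)) q \<and> c (Suc n) = q + k n" for n
    using rank_nullity_obtain[OF comm(3,1) hom(3) c(1)] kp(1)[of n] rank_on_unique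
    unfolding exact_A by metis
  then obtain q' where q': "\<And>n. rank_on (C (Suc n)) (j (Suc n) ` carrier (B (Suc n))) (q' n)"
      "\<And>n. c (Suc n) = q' n + k n" unfolding exact_C by metis
  define q where "q = case_nat (c 0) q'"
  have q: "rank_on (C n) (j n ` carrier (B n)) (q n)" for n
    using q'(1) c(1)[of 0] by (cases n) (auto simp: q_def epi has_rank_iff_rank_on)
  have b: "has_rank (B n) (p n + q n)" for n
    using rank_nullity[OF comm(2,3) hom(2) _ q] kp(2) exact_B by metis
  define L where "L = Suc (max N M)"
  have L: "N \<le> L" "M \<le> L" "N \<le> max N M" by (auto simp: L_def)
  have "(\<Sum>n<L. (-1) ^ n * int (p n + q n)) = (\<Sum>n<L. (-1) ^ n * int (a n)) + (\<Sum>n<L. (-1) ^ n * int (c n))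
     - (-1) ^ max N M * int (k (max N M))"
    unfolding L_def using q'(2) kp(3)
    by (intro alternating_sum_exact[where p=p and q=q]) (auto simp: q_def)
  also have "\<dots> = x + y" using a(3)[OF L(1)] c(3)[OF L(2)] a(2)[OF L(3)] kp(3)[of "max N M"] by simp
  finally have sum: "x + y = (\<Sum>n<L. (-1) ^ n * int (p n + q n))" by simp
  have "p n + q n = 0" if "n \<ge> L" for n
    using a(2)[of n] c(2)[of n] kp(3)[of n] q'(2)[of "n-1"] L that by (cases n) (auto simp: q_def)
  then show ?thesis unfolding graded_euler_def using b sum
    by (intro exI[of _ "\<lambda>n. p n + q n"] exI[of _ L]) auto
qed

lemma euler_last:
  assumes "graded_euler A x" "graded_euler B y"
  shows "graded_euler C (y - x)"
proof -
  obtain a N where a: "\<And>n. has_rank (A n) (a n)" "\<And>n. n \<ge> N \<Longrightarrow> a n = 0"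
      "\<And>N'. N' \<ge> N \<Longrightarrow> x = (\<Sum>n<N'. (-1) ^ n * int (a n))"
    using graded_euler_finite_obtain[OF assms(1)] by metis
  obtain b M where b: "\<And>n. has_rank (B n) (b n)" "\<And>n. n \<ge> M \<Longrightarrow> b n = 0"
      "\<And>N'. N' \<ge> M \<Longrightarrow> y = (\<Sum>n<N'. (-1) ^ n * int (b n))"
    using graded_euler_finite_obtain[OF assms(2)] by metis
  have "\<exists>k p. rank_on (A n) (kernel (A n) (B n) (i n)) k \<and> rank_on (B n) (i n ` carrier (A n)) p \<and> a n = k + p" for n
    using rank_nullity_obtain[OF comm(1,2) hom(1) a(1)] by metis
  then obtain k p where kp: "\<And>n. rank_on (A n) (kernel (A n) (B n) (i n)) (k n)"
     "\<And>n. rank_on (B n) (i n ` carrier (A n)) (p n)" "\<And>n. a n = k n + p n" by metis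
  have "\<exists>q. rank_on (C n) (j n ` carrier (B n)) q \<and> b n = p n + q" for n
    using rank_nullity_obtain[OF comm(2,3) hom(2) b(1)] kp(2)[of n] rank_on_unique
    unfolding exact_B by metis
  then obtain q where q: "\<And>n. rank_on (C n) (j n ` carrier (B n)) (q n)" "\<And>n. b n = p n + q n"
    by metis
  define c where "c = (\<lambda>n. q n + (case n of 0 \<Rightarrow> 0 | Suc m \<Rightarrow> k m))"
  have c: "has_rank (C n) (c n)" for n
  proof (cases n)
    case 0
    then show ?thesis using q(1)[of 0] by (simp add: c_def epi has_rank_iff_rank_on)
  next
    case (Suc m)
    then show ?thesis
      using rank_nullity[OF comm(3,1) hom(3), of m "q (Suc m)" "k m"] q(1)[of "Suc m"] kp(1)[of m]
      by (simp add: c_def exact_A exact_C)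
  qed
  define L where "L = Suc (max N M)"
  have L: "N \<le> L" "M \<le> L" "N \<le> max N M" by (auto simp: L_def)
  have "(\<Sum>n<L. (-1) ^ n * int (b n)) = (\<Sum>n<L. (-1) ^ n * int (a n)) + (\<Sum>n<L. (-1) ^ n * int (c n))
     - (-1) ^ max N M * int (k (max N M))"
    unfolding L_def by (rule alternating_sum_exact[where p=p and q=q]) (auto simp: q(2) kp(3) c_def)
  then have sum: "y - x = (\<Sum>n<L. (-1) ^ n * int (c n))"
    using a(3)[OF L(1)] b(3)[OF L(2)] a(2)[OF L(3)] kp(3)[of "max N M"] by simp
  have "c n = 0" if "n \<ge> L" for n
    using that a(2)[of "n-1"] b(2)[of n] kp(3)[of "n-1"] q(2)[of n] L by (cases n) (auto simp: c_def L_def)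
  then show ?thesis unfolding graded_euler_def using c sum
    by (intro exI[of _ c] exI[of _ L]) auto
qed

end

section \<open>Euler characteristics of spaces\<close>

text \<open>The homology sequence of a pair ends in degree \<open>0\<close> because homology vanishes in degree \<open>- 1\<close>.\<close>

lemma long_exact_pair:
  "long_exact (\<lambda>n. homology_group (int n) (subtopology X S)) (\<lambda>n. homology_group (int n) X)
     (\<lambda>n. relative_homology_group (int n) X S)
     (\<lambda>n. hom_induced (int n) (subtopology X S) {} X {} id)
     (\<lambda>n. hom_induced (int n) X {} X S id)
     (\<lambda>n. hom_boundary (int (Suc n)) X S)"
proof (rule long_exact.intro)
  fix n
  show "comm_group (homology_group (int n) (subtopology X S))" "comm_group (homology_group (int n) X)"
    "comm_group (relative_homology_group (int n) X S)" by simp_all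
  show "hom_induced (int n) (subtopology X S) {} X {} id \<in> hom (homology_group (int n) (subtopology X S)) (homology_group (int n) X)"
       "hom_induced (int n) X {} X S id \<in> hom (homology_group (int n) X) (relative_homology_group (int n) X S)"
    by (simp_all add: hom_induced_hom)
  show "hom_boundary (int (Suc n)) X S \<in> hom (relative_homology_group (int (Suc n)) X S) (homology_group (int n) (subtopology X S))"
    using hom_boundary_hom[of "int (Suc n)" X S] by simp
  show "kernel (homology_group (int n) (subtopology X S)) (homology_group (int n) X) (hom_induced (int n) (subtopology X S) {} X {} id)
     = hom_boundary (int (Suc n)) X S ` carrier (relative_homology_group (int (Suc n)) X S)"
    using homology_exactness_axiom_2[of "int (Suc n)" X S] by simp
  show "kernel (homology_group (int n) X) (relative_homology_group (int n) X S) (hom_induced (int n) X {} X S id)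
     = hom_induced (int n) (subtopology X S) {} X {} id ` carrier (homology_group (int n) (subtopology X S))"
    using homology_exactness_axiom_3[of "int n" X S] by simp
  show "kernel (relative_homology_group (int (Suc n)) X S) (homology_group (int n) (subtopology X S)) (hom_boundary (int (Suc n)) X S)
     = hom_induced (int (Suc n)) X {} X S id ` carrier (homology_group (int (Suc n)) X)"
    using homology_exactness_axiom_1[of "int (Suc n)" X S] by simp
next
  have "trivial_group (homology_group (-1) (subtopology X S))"
    by (rule trivial_relative_homology_group) simp
  then have "carrier (homology_group (-1) (subtopology X S)) = {\<one>\<^bsub>homology_group (-1) (subtopology X S)\<^esub>}"
    by (auto simp: trivial_group_def)
  then have "kernel (relative_homology_group 0 X S) (homology_group (-1) (subtopology X S)) (hom_boundary 0 X S) =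
     carrier (relative_homology_group 0 X S)"
    unfolding kernel_def using hom_carrier[OF hom_boundary_hom[of 0 X S]] by (simp only: diff_0) blast
  then show "hom_induced (int 0) X {} X S id ` carrier (homology_group (int 0) X) = carrier (relative_homology_group (int 0) X S)"
    using homology_exactness_axiom_1[of 0 X S] by simp
qed

lemma graded_euler_iso:
  assumes "\<And>n. comm_group (A n)" "\<And>n. comm_group (B n)" "\<And>n. A n \<cong> B n" "graded_euler A k"
  shows "graded_euler B k"
proof -
  obtain b N where b: "\<And>n. has_rank (A n) (b n)" "\<forall>n\<ge>N. b n = 0" "k = (\<Sum>n<N. (-1) ^ n * int (b n))"
    using assms(4) unfolding graded_euler_def by metis
  have "has_rank (B n) (b n)" for n
    using has_rank_iso[OF assms(1,2,3) b(1)] .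
  with b(2,3) show ?thesis
    unfolding graded_euler_def by (intro exI[of _ b] exI[of _ N]) simp
qed

lemma graded_euler_unique:
  assumes "graded_euler G k" "graded_euler G k'"
  shows "k = k'"
proof -
  obtain b N where b: "\<And>n. has_rank (G n) (b n)" "\<And>N'. N' \<ge> N \<Longrightarrow> k = (\<Sum>n<N'. (-1) ^ n * int (b n))"
    using graded_euler_finite_obtain[OF assms(1)] by metis
  obtain b' N' where b': "\<And>n. has_rank (G n) (b' n)" "\<And>M. M \<ge> N' \<Longrightarrow> k' = (\<Sum>n<M. (-1) ^ n * int (b' n))"
    using graded_euler_finite_obtain[OF assms(2)] by metis
  have "b = b'" using b(1) b'(1) rank_on_unique by (metis has_rank_iff_rank_on ext)
  then show ?thesis using b(2)[of "max N N'"] b'(2)[of "max N N'"] by simp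
qed

lemma has_euler_characteristic_unique:
  "has_euler_characteristic X k \<Longrightarrow> has_euler_characteristic X k' \<Longrightarrow> k = k'"
  unfolding has_euler_characteristic_iff_graded by (rule graded_euler_unique)

lemma has_euler_characteristic_homotopy_equivalent:
  assumes "X homotopy_equivalent_space Y" "has_euler_characteristic X k"
  shows "has_euler_characteristic Y k"
  using assms(2) unfolding has_euler_characteristic_iff_graded
  by (rule graded_euler_iso[rotated -1])
    (simp_all add: homotopy_equivalent_space_imp_isomorphic_homology_groups[OF assms(1)])

lemma has_rank_trivial_group:
  assumes "comm_group G" "trivial_group G" shows "has_rank G 0"
  using rank_on_one[OF assms(1)] assms(2) by (simp add: has_rank_iff_rank_on trivial_group_def)

lemma has_euler_characteristic_empty:
  assumes "topspace X = {}" shows "has_euler_characteristic X 0"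
proof -
  have "has_rank (homology_group (int n) X) 0" for n
    by (intro has_rank_trivial_group) (auto intro: trivial_homology_group_empty simp: assms)
  then show ?thesis
    unfolding has_euler_characteristic_def by (intro exI[of _ "\<lambda>_. 0"] exI[of _ 0]) auto
qed

text \<open>Two integers \<open>x\<close>, \<open>y\<close> always satisfy the relation \<open>y * x - x * y = 0\<close>.\<close>

lemma independent_integer_group:
  assumes "int_independent integer_group S" shows "card S \<le> 1"
proof (rule ccontr)
  interpret comm_group integer_group by (rule abelian_integer_group)
  assume "\<not> card S \<le> 1"
  then obtain x y where xy: "x \<in> S" "y \<in> S" "x \<noteq> y"
    by (metis card_le_Suc0_iff_eq One_nat_def assms int_independent_def)
  have fin: "finite S" using assms by (simp add: int_independent_def)
  have sum: "finprod integer_group f S = sum f S" if "finite S" for f S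
    using that by induction auto
  define c where "c = (\<lambda>z. if z = x then y else if z = y then -x else 0)"
  have "(\<Sum>z\<in>S. z * c z) = (\<Sum>z\<in>{x,y}. z * c z)"
    using xy fin by (intro sum.mono_neutral_right) (auto simp: c_def)
  also have "\<dots> = 0" using xy by (simp add: c_def)
  finally have "\<forall>z\<in>S. c z = 0"
    using assms fin by (simp add: int_independent_def sum mult.commute)
  then have "y = 0" "x = 0" using xy by (auto simp: c_def split: if_splits)
  with xy show False by simp
qed

lemma has_euler_characteristic_contractible:
  assumes "contractible_space X" shows "\<exists>k. has_euler_characteristic X k"
proof (cases "topspace X = {}")
  case True
  then show ?thesis using has_euler_characteristic_empty by blast
next
  case False
  then obtain a where "a \<in> topspace X" "X homotopy_equivalent_space (subtopology X {a})"
    using assms unfolding contractible_eq_homotopy_equivalent_singleton_subtopology by auto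
  then have eq: "subtopology X {a} homotopy_equivalent_space X" and top: "topspace (subtopology X {a}) = {a}"
    by (simp_all add: homotopy_equivalent_space_sym[of _ X])
  interpret Z: comm_group integer_group by (rule abelian_integer_group)
  obtain r where "has_rank integer_group r"
    using rank_on_ex[OF Z.is_group, of "carrier integer_group" 1] independent_integer_group
    by (metis has_rank_iff_rank_on)
  moreover have "integer_group \<cong> homology_group 0 (subtopology X {a})"
    using homology_coefficients[OF top] group.iso_sym[OF group_relative_homology_group] by blast
  ultimately have "has_rank (homology_group (int 0) (subtopology X {a})) r"
    using has_rank_iso[OF abelian_integer_group abelian_relative_homology_group] by simp
  moreover have "has_rank (homology_group (int n) (subtopology X {a})) 0" if "n > 0" for n
    using that by (intro has_rank_trivial_group homology_dimension_axiom[OF top]) auto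
  ultimately have "has_euler_characteristic (subtopology X {a}) (int r)"
    unfolding has_euler_characteristic_def
    by (intro exI[of _ "\<lambda>n. if n = 0 then r else 0"] exI[of _ 1]) auto
  then show ?thesis using has_euler_characteristic_homotopy_equivalent[OF eq] by blast
qed

text \<open>Excision of the complement of \<open>B\<close> identifies the homology of \<open>(B, A \<inter> B)\<close> with that of \<open>(X, A)\<close>.
Hence \<open>\<chi>(X) = \<chi>(A) + \<chi>(X, A) = \<chi>(A) + (\<chi>(B) - \<chi>(A \<inter> B))\<close>, and the existence of the terms on the
right gives the existence of \<open>\<chi>(X)\<close>.\<close>

lemma mayer_vietoris_euler_cover:
  assumes "openin X A" "openin X B" "A \<union> B = topspace X"
    and "has_euler_characteristic (subtopology X A) a"
    and "has_euler_characteristic (subtopology X B) b"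
    and "has_euler_characteristic (subtopology X (A \<inter> B)) c"
  shows "has_euler_characteristic X (a + b - c)"
proof -
  have sub: "A \<subseteq> topspace X" "B \<subseteq> topspace X" using assms openin_subset by auto
  have "subtopology (subtopology X B) (A \<inter> B) = subtopology X (A \<inter> B)"
    by (simp add: subtopology_subtopology Int_absorb1)
  then have rel: "graded_euler (\<lambda>n. relative_homology_group (int n) (subtopology X B) (A \<inter> B)) (b - c)"
    using long_exact.euler_last[OF long_exact_pair[of "subtopology X B" "A \<inter> B"]] assms(5,6)
    unfolding has_euler_characteristic_iff_graded by simp
  define U where "U = topspace X - B"
  have "closedin X U" using assms(2) by (auto simp: U_def)
  then have "X closure_of U \<subseteq> X interior_of A"
    using assms(1,3) by (auto simp: closure_of_closedin interior_of_openin U_def)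
  moreover have "topspace X - U = B" "A - U = A \<inter> B" using sub by (auto simp: U_def)
  ultimately have "relative_homology_group p (subtopology X B) (A \<inter> B) \<cong> relative_homology_group p X A" for p
    using homology_excision_axiom[of X U A "topspace X" p] sub unfolding is_iso_def by auto
  with rel have "graded_euler (\<lambda>n. relative_homology_group (int n) X A) (b - c)"
    by (intro graded_euler_iso[OF _ _ _ rel]) auto
  then have "graded_euler (\<lambda>n. homology_group (int n) X) (a + (b - c))"
    using long_exact.euler_middle[OF long_exact_pair[of X A]] assms(4)
    unfolding has_euler_characteristic_iff_graded by blast
  then show ?thesis unfolding has_euler_characteristic_iff_graded by (simp add: algebra_simps)
qed

lemma mayer_vietoris_euler:
  assumes "openin X A" "openin X B"
    and "has_euler_characteristic (subtopology X A) a"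
    and "has_euler_characteristic (subtopology X B) b"
    and "has_euler_characteristic (subtopology X (A \<inter> B)) c"
  shows "has_euler_characteristic (subtopology X (A \<union> B)) (a + b - c)"
proof (rule mayer_vietoris_euler_cover)
  have sub: "A \<subseteq> topspace X" "B \<subseteq> topspace X" using assms openin_subset by auto
  show "openin (subtopology X (A \<union> B)) A" "openin (subtopology X (A \<union> B)) B"
    using assms by (auto simp: openin_subtopology)
  show "A \<union> B = topspace (subtopology X (A \<union> B))" using sub by auto
  have "(A \<union> B) \<inter> A = A" "(A \<union> B) \<inter> B = B" "(A \<union> B) \<inter> (A \<inter> B) = A \<inter> B" by auto
  then show "has_euler_characteristic (subtopology (subtopology X (A \<union> B)) A) a"
    "has_euler_characteristic (subtopology (subtopology X (A \<union> B)) B) b"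
    "has_euler_characteristic (subtopology (subtopology X (A \<union> B)) (A \<inter> B)) c"
    using assms(3-5) by (simp_all only: subtopology_subtopology)
qed

text \<open>Induction on the number of sets: if \<open>B\<close> is one of them, then \<open>B\<close> meets the union of the others in
a union of one set fewer, again from \<open>\<B>\<close>.\<close>

lemma euler_finite_union:
  assumes opn: "\<And>B. B \<in> \<B> \<Longrightarrow> openin X B"
    and int: "\<And>B C. B \<in> \<B> \<Longrightarrow> C \<in> \<B> \<Longrightarrow> B \<inter> C \<in> \<B>"
    and fin: "\<And>B. B \<in> \<B> \<Longrightarrow> \<exists>k. has_euler_characteristic (subtopology X B) k"
    and "finite F" "F \<subseteq> \<B>"
  shows "\<exists>k. has_euler_characteristic (subtopology X (\<Union>F)) k"
proof -
  have "finite F \<Longrightarrow> card F \<le> n \<Longrightarrow> F \<subseteq> \<B> \<Longrightarrow> \<exists>k. has_euler_characteristic (subtopology X (\<Union>F)) k" for n F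
  proof (induction n arbitrary: F)
    case 0
    then have "topspace (subtopology X (\<Union>F)) = {}" by auto
    then show ?case using has_euler_characteristic_empty by blast
  next
    case (Suc n)
    show ?case
    proof (cases "F = {}")
      case True
      then have "topspace (subtopology X (\<Union>F)) = {}" by auto
      then show ?thesis using has_euler_characteristic_empty by blast
    next
      case False
      then obtain B F' where F: "F = insert B F'" "B \<notin> F'" by (meson ex_in_conv mk_disjoint_insert)
      then have F': "finite F'" "card F' \<le> n" "F' \<subseteq> \<B>" and B: "B \<in> \<B>" using Suc by auto
      have "finite ((\<inter>) B ` F')" "card ((\<inter>) B ` F') \<le> n" "(\<inter>) B ` F' \<subseteq> \<B>"
        using F' B int card_image_le[OF F'(1), of "(\<inter>) B"] by auto
      then obtain c where "has_euler_characteristic (subtopology X (\<Union>((\<inter>) B ` F'))) c"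
        using Suc.IH by blast
      moreover have "\<Union>((\<inter>) B ` F') = B \<inter> \<Union>F'" by auto
      moreover obtain a where "has_euler_characteristic (subtopology X B) a" using fin B by blast
      moreover obtain b where "has_euler_characteristic (subtopology X (\<Union>F')) b"
        using Suc.IH F' by blast
      moreover have "openin X (\<Union>F')" using opn F' by auto
      ultimately have "has_euler_characteristic (subtopology X (B \<union> \<Union>F')) (a + b - c)"
        using mayer_vietoris_euler[OF opn[OF B]] by simp
      moreover have "\<Union>F = B \<union> \<Union>F'" using F by auto
      ultimately show ?thesis by metis
    qed
  qed
  then show ?thesis using assms by blast
qed

text \<open>The inclusion of a retract is injective on homology, so the Betti numbers of \<open>F\<close> are bounded by
those of \<open>K\<close>.\<close>

lemma euler_retract:
  assumes "F retract_of_space K" "has_euler_characteristic K k"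
  shows "\<exists>k'. has_euler_characteristic (subtopology K F) k'"
proof -
  obtain b N where b: "\<And>n. has_rank (homology_group (int n) K) (b n)" "\<And>n. n \<ge> N \<Longrightarrow> b n = 0"
    using assms(2) unfolding has_euler_characteristic_def by blast
  have "\<exists>r\<le>b n. has_rank (homology_group (int n) (subtopology K F)) r" for n
    using has_rank_inj[OF _ _ hom_induced_hom inj_on_hom_induced_inclusion b(1)] assms(1)
      abelian_relative_homology_group by (metis (no_types, lifting))
  then obtain r where "\<And>n. r n \<le> b n" "\<And>n. has_rank (homology_group (int n) (subtopology K F)) (r n)"
    by metis
  moreover from this(1) have "r n = 0" if "n \<ge> N" for n
    using b(2)[OF that] by (metis le_zero_eq)
  ultimately have "has_euler_characteristic (subtopology K F) (\<Sum>n<N. (-1) ^ n * int (r n))"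
    unfolding has_euler_characteristic_def by (intro exI[of _ r] exI[of _ N]) auto
  then show ?thesis ..
qed

text \<open>By compactness \<open>F\<close> lies in a union \<open>K\<close> of finitely many basic sets inside \<open>W\<close>, and the retraction
of \<open>W\<close> restricts to one of \<open>K\<close>. This replaces triangulability or a cell structure of \<open>F\<close>.\<close>

lemma euler_compact_neighbourhood_retract:
  assumes opn: "\<And>B. B \<in> \<B> \<Longrightarrow> openin X B"
    and int: "\<And>B C. B \<in> \<B> \<Longrightarrow> C \<in> \<B> \<Longrightarrow> B \<inter> C \<in> \<B>"
    and fin: "\<And>B. B \<in> \<B> \<Longrightarrow> \<exists>k. has_euler_characteristic (subtopology X B) k"
    and base: "\<And>x W. openin X W \<Longrightarrow> x \<in> W \<Longrightarrow> \<exists>B\<in>\<B>. x \<in> B \<and> B \<subseteq> W"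
    and "compactin X F" "openin X W" "F retract_of_space (subtopology X W)"
  shows "\<exists>k. has_euler_characteristic (subtopology X F) k"
proof -
  have FW: "F \<subseteq> W" using assms(7) by (auto simp: retract_of_space_def)
  obtain \<F> where \<F>: "finite \<F>" "\<F> \<subseteq> {B \<in> \<B>. B \<subseteq> W}" "F \<subseteq> \<Union>\<F>"
  proof -
    have "F \<subseteq> \<Union>{B \<in> \<B>. B \<subseteq> W}" using base[OF assms(6)] FW by fastforce
    then show thesis
      using compactinD[OF assms(5), of "{B \<in> \<B>. B \<subseteq> W}"] opn that by auto
  qed
  define K where "K = \<Union>\<F>"
  have KW: "K \<subseteq> W" using \<F> by (auto simp: K_def)
  obtain k where "has_euler_characteristic (subtopology X K) k"
    using euler_finite_union[OF opn int fin \<F>(1)] \<F>(2) unfolding K_def by blast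
  moreover have "F retract_of_space (subtopology X K)"
  proof -
    obtain r where r: "continuous_map (subtopology X W) (subtopology (subtopology X W) F) r" "\<And>x. x \<in> F \<Longrightarrow> r x = x"
      using assms(7) by (auto simp: retract_of_space_def)
    have "continuous_map (subtopology X K) (subtopology (subtopology X W) F) r"
      using continuous_map_from_subtopology_mono[OF r(1) KW] .
    moreover have "W \<inter> F = F" "K \<inter> F = F" using FW \<F> by (auto simp: K_def)
    ultimately show ?thesis
      using r(2) compactin_subset_topspace[OF assms(5)]
      by (auto simp: retract_of_space_def subtopology_subtopology)
  qed
  moreover have "subtopology (subtopology X K) F = subtopology X F"
    using \<F>(3) by (simp add: subtopology_subtopology K_def Int_absorb1)
  ultimately show ?thesis using euler_retract by metis
qed

section \<open>Fibrations over the circle\<close>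

lemma contractible_prod_homotopy_equivalent:
  assumes "contractible_space X" "topspace X \<noteq> {}"
  shows "prod_topology X Y homotopy_equivalent_space Y"
proof -
  obtain a where a: "homotopic_with (\<lambda>x. True) X X id (\<lambda>x. a)"
    using assms(1) by (auto simp: contractible_space_def)
  then have aX: "a \<in> topspace X"
    using assms(2) homotopic_with_imp_continuous_maps[OF a] by (auto simp: continuous_map_def Pi_iff)
  have "homotopic_with (\<lambda>x. True) (prod_topology X Y) (prod_topology X Y)
      (\<lambda>z. (id (fst z), id (snd z))) (\<lambda>z. (a, id (snd z)))"
    by (rule homotopic_with_prod_topology[OF a, where q="\<lambda>_. True"]) auto
  then have "homotopic_with (\<lambda>x. True) (prod_topology X Y) (prod_topology X Y) ((\<lambda>y. (a, y)) \<circ> snd) id"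
    by (simp add: homotopic_with_sym o_def id_def)
  moreover have "continuous_map Y (prod_topology X Y) (\<lambda>y. (a, y))"
    using aX by (auto intro!: continuous_map_pairedI simp: continuous_map_const)
  ultimately show ?thesis
    unfolding homotopy_equivalent_space_def
    by (intro exI[of _ snd] exI[of _ "\<lambda>y. (a, y)"]) (auto simp: o_def id_def continuous_map_snd)
qed

text \<open>The complex exponential is a covering of the punctured plane and therefore open; the circle is cut
out by the real part.\<close>

lemma openin_circle_cis_image:
  assumes "open W" shows "openin (top_of_set (sphere (0::complex) 1)) (cis ` W)"
proof -
  have "open {z::complex. Im z \<in> W}"
    using open_vimage[OF assms continuous_on_Im[OF continuous_on_id]] by (simp add: vimage_def)
  then have "openin (top_of_set (- {0})) (exp ` {z::complex. Im z \<in> W})"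
    using covering_space_open_map[OF covering_space_exp_punctured_plane] by simp
  then have "open (exp ` {z::complex. Im z \<in> W})"
    using openin_open_eq[of "-{0::complex}"] by auto
  moreover have "cis ` W = sphere 0 1 \<inter> exp ` {z::complex. Im z \<in> W}"
  proof (intro equalityI subsetI)
    fix w assume "w \<in> cis ` W"
    then show "w \<in> sphere 0 1 \<inter> exp ` {z::complex. Im z \<in> W}"
      by (auto simp: cis_conv_exp intro!: imageI)
  next
    fix w assume w: "w \<in> sphere 0 1 \<inter> exp ` {z::complex. Im z \<in> W}"
    then obtain z where z: "w = exp z" "Im z \<in> W" "norm (exp z) = 1" by auto
    then have "w = cis (Im z)" using norm_exp_imaginary[OF z(3)] by (simp add: exp_eq_polar)
    with z show "w \<in> cis ` W" by blast
  qed
  ultimately show ?thesis by (simp only: openin_open_Int)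
qed

lemma inj_on_cis_interval:
  assumes "t - s \<le> 2 * pi" shows "inj_on cis {s<..<t}"
proof (rule inj_onI)
  fix x y assume xy: "x \<in> {s<..<t}" "y \<in> {s<..<t}" "cis x = cis y"
  then obtain n :: int where n: "y = x + 2 * pi * n"
    using sin_cos_eq_iff[of y x] by (auto simp: complex_eq_iff)
  with xy assms have "\<bar>2 * pi * n\<bar> < 2 * pi" by auto
  then have "n = 0" by (auto simp: abs_mult)
  with n show "x = y" by simp
qed

lemma contractible_arc:
  assumes "t - s \<le> 2 * pi"
  shows "contractible_space (subtopology (top_of_set (sphere 0 1)) (cis ` {s<..<t}))"
proof -
  have sub: "sphere 0 1 \<inter> cis ` {s<..<t} = cis ` {s<..<t}" by auto
  have "openin (top_of_set (cis ` {s<..<t})) (cis ` U)" if "openin (top_of_set {s<..<t}) U" for U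
  proof -
    have "open U" "U \<subseteq> {s<..<t}" using that openin_open_eq[of "{s<..<t}" U] by auto
    then show ?thesis
      by (intro openin_subset_trans[OF openin_circle_cis_image]) (auto simp: image_mono)
  qed
  then obtain g where "homeomorphism {s<..<t} (cis ` {s<..<t}) cis g"
    using homeomorphism_injective_open_map[of "{s<..<t}" cis "cis ` {s<..<t}"] inj_on_cis_interval[OF assms]
      continuous_on_cis[OF continuous_on_id] by metis
  then have "contractible (cis ` {s<..<t})"
    using homeomorphic_contractible homeomorphic_def convex_imp_contractible convex_real_interval(8) by metis
  then show ?thesis by (simp add: subtopology_subtopology sub)
qed

lemma dist_cis_le: "dist (cis x) (cis y) \<le> \<bar>x - y\<bar>"
proof -
  have "cis x = cis y * cis (x - y)" by (simp add: cis_mult)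
  then have "cis x - cis y = cis y * (exp (\<i> * of_real (x - y)) - 1)"
    by (simp only: cis_conv_exp[of "x - y"]) (simp add: right_diff_distrib)
  then have "dist (cis x) (cis y) = 2 * \<bar>sin ((x - y) / 2)\<bar>"
    by (simp only: dist_norm norm_mult norm_cis dist_exp_i_1 mult_1)
  also have "\<dots> \<le> 2 * \<bar>(x - y) / 2\<bar>"
    using abs_sin_x_le_abs_x[of "(x - y) / 2"] by linarith
  finally show ?thesis by simp
qed

text \<open>A trivialisation over \<open>U\<close> restricts to one over \<open>V\<close>, and a contractible factor does not change the
homotopy type. Both small arcs and single points are used for \<open>V\<close>.\<close>

lemma locally_trivial_part_homotopy_equivalent_fibre:
  assumes h: "homeomorphic_map (subtopology E {e \<in> topspace E. p e \<in> U}) (prod_topology (subtopology B U) F) h"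
    and fst: "\<And>e. e \<in> topspace E \<Longrightarrow> p e \<in> U \<Longrightarrow> fst (h e) = p e"
    and V: "V \<subseteq> U" "V \<subseteq> topspace B" "V \<noteq> {}" "contractible_space (subtopology B V)"
  shows "subtopology E {e \<in> topspace E. p e \<in> V} homotopy_equivalent_space F"
proof -
  have "homeomorphic_map (subtopology (subtopology E {e \<in> topspace E. p e \<in> U}) {e. p e \<in> V})
    (subtopology (prod_topology (subtopology B U) F) (V \<times> UNIV)) h"
    by (rule homeomorphic_map_subtopologies_alt[OF h]) (auto simp: fst mem_Times_iff)
  moreover have "subtopology (subtopology E {e \<in> topspace E. p e \<in> U}) {e. p e \<in> V} = subtopology E {e \<in> topspace E. p e \<in> V}"
    unfolding subtopology_subtopology using V(1) by (intro arg_cong2[where f=subtopology]) auto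
  moreover have "subtopology (prod_topology (subtopology B U) F) (V \<times> UNIV) = prod_topology (subtopology B V) F"
    unfolding subtopology_Times subtopology_subtopology using V(1) by (simp add: Int_absorb1)
  ultimately have "subtopology E {e \<in> topspace E. p e \<in> V} homotopy_equivalent_space prod_topology (subtopology B V) F"
    using homeomorphic_imp_homotopy_equivalent_space homeomorphic_map_imp_homeomorphic_space by metis
  moreover have "prod_topology (subtopology B V) F homotopy_equivalent_space F"
    using V by (intro contractible_prod_homotopy_equivalent) auto
  ultimately show ?thesis by (rule homotopy_eqv_trans)
qed

text \<open>All fibres have the same Euler characteristic \<open>\<phi>\<close>, since it is locally constant on the connected
circle. By the previous lemma \<open>\<phi>\<close> is also the Euler characteristic of the part over a short arc.
Growing an arc by half a short one adds \<open>\<phi>\<close> and subtracts \<open>\<phi>\<close> again, so the part over the circle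
minus a point has Euler characteristic \<open>\<phi>\<close>. The circle is the union of that long arc and a short one
around the missing point, which meet in two disjoint short arcs; this gives
\<open>\<phi> + \<phi> - (\<phi> + \<phi>) = 0\<close>.\<close>

theorem euler_characteristic_circle_fibration:
  assumes lt: "locally_trivial_fibration E (top_of_set (sphere (0::complex) 1)) p"
    and fib: "\<And>b. b \<in> sphere 0 1 \<Longrightarrow> \<exists>k. has_euler_characteristic (subtopology E {e \<in> topspace E. p e = b}) k"
  shows "has_euler_characteristic E 0"
proof -
  let ?S = "sphere (0::complex) 1"
  define part where "part V = subtopology E {e \<in> topspace E. p e \<in> V}" for V
  define chart where "chart U b \<longleftrightarrow> openin (top_of_set ?S) U \<and> b \<in> U \<and> (\<exists>h. 
        homeomorphic_map (subtopology E {e \<in> topspace E. p e \<in> U})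
          (prod_topology (subtopology (top_of_set ?S) U) (subtopology E {e \<in> topspace E. p e = b})) h \<and>
        (\<forall>e\<in>topspace E. p e \<in> U \<longrightarrow> fst (h e) = p e))" for U b
  have cont: "continuous_map E (top_of_set ?S) p"
    and charts: "\<And>b. b \<in> ?S \<Longrightarrow> \<exists>U. chart U b"
    using lt by (auto simp: locally_trivial_fibration_def chart_def)
  have pS: "p e \<in> ?S" if "e \<in> topspace E" for e
    using cont that by (auto simp: continuous_map_def Pi_iff)
  have part_fib: "part {b} = subtopology E {e \<in> topspace E. p e = b}" for b
    by (simp add: part_def)
  have part_eq: "part V homotopy_equivalent_space part {b}"
    if c: "chart U b" and V: "V \<subseteq> U" "V \<noteq> {}" "contractible_space (subtopology (top_of_set ?S) V)" for U V b
  proof -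
    obtain h where h: "homeomorphic_map (subtopology E {e \<in> topspace E. p e \<in> U})
          (prod_topology (subtopology (top_of_set ?S) U) (subtopology E {e \<in> topspace E. p e = b})) h"
        "\<forall>e\<in>topspace E. p e \<in> U \<longrightarrow> fst (h e) = p e"
      using c unfolding chart_def by blast
    have U: "U \<subseteq> ?S"
      using c openin_subset[of "top_of_set ?S" U] unfolding chart_def by auto
    show ?thesis
      unfolding part_fib unfolding part_def
      by (rule locally_trivial_part_homotopy_equivalent_fibre[OF h(1)]) (use h(2) U V in auto)
  qed
  obtain chi where chi: "\<And>b. b \<in> ?S \<Longrightarrow> has_euler_characteristic (part {b}) (chi b)"
    using fib unfolding part_fib by metis
  have chi_part: "has_euler_characteristic (part V) (chi b)"
    if "chart U b" "b \<in> ?S" "V \<subseteq> U" "V \<noteq> {}" "contractible_space (subtopology (top_of_set ?S) V)" for U V b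
    using has_euler_characteristic_homotopy_equivalent[OF _ chi[OF that(2)]] part_eq[OF that(1,3,4,5)]
    by (metis homotopy_equivalent_space_sym)
  have "chi constant_on ?S"
  proof (rule locally_constant_imp_constant)
    show "connected ?S" by (rule connected_sphere) simp
  next
    fix b assume b: "b \<in> ?S"
    then obtain U where U: "chart U b" using charts by blast
    have "chi x = chi b" if "x \<in> U" for x
    proof -
      have x: "x \<in> ?S" using that U openin_subset[of "top_of_set ?S" U] by (auto simp: chart_def)
      have "contractible_space (subtopology (top_of_set ?S) {x})"
        using x by (simp add: contractible_space_singleton)
      then have "has_euler_characteristic (part {x}) (chi b)"
        using chi_part[OF U b, of "{x}"] that by simp
      then show ?thesis using chi[OF x] has_euler_characteristic_unique by blast
    qed
    then show "\<exists>T. openin (top_of_set ?S) T \<and> b \<in> T \<and> (\<forall>x\<in>T. chi x = chi b)"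
      using U unfolding chart_def by blast
  qed
  then obtain \<phi> where \<phi>: "\<And>b. b \<in> ?S \<Longrightarrow> chi b = \<phi>" unfolding constant_on_def by blast
  \<comment> \<open>A Lebesgue number of the cover of the circle by base sets of charts.\<close>
  have "?S \<subseteq> \<Union>{G. open G \<and> (\<exists>b\<in>?S. chart (?S \<inter> G) b)}"
  proof
    fix b assume b: "b \<in> ?S"
    then obtain U where U: "chart U b" using charts by blast
    then obtain G where "open G" "U = ?S \<inter> G" by (auto simp: chart_def openin_open)
    moreover have "b \<in> U" using U by (simp add: chart_def)
    ultimately show "b \<in> \<Union>{G. open G \<and> (\<exists>b\<in>?S. chart (?S \<inter> G) b)}" using U b by blast
  qed
  then obtain \<epsilon> where \<epsilon>: "\<epsilon> > 0" "\<And>x. x \<in> ?S \<Longrightarrow> \<exists>G\<in>{G. open G \<and> (\<exists>b\<in>?S. chart (?S \<inter> G) b)}. ball x \<epsilon> \<subseteq> G"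
    using Heine_Borel_lemma[OF compact_sphere] by (metis (no_types, lifting) mem_Collect_eq)
  have small: "has_euler_characteristic (part (cis ` {s<..<t})) \<phi>" if "s < t" "t - s < \<epsilon>" "t - s \<le> 2 * pi" for s t
  proof -
    obtain G b where G: "chart (?S \<inter> G) b" "b \<in> ?S" "ball (cis s) \<epsilon> \<subseteq> G"
      using \<epsilon>(2)[of "cis s"] by auto
    have "cis ` {s<..<t} \<subseteq> ?S \<inter> G"
    proof
      fix w assume "w \<in> cis ` {s<..<t}"
      then obtain x where x: "w = cis x" "s < x" "x < t" by auto
      have "dist (cis s) w < \<epsilon>" using dist_cis_le[of s x] x that by auto
      then show "w \<in> ?S \<inter> G" using G(3) x by auto
    qed
    then show ?thesis
      using chi_part[OF G(1,2) _ _ contractible_arc[OF that(3)]] \<phi>[OF G(2)] that(1) by auto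
  qed
  have mv: "has_euler_characteristic (part (V \<union> W)) (a + b - c)"
    if "openin (top_of_set ?S) V" "openin (top_of_set ?S) W" "has_euler_characteristic (part V) a"
      "has_euler_characteristic (part W) b" "has_euler_characteristic (part (V \<inter> W)) c" for V W a b c
  proof -
    have "{e \<in> topspace E. p e \<in> V \<union> W} = {e \<in> topspace E. p e \<in> V} \<union> {e \<in> topspace E. p e \<in> W}"
       "{e \<in> topspace E. p e \<in> V \<inter> W} = {e \<in> topspace E. p e \<in> V} \<inter> {e \<in> topspace E. p e \<in> W}" by auto
    then show ?thesis
      using mayer_vietoris_euler[of E "{e \<in> topspace E. p e \<in> V}" "{e \<in> topspace E. p e \<in> W}" a b c] that
        openin_continuous_map_preimage[OF cont]
      unfolding part_def by simp
  qed
  have opc: "openin (top_of_set ?S) (cis ` {s<..<t})" for s t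
    by (intro openin_circle_cis_image) simp
  \<comment> \<open>The circle is divided into \<open>K + 2\<close> arcs of length \<open>h\<close> such that two adjacent ones are still short.\<close>
  obtain K :: nat where K: "4 * pi / \<epsilon> < K" using reals_Archimedean2 by blast
  have "K > 0" using K \<epsilon>(1) by (intro gr0I) (auto simp: field_simps dest: less_trans[of 0])
  define h where "h = 2 * pi / (K + 2)"
  have h: "h > 0" "2 * h < \<epsilon>" "h \<le> pi" "real (K + 2) * h = 2 * pi"
    using K \<epsilon>(1) \<open>K > 0\<close> by (auto simp: h_def field_simps)
  have h2: "2 * h \<le> 2 * pi" "h \<le> 2 * pi" "h < \<epsilon>" using h by auto
  have arcs: "has_euler_characteristic (part (cis ` {0<..<real m * h})) \<phi>" if "1 \<le> m" "m \<le> K + 2" for m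
    using that
  proof (induction m rule: dec_induct)
    case base
    then show ?case using small[of 0 h] h h2 by simp
  next
    case (step m)
    have le: "real (Suc m) * h \<le> 2 * pi"
      using step h mult_right_mono[of "real (Suc m)" "real (K + 2)" h] by simp
    have m1: "real m \<ge> 1" using step by simp
    have inj: "inj_on cis {0<..<real (Suc m) * h}" by (rule inj_on_cis_interval) (use le in simp)
    define q where "q = real m * h"
    have ge: "q \<ge> h" using m1 h(1) by (simp add: q_def)
    have e: "real (Suc m) * h = q + h" "(real m - 1) * h = q - h" "(real m + 1) * h = q + h" "real m * h = q"
      by (simp_all add: q_def algebra_simps)
    have "{0<..<real (Suc m) * h} = {0<..<real m * h} \<union> {(real m - 1) * h<..<(real m + 1) * h}"
      unfolding e using h(1) ge by auto
    then have un: "cis ` {0<..<real (Suc m) * h} = cis ` {0<..<real m * h} \<union> cis ` {(real m - 1) * h<..<(real m + 1) * h}"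
      by (simp only: image_Un)
    have "{0<..<real m * h} \<inter> {(real m - 1) * h<..<(real m + 1) * h} = {(real m - 1) * h<..<real m * h}"
      unfolding e using h(1) ge by auto
    moreover have "cis ` ({0<..<real m * h} \<inter> {(real m - 1) * h<..<(real m + 1) * h}) =
         cis ` {0<..<real m * h} \<inter> cis ` {(real m - 1) * h<..<(real m + 1) * h}"
      unfolding e by (rule inj_on_image_Int[OF inj[unfolded e(1)]]) (use h(1) ge in auto)
    ultimately have int: "cis ` {0<..<real m * h} \<inter> cis ` {(real m - 1) * h<..<(real m + 1) * h} =
        cis ` {(real m - 1) * h<..<real m * h}" by simp
    have "has_euler_characteristic (part (cis ` {(real m - 1) * h<..<(real m + 1) * h})) \<phi>"
      unfolding e using h h2 by (intro small) auto
    moreover have "has_euler_characteristic (part (cis ` {(real m - 1) * h<..<real m * h})) \<phi>"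
      unfolding e using h h2 by (intro small) auto
    moreover have "has_euler_characteristic (part (cis ` {0<..<real m * h})) \<phi>"
      using step by simp
    ultimately have "has_euler_characteristic (part (cis ` {0<..<real (Suc m) * h})) (\<phi> + \<phi> - \<phi>)"
      unfolding un by (intro mv opc) (simp_all only: int)
    then show ?case by simp
  qed
  have big: "has_euler_characteristic (part (cis ` {0<..<2 * pi})) \<phi>"
    using arcs[of "K + 2"] unfolding h(4) by simp
  have cover: "cis ` {0<..<2 * pi} \<union> cis ` {-h<..<h} = ?S"
  proof (intro equalityI subsetI)
    fix w assume "w \<in> ?S"
    then obtain x where x: "w = cis x" "0 \<le> x" "x < 2 * pi"
      using that[of "Arg2pi w"] complex_norm_eq_1_exp[of w] Arg2pi_ge_0[of w] Arg2pi_lt_2pi[of w]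
      by (simp add: cis_conv_exp)
    show "w \<in> cis ` {0<..<2 * pi} \<union> cis ` {-h<..<h}"
    proof (cases "x = 0")
      case True
      then show ?thesis using x h(1) by (intro UnI2 image_eqI[of _ cis 0]) auto
    qed (use x in auto)
  qed auto
  have shift: "cis ` {-h<..<0} = cis ` {2 * pi - h<..<2 * pi}"
  proof -
    have "{2 * pi - h<..<2 * pi} = (\<lambda>x. x + 2 * pi) ` {-h<..<0}"
    proof (intro equalityI subsetI)
      fix x assume "x \<in> {2 * pi - h<..<2 * pi}"
      then show "x \<in> (\<lambda>x. x + 2 * pi) ` {-h<..<0}"
        by (intro image_eqI[of _ _ "x - 2 * pi"]) auto
    qed auto
    moreover have "cis (x + 2 * pi) = cis x" for x by (simp add: complex_eq_iff)
    ultimately show ?thesis by (simp add: image_image)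
  qed
  have int: "cis ` {0<..<2 * pi} \<inter> cis ` {-h<..<h} = cis ` {0<..<h} \<union> cis ` {-h<..<0}"
  proof -
    have "{-h<..<h} = {-h<..<0} \<union> {0} \<union> {0<..<h}" using h(1) by auto
    moreover have "cis 0 \<notin> cis ` {0<..<2 * pi}"
    proof
      assume "cis 0 \<in> cis ` {0<..<2 * pi}"
      then obtain x where x: "cis 0 = cis x" "x \<in> {0<..<2 * pi}" by (rule imageE)
      \<comment> \<open>An open interval of length \<open>2 * pi\<close> centred at \<open>x/2\<close> contains both \<open>0\<close> and \<open>x\<close>.\<close>
      have "inj_on cis {x/2 - pi<..<x/2 + pi}" by (rule inj_on_cis_interval) simp
      from inj_onD[OF this x(1)] show False using x by auto
    qed
    moreover have "cis ` {0<..<h} \<subseteq> cis ` {0<..<2 * pi}" "cis ` {-h<..<0} \<subseteq> cis ` {0<..<2 * pi}"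
      unfolding shift using h by auto
    ultimately show ?thesis by auto
  qed
  have disj: "cis ` {0<..<h} \<inter> cis ` {-h<..<0} = {}"
  proof -
    have inj: "inj_on cis {0<..<2 * pi}" by (rule inj_on_cis_interval) simp
    have "cis ` {0<..<h} \<inter> cis ` {2 * pi - h<..<2 * pi} = cis ` ({0<..<h} \<inter> {2 * pi - h<..<2 * pi})"
      by (rule inj_on_image_Int[OF inj, symmetric]) (use h in auto)
    also have "{0<..<h} \<inter> {2 * pi - h<..<2 * pi} = {}" using h by auto
    finally show ?thesis by (simp add: shift)
  qed
  have "has_euler_characteristic (part {}) 0"
    by (rule has_euler_characteristic_empty) (simp add: part_def)
  then have "has_euler_characteristic (part (cis ` {0<..<h} \<union> cis ` {-h<..<0})) (\<phi> + \<phi> - 0)"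
    using small[of 0 h] small[of "-h" 0] h h2 by (intro mv opc) (simp_all add: disj)
  then have "has_euler_characteristic (part (cis ` {0<..<2 * pi} \<union> cis ` {-h<..<h})) (\<phi> + \<phi> - (\<phi> + \<phi> - 0))"
    using small[of "-h" h] h h2 by (intro mv opc big) (simp_all add: int)
  moreover have "part ?S = E"
  proof -
    have "{e \<in> topspace E. p e \<in> ?S} = topspace E" using pS by blast
    then show ?thesis by (simp only: part_def subtopology_topspace)
  qed
  ultimately show ?thesis unfolding cover by simp
qed

section \<open>Moebius transport on the torus\<close>

text \<open>The hyperbolic translations of the unit disc, extended to the unit circle. What matters here is
that they depend algebraically on \<open>c\<close> and that the inverse is obtained by changing the sign of
\<open>c\<close>.\<close>

definition moebius :: "complex \<Rightarrow> complex \<Rightarrow> complex" where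
  "moebius c u = (u + c) / (1 + cnj c * u)"

lemma moebius_denominator:
  assumes "norm u = 1" "norm c \<le> \<eta>"
  shows "norm (1 + cnj c * u) \<ge> 1 - \<eta>"
proof -
  have "norm (cnj c * u) \<le> \<eta>" using assms by (simp add: norm_mult)
  then show ?thesis using norm_triangle_ineq4[of "1 + cnj c * u" "cnj c * u"] by simp
qed

lemma moebius_denominator_nonzero:
  assumes "norm u = 1" "norm c < 1" shows "1 + cnj c * u \<noteq> 0"
  using moebius_denominator[OF assms(1), of c "norm c"] assms(2) by auto

lemma moebius_0 [simp]: "moebius 0 u = u"
  by (simp add: moebius_def)

text \<open>On the unit circle \<open>u + c = u * cnj (1 + cnj c * u)\<close>, so numerator and denominator have the same
norm.\<close>

lemma norm_moebius:
  assumes "norm u = 1" "norm c < 1" shows "norm (moebius c u) = 1"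
proof -
  have "u * cnj u = 1" using assms(1) by (simp add: complex_norm_square[symmetric])
  then have "u + c = u * cnj (1 + cnj c * u)" by (simp add: algebra_simps)
  then have "norm (u + c) = norm (1 + cnj c * u)" using assms(1)
    by (metis complex_mod_cnj mult_1 norm_mult)
  then show ?thesis
    using moebius_denominator_nonzero[OF assms] by (simp add: moebius_def norm_divide)
qed

lemma moebius_inverse:
  assumes "norm u = 1" "norm c < 1" shows "moebius (- c) (moebius c u) = u"
proof -
  have nz: "1 + cnj c * u \<noteq> 0" by (rule moebius_denominator_nonzero[OF assms])
  have nz2: "1 - cnj c * c \<noteq> 0"
  proof
    assume "1 - cnj c * c = 0"
    then have "norm (cnj c * c) = 1" by simp
    then have "norm c * norm c = 1" by (simp add: norm_mult)
    moreover have "norm c * norm c < 1 * 1" using assms(2) by (intro mult_strict_mono) auto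
    ultimately show False by simp
  qed
  have "moebius c u - c = u * (1 - cnj c * c) / (1 + cnj c * u)"
    using nz by (simp add: moebius_def field_simps)
  moreover have "1 - cnj c * moebius c u = (1 - cnj c * c) / (1 + cnj c * u)"
    using nz by (simp add: moebius_def field_simps)
  ultimately have "moebius (- c) (moebius c u) = (u * (1 - cnj c * c) / (1 + cnj c * u)) / ((1 - cnj c * c) / (1 + cnj c * u))"
    by (simp add: moebius_def)
  then show ?thesis using nz nz2 by simp
qed

text \<open>The derivative at \<open>c = 0\<close> is \<open>c - cnj c * u\<^sup>2\<close>, and the remainder is \<open>- A c / D c\<close> with \<open>A\<close> quadratic
in \<open>c\<close>. On a disc of radius \<open>\<eta>\<close> the remainder is therefore Lipschitz with a constant of order \<open>\<eta>\<close>,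
which is what the contraction below needs.\<close>

lemma moebius_linearization:
  assumes u: "norm u = 1" and c: "norm c \<le> \<eta>" and d: "norm d \<le> \<eta>" and \<eta>: "\<eta> \<le> 1/2"
  shows "norm (moebius c u - moebius d u - ((c - d) - cnj (c - d) * u\<^sup>2)) \<le> 12 * \<eta> * norm (c - d)"
proof -
  have \<eta>0: "\<eta> \<ge> 0" using c norm_ge_zero order_trans by blast
  define A where "A c = cnj c * u * (c - cnj c * u\<^sup>2)" for c
  define D where "D c = 1 + cnj c * u" for c
  have Dn: "norm (D c) \<ge> 1/2" "norm (D d) \<ge> 1/2"
    unfolding D_def using moebius_denominator[OF u c] moebius_denominator[OF u d] \<eta> by linarith+
  then have nz: "D c \<noteq> 0" "D d \<noteq> 0" by auto
  have rem: "moebius c u - u - (c - cnj c * u\<^sup>2) = - (A c / D c)" if "D c \<noteq> 0" for c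
    using that unfolding moebius_def A_def D_def by (simp add: field_simps power2_eq_square)
  have "moebius c u - moebius d u - ((c - d) - cnj (c - d) * u\<^sup>2) =
     (moebius c u - u - (c - cnj c * u\<^sup>2)) - (moebius d u - u - (d - cnj d * u\<^sup>2))"
    by (simp add: algebra_simps)
  also have "\<dots> = A d / D d - A c / D c" using rem nz by simp
  also have "\<dots> = (A d - A c) / D c + A d * (D c - D d) / (D c * D d)"
    using nz by (simp add: field_simps)
  finally have eq: "norm (moebius c u - moebius d u - ((c - d) - cnj (c - d) * u\<^sup>2)) \<le>
      norm ((A d - A c) / D c) + norm (A d * (D c - D d) / (D c * D d))"
    using norm_triangle_ineq by metis
  have Dd: "norm (D c - D d) = norm (c - d)"
  proof -
    have "D c - D d = cnj (c - d) * u" by (simp add: D_def algebra_simps)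
    then show ?thesis using u by (simp add: norm_mult del: complex_cnj_diff)
  qed
  have nA: "norm (A d) \<le> \<eta>"
  proof -
    have "norm (d - cnj d * u\<^sup>2) \<le> norm d + norm d"
      using norm_triangle_ineq4[of d "cnj d * u\<^sup>2"] u by (simp add: norm_mult norm_power)
    also have "\<dots> \<le> 1" using d \<eta> by simp
    finally have "norm d * norm (d - cnj d * u\<^sup>2) \<le> \<eta> * 1"
      using d \<eta>0 by (intro mult_mono) auto
    then show ?thesis using u by (simp add: A_def norm_mult)
  qed
  have dA: "norm (A d - A c) \<le> 4 * \<eta> * norm (c - d)"
  proof -
    have "A d - A c = cnj (d - c) * u * (d - cnj d * u\<^sup>2) + cnj c * u * ((d - c) - cnj (d - c) * u\<^sup>2)"
      by (simp add: A_def algebra_simps)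
    then have "norm (A d - A c) \<le> norm (cnj (d - c) * u * (d - cnj d * u\<^sup>2)) + norm (cnj c * u * ((d - c) - cnj (d - c) * u\<^sup>2))"
      using norm_triangle_ineq by metis
    also have "norm (cnj (d - c) * u * (d - cnj d * u\<^sup>2)) = norm (c - d) * norm (d - cnj d * u\<^sup>2)"
      using u by (simp add: norm_mult norm_minus_commute del: complex_cnj_diff)
    also have "\<dots> \<le> norm (c - d) * (2 * \<eta>)"
      using norm_triangle_ineq4[of d "cnj d * u\<^sup>2"] u d by (intro mult_left_mono) (auto simp: norm_mult norm_power)
    also have "norm (cnj c * u * ((d - c) - cnj (d - c) * u\<^sup>2)) = norm c * norm ((d - c) - cnj (d - c) * u\<^sup>2)"
      using u by (simp add: norm_mult del: complex_cnj_diff)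
    also have "\<dots> \<le> \<eta> * (2 * norm (c - d))"
      using norm_triangle_ineq4[of "d - c" "cnj (d - c) * u\<^sup>2"] u c \<eta>0
      by (intro mult_mono) (auto simp: norm_mult norm_power norm_minus_commute simp del: complex_cnj_diff)
    finally show ?thesis by (simp add: algebra_simps)
  qed
  have "norm ((A d - A c) / D c) \<le> (4 * \<eta> * norm (c - d)) / (1/2)"
    unfolding norm_divide using dA Dn \<eta>0 by (intro frac_le) auto
  moreover have "norm (A d * (D c - D d) / (D c * D d)) \<le> (\<eta> * norm (c - d)) / (1/2 * (1/2))"
    unfolding norm_divide norm_mult Dd using nA Dn \<eta>0 by (intro frac_le mult_mono mult_pos_pos) auto
  ultimately show ?thesis using eq by simp
qed

definition torus :: "nat \<Rightarrow> (nat \<Rightarrow> complex) set" where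
  "torus n = {..<n} \<rightarrow>\<^sub>E sphere 0 1"

definition torus_space :: "nat \<Rightarrow> (nat \<Rightarrow> complex) topology" where
  "torus_space n = subtopology (product_topology (\<lambda>_. euclidean) {..<n}) (torus n)"

definition endpoint :: "nat \<Rightarrow> (nat \<Rightarrow> complex) \<Rightarrow> complex" where
  "endpoint n u = (\<Sum>i<n. u i)"

lemma topspace_torus_space [simp]: "topspace (torus_space n) = torus n"
  by (auto simp: torus_space_def torus_def)

lemma torus_norm: "u \<in> torus n \<Longrightarrow> i < n \<Longrightarrow> norm (u i) = 1"
  by (auto simp: torus_def PiE_iff)

lemma compact_torus_space: "compact_space (torus_space n)"
  unfolding torus_space_def torus_def subtopology_product_topology
  by (simp add: compact_space_product_topology compact_space_subtopology)

lemma continuous_map_euclidean_iff_tendsto: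
  "continuous_map X euclidean f \<longleftrightarrow> (\<forall>x\<in>topspace X. (f \<longlongrightarrow> f x) (atin X x))"
  by (simp add: continuous_map_atin)

lemma continuous_map_torus_component:
  assumes "i < n" shows "continuous_map (torus_space n) euclidean (\<lambda>u. u i)"
  unfolding torus_space_def using assms
  by (intro continuous_map_from_subtopology continuous_map_product_projection) auto

lemma continuous_map_into_torus_space:
  "continuous_map X (torus_space n) f \<longleftrightarrow>
     f \<in> topspace X \<rightarrow> torus n \<and> (\<forall>i<n. continuous_map X euclidean (\<lambda>x. f x i))"
  unfolding torus_space_def continuous_map_in_subtopology continuous_map_componentwise
  by (auto simp: torus_def Pi_iff PiE_iff image_subset_iff)

text \<open>Extensionality outside the index set is kept, so that the results are points of the torus.\<close>

definition moebius_act :: "nat \<Rightarrow> complex \<Rightarrow> (nat \<Rightarrow> complex) \<Rightarrow> nat \<Rightarrow> complex" where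
  "moebius_act n c u = (\<lambda>i\<in>{..<n}. moebius c (u i))"

lemma moebius_act_torus: "u \<in> torus n \<Longrightarrow> norm c < 1 \<Longrightarrow> moebius_act n c u \<in> torus n"
  using norm_moebius torus_norm by (auto simp: torus_def moebius_act_def)

lemma moebius_act_inverse:
  assumes "u \<in> torus n" "norm c < 1" shows "moebius_act n (- c) (moebius_act n c u) = u"
proof
  fix i show "moebius_act n (- c) (moebius_act n c u) i = u i"
    using moebius_inverse[OF torus_norm[OF assms(1)] assms(2)] assms(1)
    by (cases "i < n") (auto simp: moebius_act_def torus_def PiE_iff extensional_def)
qed

lemma moebius_act_0: "u \<in> torus n \<Longrightarrow> moebius_act n 0 u = u"
  by (auto simp: moebius_act_def torus_def PiE_iff extensional_def fun_eq_iff)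

text \<open>The continuous function \<open>g\<close> vanishes exactly where the end point is \<open>v0\<close> and the norm of the sum of
squares attains its maximum \<open>n\<close>. The hypothesis excludes such points, so \<open>g\<close> has a positive minimum
on the compact torus.\<close>

lemma uniformly_regular:
  assumes reg: "\<And>u. u \<in> torus n \<Longrightarrow> endpoint n u = v0 \<Longrightarrow> norm (\<Sum>i<n. (u i)\<^sup>2) < n"
  shows "\<exists>\<kappa>>0. \<forall>u\<in>torus n. dist v0 (endpoint n u) < \<kappa> \<longrightarrow> norm (\<Sum>i<n. (u i)\<^sup>2) \<le> real n - \<kappa>"
proof -
  define g where "g u = norm (endpoint n u - v0) + (n - norm (\<Sum>i<n. (u i)\<^sup>2))" for u
  have le: "norm (\<Sum>i<n. (u i)\<^sup>2) \<le> n" if "u \<in> torus n" for u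
  proof -
    have "norm (\<Sum>i<n. (u i)\<^sup>2) \<le> (\<Sum>i<n. norm ((u i)\<^sup>2))" by (rule norm_sum)
    also have "\<dots> = n" using torus_norm[OF that] by (simp add: norm_power)
    finally show ?thesis .
  qed
  have pos: "g u > 0" if "u \<in> torus n" for u
    using reg[OF that] le[OF that] unfolding g_def
    by (cases "endpoint n u = v0") (auto intro: add_pos_nonneg)
  have "continuous_map (torus_space n) euclidean g"
    unfolding continuous_map_euclidean_iff_tendsto
  proof
    fix u assume u: "u \<in> topspace (torus_space n)"
    have "((\<lambda>u. u i) \<longlongrightarrow> u i) (atin (torus_space n) u)" if "i < n" for i
      using continuous_map_torus_component[OF that] u by (simp add: continuous_map_euclidean_iff_tendsto)
    then show "(g \<longlongrightarrow> g u) (atin (torus_space n) u)"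
      unfolding g_def endpoint_def by (intro tendsto_intros) auto
  qed
  then have "compactin euclidean (g ` torus n)"
    using image_compactin[of "torus_space n" "torus n"] compact_torus_space[of n]
    unfolding compact_space_def by (metis topspace_torus_space)
  then have "compact (g ` torus n)" by simp
  moreover have "g ` torus n \<noteq> {}"
  proof -
    have "(\<lambda>i\<in>{..<n}. 1) \<in> torus n" by (auto simp: torus_def)
    then show ?thesis by blast
  qed
  ultimately obtain u0 where u0: "u0 \<in> torus n" "\<And>u. u \<in> torus n \<Longrightarrow> g u0 \<le> g u"
    using compact_attains_inf[of "g ` torus n"] by auto
  show ?thesis
  proof (intro exI[of _ "g u0 / 2"] conjI ballI impI)
    show "g u0 / 2 > 0" using pos[OF u0(1)] by simp
    fix u assume "u \<in> torus n" "dist v0 (endpoint n u) < g u0 / 2"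
    then show "norm (\<Sum>i<n. (u i)\<^sup>2) \<le> real n - g u0 / 2"
      using u0(2)[of u] unfolding g_def[of u] dist_norm norm_minus_commute[of v0] by linarith
  qed
qed

text \<open>\<open>\<tau> u v\<close> carries the chain of edges \<open>u\<close> to one that ends at \<open>v\<close>. The last condition of the
first part says that transport back to the old end point undoes the transport; this turns \<open>\<tau>\<close>
directly into trivialisations of the end point map.\<close>

definition parallel_transport ::
    "nat \<Rightarrow> complex set \<Rightarrow> ((nat \<Rightarrow> complex) \<Rightarrow> complex \<Rightarrow> nat \<Rightarrow> complex) \<Rightarrow> bool" where
  "parallel_transport n D \<tau> \<longleftrightarrow>
     (\<forall>u\<in>torus n. endpoint n u \<in> D \<longrightarrow> \<tau> u (endpoint n u) = u \<and>
        (\<forall>v\<in>D. \<tau> u v \<in> torus n \<and> endpoint n (\<tau> u v) = v \<and> \<tau> (\<tau> u v) (endpoint n u) = u)) \<and>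
     continuous_map
       (prod_topology (subtopology (torus_space n) {u. endpoint n u \<in> D}) (top_of_set D))
       (torus_space n) (\<lambda>(u, v). \<tau> u v)"

text \<open>For \<open>u\<close> near the fibre over \<open>v0\<close> and \<open>v\<close> near \<open>v0\<close>, let \<open>f u c\<close> be the end point after applying
the transformation with parameter \<open>c\<close> to all edges. Its derivative at \<open>c = 0\<close> is
\<open>L u c = n * c - cnj c * Q\<close> with \<open>Q\<close> the sum of the squares of the edges; it is bounded below by \<open>\<kappa>\<close>
because \<open>\<bar>Q\<bar> \<le> n - \<kappa>\<close>. The linearisation bound and a contraction argument show that \<open>f u c = v\<close>
has exactly one solution \<open>c = C u v\<close> of norm at most \<open>\<eta>\<close>, and \<open>\<tau>\<close> is the transformation with this
parameter. Since \<open>- c\<close> is an equally small parameter that undoes it, uniqueness gives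
\<open>C (\<tau> u v) (endpoint n u) = - C u v\<close>, the required invertibility.\<close>

lemma parallel_transport_exists:
  assumes n: "n > 0"
    and reg: "\<And>u. u \<in> torus n \<Longrightarrow> endpoint n u = v0 \<Longrightarrow> norm (\<Sum>i<n. (u i)\<^sup>2) < n"
  shows "\<exists>\<epsilon>>0. \<exists>\<tau>. parallel_transport n (ball v0 \<epsilon>) \<tau>"
proof -
  have "\<exists>\<kappa>>0. \<forall>u\<in>torus n. dist v0 (endpoint n u) < \<kappa> \<longrightarrow> norm (\<Sum>i<n. (u i)\<^sup>2) \<le> real n - \<kappa>"
    by (rule uniformly_regular) (rule reg)
  then obtain \<kappa> :: real where \<kappa>: "\<kappa> > 0"
    and \<kappa>': "\<forall>u\<in>torus n. dist v0 (endpoint n u) < \<kappa> \<longrightarrow> norm (\<Sum>i<n. (u i)\<^sup>2) \<le> real n - \<kappa>"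
    by (elim exE conjE)
  \<comment> \<open>The Lipschitz constant \<open>12 * n * \<eta>\<close> of the remainder has to be at most half the lower bound of \<open>L u\<close>.\<close>
  define \<eta> where "\<eta> = min (1/2) (\<kappa> / (24 * n))"
  have \<eta>: "\<eta> > 0" "\<eta> \<le> 1/2" using \<kappa> n by (auto simp: \<eta>_def)
  have "\<eta> * (24 * n) \<le> \<kappa> / (24 * n) * (24 * n)"
    by (intro mult_right_mono) (auto simp: \<eta>_def)
  then have \<eta>\<kappa>: "12 * n * \<eta> \<le> \<kappa> / 2" using n by (simp add: algebra_simps)
  \<comment> \<open>Two points of the ball of radius \<open>\<epsilon>\<close> are so close that the first Newton step stays within \<open>\<eta> / 2\<close>.\<close>
  define \<epsilon> where "\<epsilon> = min \<kappa> (\<kappa> * \<eta> / 4)"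
  have \<epsilon>: "\<epsilon> > 0" "\<epsilon> \<le> \<kappa>" "2 * \<epsilon> \<le> \<kappa> * \<eta> / 2" using \<kappa> \<eta> by (auto simp: \<epsilon>_def)
  define K where "K = {u \<in> torus n. endpoint n u \<in> ball v0 \<epsilon>}"
  define f where "f u c = endpoint n (moebius_act n c u)" for u c
  define L where "L u c = of_nat n * c - cnj c * (\<Sum>i<n. (u i)\<^sup>2)" for u :: "nat \<Rightarrow> complex" and c :: complex
  have f_eq: "f u c = (\<Sum>i<n. moebius c (u i))" for u c
    by (simp add: f_def endpoint_def moebius_act_def)
  have f0: "f u 0 = endpoint n u" if "u \<in> K" for u
    using that moebius_act_0 by (simp add: f_def K_def)
  have L_ge: "\<kappa> * norm c \<le> norm (L u c)" if "u \<in> K" for u c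
  proof -
    have Q: "norm (\<Sum>i<n. (u i)\<^sup>2) \<le> real n - \<kappa>" using \<kappa>' that \<epsilon> by (auto simp: K_def)
    have "norm (of_nat n * c) - norm (cnj c * (\<Sum>i<n. (u i)\<^sup>2)) \<le> norm (L u c)"
      unfolding L_def by (rule norm_triangle_ineq2)
    moreover have "norm (cnj c * (\<Sum>i<n. (u i)\<^sup>2)) \<le> norm c * (real n - \<kappa>)"
      using Q by (simp add: norm_mult mult_left_mono)
    ultimately show ?thesis by (simp add: norm_mult algebra_simps)
  qed
  have lin: "norm (f u c - f u d - L u (c - d)) \<le> \<kappa> / 2 * norm (c - d)"
    if "u \<in> K" "norm c \<le> \<eta>" "norm d \<le> \<eta>" for u c d
  proof -
    have "f u c - f u d - L u (c - d) =
        (\<Sum>i<n. moebius c (u i) - moebius d (u i) - ((c - d) - cnj (c - d) * (u i)\<^sup>2))"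
      by (simp add: f_eq L_def sum_subtractf sum_distrib_left)
    also have "norm \<dots> \<le> (\<Sum>i<n. 12 * \<eta> * norm (c - d))"
      using that \<eta> by (intro sum_norm_le moebius_linearization) (auto simp: K_def torus_norm)
    also have "\<dots> = (12 * n * \<eta>) * norm (c - d)" by simp
    also have "\<dots> \<le> \<kappa> / 2 * norm (c - d)" using \<eta>\<kappa> by (intro mult_right_mono) auto
    finally show ?thesis .
  qed
  have expand: "\<kappa> / 2 * norm (c - d) \<le> norm (f u c - f u d)"
    if "u \<in> K" "norm c \<le> \<eta>" "norm d \<le> \<eta>" for u c d
    using lin[OF that] L_ge[OF that(1), of "c - d"] norm_triangle_ineq4[of "f u c - f u d" "f u c - f u d - L u (c - d)"]
    by (simp add: algebra_simps)
  have uniq: "c = d" if "u \<in> K" "norm c \<le> \<eta>" "norm d \<le> \<eta>" "f u c = f u d" for u c d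
  proof -
    have "\<kappa> / 2 * norm (c - d) \<le> 0" using expand[OF that(1-3)] that(4) by simp
    then show ?thesis using \<kappa> by (simp add: mult_le_0_iff)
  qed
  have ex: "\<exists>c. norm c \<le> \<eta> \<and> f u c = v" if u: "u \<in> K" and v: "v \<in> ball v0 \<epsilon>" for u v
  proof -
    have "linear (L u)"
      by (rule linearI) (simp_all add: L_def algebra_simps scaleR_conv_of_real)
    moreover have "inj (L u)"
    proof (rule injI)
      fix x y assume "L u x = L u y"
      then have "L u (x - y) = 0" by (simp add: L_def algebra_simps)
      then show "x = y" using L_ge[OF u, of "x - y"] \<kappa> by (simp add: mult_le_0_iff)
    qed
    ultimately obtain L' where L': "linear L'" "\<And>x. L' (L u x) = x" "\<And>x. L u (L' x) = x"
      using linear_injective_isomorphism[of "L u"] by blast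
    have nL': "norm (L' x) \<le> norm x / \<kappa>" for x
      using L_ge[OF u, of "L' x"] \<kappa> by (simp add: L'(3) field_simps)
    \<comment> \<open>Newton iteration with the derivative frozen at \<open>0\<close>.\<close>
    define \<Phi> where "\<Phi> c = c + L' (v - f u c)" for c
    have contr: "dist (\<Phi> c) (\<Phi> d) \<le> 1/2 * dist c d" if "c \<in> cball 0 \<eta>" "d \<in> cball 0 \<eta>" for c d
    proof -
      have "\<Phi> c - \<Phi> d = - L' (f u c - f u d - L u (c - d))"
        unfolding \<Phi>_def by (simp add: linear_diff[OF L'(1)] L'(2))
      then have "dist (\<Phi> c) (\<Phi> d) \<le> norm (f u c - f u d - L u (c - d)) / \<kappa>"
        using nL' by (simp add: dist_norm)
      also have "\<dots> \<le> (\<kappa> / 2 * norm (c - d)) / \<kappa>"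
        using lin[OF u, of c d] that \<kappa> by (intro divide_right_mono) auto
      finally show ?thesis using \<kappa> by (simp add: dist_norm)
    qed
    have "norm (\<Phi> 0) \<le> \<eta> / 2"
    proof -
      have "norm (\<Phi> 0) \<le> norm (v - endpoint n u) / \<kappa>"
        using nL'[of "v - endpoint n u"] by (simp add: \<Phi>_def f0[OF u])
      also have "norm (v - endpoint n u) \<le> dist v0 v + dist v0 (endpoint n u)"
        by (metis dist_commute dist_norm dist_triangle)
      also have "\<dots> \<le> \<kappa> * \<eta> / 2" using u v \<epsilon>(3) by (simp add: K_def)
      finally show ?thesis using \<kappa> by (simp add: divide_right_mono)
    qed
    then have "\<Phi> c \<in> cball 0 \<eta>" if "c \<in> cball 0 \<eta>" for c
      using contr[OF that, of 0] that \<eta>(1) dist_triangle[of 0 "\<Phi> c" "\<Phi> 0"] by (simp add: dist_commute)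
    then have "\<exists>!c\<in>cball 0 \<eta>. \<Phi> c = c"
      using contr \<eta>(1) by (intro Banach_fix[of _ "1/2"]) (auto intro: compact_imp_complete)
    then obtain c where c: "norm c \<le> \<eta>" "\<Phi> c = c" by auto
    then have "L' (v - f u c) = 0" by (simp add: \<Phi>_def)
    then have "v - f u c = 0" using L'(3)[of "v - f u c"] by (simp add: L_def)
    with c show ?thesis by auto
  qed
  define C where "C u v = (SOME c. norm c \<le> \<eta> \<and> f u c = v)" for u v
  have C: "norm (C u v) \<le> \<eta>" "f u (C u v) = v" if "u \<in> K" "v \<in> ball v0 \<epsilon>" for u v
    using someI_ex[OF ex[OF that]] by (auto simp: C_def)
  have C_eq: "C u v = c" if "u \<in> K" "v \<in> ball v0 \<epsilon>" "norm c \<le> \<eta>" "f u c = v" for u v c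
    using uniq[OF that(1)] C[OF that(1,2)] that(3,4) by auto
  define \<tau> where "\<tau> u v = moebius_act n (C u v) u" for u v
  have C1: "norm (C u v) < 1" if "u \<in> K" "v \<in> ball v0 \<epsilon>" for u v
    using C(1)[OF that] \<eta> by linarith
  have \<tau>1: "\<tau> u v \<in> torus n" "endpoint n (\<tau> u v) = v" if "u \<in> K" "v \<in> ball v0 \<epsilon>" for u v
    using moebius_act_torus[OF _ C1[OF that]] C(2)[OF that] that by (auto simp: \<tau>_def f_def K_def)
  have \<tau>K: "\<tau> u v \<in> K" if "u \<in> K" "v \<in> ball v0 \<epsilon>" for u v
    using \<tau>1[OF that] that by (simp add: K_def)
  have \<tau>2: "\<tau> (\<tau> u v) (endpoint n u) = u" if "u \<in> K" "v \<in> ball v0 \<epsilon>" for u v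
  proof -
    have inv: "moebius_act n (- C u v) (\<tau> u v) = u"
      unfolding \<tau>_def using moebius_act_inverse[OF _ C1[OF that]] that by (simp add: K_def)
    have "C (\<tau> u v) (endpoint n u) = - C u v"
      using C(1)[OF that] that inv by (intro C_eq \<tau>K) (auto simp: K_def f_def)
    then show ?thesis using inv by (simp add: \<tau>_def)
  qed
  have \<tau>3: "\<tau> u (endpoint n u) = u" if "u \<in> K" for u
  proof -
    have "C u (endpoint n u) = 0"
      using that \<eta> f0[OF that] by (intro C_eq) (auto simp: K_def)
    then show ?thesis using that by (simp add: \<tau>_def K_def moebius_act_0)
  qed
  let ?X = "prod_topology (subtopology (torus_space n) {u. endpoint n u \<in> ball v0 \<epsilon>}) (top_of_set (ball v0 \<epsilon>))"
  have top: "topspace ?X = K \<times> ball v0 \<epsilon>" by (auto simp: K_def)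
  have comp: "((\<lambda>z. fst z i) \<longlongrightarrow> fst w i) (atin ?X w)" if "w \<in> topspace ?X" "i < n" for w i
  proof -
    have "continuous_map ?X euclidean ((\<lambda>u. u i) \<circ> fst)"
      using continuous_map_torus_component[OF that(2)]
      by (intro continuous_map_compose[OF continuous_map_fst] continuous_map_from_subtopology)
    then show ?thesis
      using that(1) unfolding continuous_map_euclidean_iff_tendsto o_def by blast
  qed
  have proj2: "(snd \<longlongrightarrow> snd w) (atin ?X w)" if "w \<in> topspace ?X" for w
  proof -
    have "continuous_map ?X euclidean snd"
      using continuous_map_into_fulltopology[OF continuous_map_snd] by simp
    then show ?thesis using that unfolding continuous_map_euclidean_iff_tendsto by blast
  qed
  have ev: "eventually (\<lambda>z. z \<in> topspace ?X) (atin ?X w)" for w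
    unfolding eventually_atin by (metis DiffD1 openin_topspace)
  \<comment> \<open>Continuity of the parameter: \<open>expand\<close> bounds its variation by the failure of the old parameter to solve the new equation.\<close>
  have C_lim: "((\<lambda>z. C (fst z) (snd z)) \<longlongrightarrow> C (fst w) (snd w)) (atin ?X w)" if w: "w \<in> topspace ?X" for w
  proof -
    define c where "c = C (fst w) (snd w)"
    have wK: "fst w \<in> K" "snd w \<in> ball v0 \<epsilon>" using w unfolding top by auto
    have c: "norm c \<le> \<eta>" "f (fst w) c = snd w" using C[OF wK] by (auto simp: c_def)
    have "((\<lambda>z. moebius c (fst z i)) \<longlongrightarrow> moebius c (fst w i)) (atin ?X w)" if "i < n" for i
      unfolding moebius_def
      using moebius_denominator_nonzero[of "fst w i" c] wK(1) that c(1) \<eta>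
      by (intro tendsto_intros comp w that) (auto simp: K_def torus_norm)
    then have "((\<lambda>z. f (fst z) c) \<longlongrightarrow> f (fst w) c) (atin ?X w)"
      unfolding f_eq by (intro tendsto_sum) auto
    then have "((\<lambda>z. 2 / \<kappa> * norm (snd z - f (fst z) c)) \<longlongrightarrow> 2 / \<kappa> * norm (snd w - f (fst w) c)) (atin ?X w)"
      by (intro tendsto_intros proj2 w)
    then have lim: "((\<lambda>z. 2 / \<kappa> * norm (snd z - f (fst z) c)) \<longlongrightarrow> 0) (atin ?X w)"
      by (simp add: c)
    have "eventually (\<lambda>z. norm (C (fst z) (snd z) - c) \<le> 2 / \<kappa> * norm (snd z - f (fst z) c)) (atin ?X w)"
      using ev
    proof eventually_elim
      case (elim z)
      then have z: "fst z \<in> K" "snd z \<in> ball v0 \<epsilon>" unfolding top by auto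
      show ?case
        using expand[OF z(1) C(1)[OF z] c(1)] C(2)[OF z] \<kappa> by (simp add: field_simps)
    qed
    then have "((\<lambda>z. C (fst z) (snd z) - c) \<longlongrightarrow> 0) (atin ?X w)"
      by (rule Lim_null_comparison[OF _ lim])
    then show ?thesis unfolding c_def using LIM_zero_iff by blast
  qed
  have "continuous_map ?X (torus_space n) (\<lambda>(u, v). \<tau> u v)"
    unfolding continuous_map_into_torus_space continuous_map_euclidean_iff_tendsto
  proof (intro conjI allI impI ballI funcsetI)
    fix z assume "z \<in> topspace ?X"
    then show "(case z of (u, v) \<Rightarrow> \<tau> u v) \<in> torus n"
      unfolding top using \<tau>1(1) by auto
  next
    fix i w assume i: "i < n" and w: "w \<in> topspace ?X"
    have wK: "fst w \<in> K" "snd w \<in> ball v0 \<epsilon>" using w unfolding top by auto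
    have "((\<lambda>z. moebius (C (fst z) (snd z)) (fst z i)) \<longlongrightarrow> moebius (C (fst w) (snd w)) (fst w i)) (atin ?X w)"
      unfolding moebius_def
      using moebius_denominator_nonzero[of "fst w i" "C (fst w) (snd w)"] wK C1[OF wK] i
      by (intro tendsto_intros comp C_lim w i) (auto simp: K_def torus_norm)
    then show "((\<lambda>x. (case x of (u, v) \<Rightarrow> \<tau> u v) i) \<longlongrightarrow> (case w of (u, v) \<Rightarrow> \<tau> u v) i) (atin ?X w)"
      using i by (simp add: \<tau>_def moebius_act_def case_prod_beta)
  qed
  then have "parallel_transport n (ball v0 \<epsilon>) \<tau>"
    unfolding parallel_transport_def using \<tau>1 \<tau>2 \<tau>3 by (simp add: K_def)
  with \<epsilon>(1) show ?thesis by blast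
qed

lemma unit_complex_Re_1:
  assumes "norm z = 1" "Re z = 1" shows "z = 1"
proof -
  have "(Im z)\<^sup>2 = 0" using cmod_power2[of z] assms by simp
  then show ?thesis using assms by (simp add: complex_eq_iff)
qed

text \<open>Equality in the triangle inequality for the squares forces all squares of the edges to agree. Then
every edge is plus or minus the first one, and the end point is the first edge times a sum of \<open>n\<close>
signs, which has the parity of \<open>n\<close>.\<close>

lemma torus_collinear_endpoint:
  assumes u: "u \<in> torus n" and deg: "\<not> norm (\<Sum>i<n. (u i)\<^sup>2) < n"
  shows "\<exists>k::int. norm (endpoint n u) = real_of_int \<bar>k\<bar> \<and> (even k \<longleftrightarrow> even n)"
proof (cases "n = 0")
  case True
  then show ?thesis by (intro exI[of _ 0]) (simp add: endpoint_def)
next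
  case False
  define Q where "Q = (\<Sum>i<n. (u i)\<^sup>2)"
  define q where "q = Q / n"
  have sq: "norm ((u i)\<^sup>2) = 1" if "i < n" for i using torus_norm[OF u that] by (simp add: norm_power)
  have "norm Q \<le> (\<Sum>i<n. norm ((u i)\<^sup>2))" unfolding Q_def by (rule norm_sum)
  also have "\<dots> = n" using sq by simp
  finally have nQ: "norm Q = n" using deg by (simp add: Q_def)
  then have nq: "norm q = 1" using False by (simp add: q_def norm_divide)
  have n1: "norm (cnj q * (u i)\<^sup>2) = 1" if "i < n" for i
    using sq[OF that] nq by (simp add: norm_mult)
  have le: "Re (cnj q * (u i)\<^sup>2) \<le> 1" if "i < n" for i
    using complex_Re_le_cmod[of "cnj q * (u i)\<^sup>2"] unfolding n1[OF that] .
  have "cnj q * Q = of_nat n * (cnj q * q)" using False by (simp add: q_def)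
  also have "cnj q * q = 1" using nq by (metis complex_norm_square mult.commute of_real_1 one_power2)
  finally have "Re (cnj q * Q) = n" by simp
  then have "(\<Sum>i<n. Re (cnj q * (u i)\<^sup>2)) = n"
    unfolding Q_def sum_distrib_left Re_sum .
  then have "(\<Sum>i<n. 1 - Re (cnj q * (u i)\<^sup>2)) = 0" by (simp add: sum_subtractf)
  moreover have "\<forall>i\<in>{..<n}. 1 - Re (cnj q * (u i)\<^sup>2) \<ge> 0" using le by fastforce
  ultimately have "\<forall>i\<in>{..<n}. 1 - Re (cnj q * (u i)\<^sup>2) = 0"
    by (intro sum_nonneg_eq_0_iff[THEN iffD1]) simp_all
  then have "1 - Re (cnj q * (u i)\<^sup>2) = 0" if "i < n" for i
    using that by (rule bspec[OF _ lessThan_iff[THEN iffD2]])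
  then have eq1: "Re (cnj q * (u i)\<^sup>2) = 1" if "i < n" for i
    using that by (metis eq_iff_diff_eq_0)
  have same: "(u i)\<^sup>2 = q" if "i < n" for i
  proof -
    have "cnj q * (u i)\<^sup>2 = 1"
      by (rule unit_complex_Re_1[OF n1[OF that] eq1[OF that]])
    then have "q * (cnj q * (u i)\<^sup>2) = q" by simp
    moreover have "q * cnj q = 1" using nq by (metis complex_norm_square of_real_1 one_power2)
    ultimately show ?thesis by (simp add: mult.assoc[symmetric])
  qed
  have pm: "u i = u 0 \<or> u i = - u 0" if "i < n" for i
  proof -
    have "(u i)\<^sup>2 = (u 0)\<^sup>2" using same[OF that] same[of 0] False by simp
    then show ?thesis by (rule power2_eq_iff[THEN iffD1])
  qed
  define s where "s i = (if u i = u 0 then 1 else - 1 :: int)" for i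
  have "endpoint n u = (\<Sum>i<n. of_int (s i) * u 0)"
    unfolding endpoint_def using pm by (intro sum.cong) (auto simp: s_def)
  also have "\<dots> = of_int (\<Sum>i<n. s i) * u 0" by (simp add: sum_distrib_right)
  finally have "norm (endpoint n u) = real_of_int \<bar>\<Sum>i<n. s i\<bar>"
    using torus_norm[OF u, of 0] False by (simp add: norm_mult del: of_int_sum)
  moreover have "even (\<Sum>i<m. s i) \<longleftrightarrow> even m" for m
  proof (induction m)
    case (Suc m)
    have "odd (s m)" by (simp add: s_def)
    with Suc show ?case by simp
  qed simp
  ultimately show ?thesis by blast
qed

section \<open>Spaces of polygons with given end point\<close>

abbreviation "coords n \<equiv> product_topology (\<lambda>_. euclidean :: complex topology) {..<n}"

text \<open>The fibres of the end point map.\<close>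

definition polygons :: "nat \<Rightarrow> complex \<Rightarrow> (nat \<Rightarrow> complex) set" where
  "polygons n v = {u \<in> torus n. endpoint n u = v}"

lemma parallel_transportD:
  assumes "parallel_transport n D \<tau>" "u \<in> torus n" "endpoint n u \<in> D"
  shows "\<tau> u (endpoint n u) = u"
    and "v \<in> D \<Longrightarrow> \<tau> u v \<in> polygons n v"
    and "v \<in> D \<Longrightarrow> \<tau> (\<tau> u v) (endpoint n u) = u"
  using assms unfolding parallel_transport_def polygons_def by blast+

lemma continuous_map_endpoint:
  assumes "continuous_map X (torus_space n) f"
  shows "continuous_map X euclidean (\<lambda>x. endpoint n (f x))"
  using assms unfolding endpoint_def continuous_map_into_torus_space
  by (intro continuous_map_sum) auto

lemma continuous_map_parallel_transport:
  assumes \<tau>: "parallel_transport n D \<tau>" and f: "continuous_map X (torus_space n) f"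
    and g: "continuous_map X euclidean g"
    and D: "\<And>x. x \<in> topspace X \<Longrightarrow> endpoint n (f x) \<in> D \<and> g x \<in> D"
  shows "continuous_map X (torus_space n) (\<lambda>x. \<tau> (f x) (g x))"
proof -
  have "continuous_map X (prod_topology (subtopology (torus_space n) {u. endpoint n u \<in> D}) (top_of_set D))
      (\<lambda>x. (f x, g x))"
    using f g D by (intro continuous_map_pairedI) (auto simp: continuous_map_in_subtopology)
  from continuous_map_compose[OF this, of "torus_space n" "\<lambda>(u, v). \<tau> u v"] \<tau> show ?thesis
    unfolding parallel_transport_def by (simp add: o_def)
qed

lemma compactin_polygons: "compactin (coords n) (polygons n v)"
proof -
  have "closedin (torus_space n) {u \<in> topspace (torus_space n). endpoint n u \<in> {v}}"
    by (rule closedin_continuous_map_preimage[OF continuous_map_endpoint[OF continuous_map_id[unfolded id_def]]]) simp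
  then have "compactin (torus_space n) (polygons n v)"
    using closedin_compact_space[OF compact_torus_space] by (simp add: polygons_def)
  then show ?thesis by (simp add: torus_space_def compactin_subtopology)
qed

text \<open>Normalising the coordinates retracts the tuples of non-zero complex numbers to the torus; near the
fibre, transport to the end point \<open>v\<close> is a further retraction, by which points of the fibre do not
move.\<close>

lemma polygons_neighbourhood_retract:
  assumes \<tau>: "parallel_transport n (ball v \<epsilon>) \<tau>" and \<epsilon>: "\<epsilon> > 0"
  shows "\<exists>W. openin (coords n) W \<and> polygons n v retract_of_space (subtopology (coords n) W)"
proof -
  define A where "A = PiE {..<n} (\<lambda>_. - {0::complex})"
  define \<nu> where "\<nu> x = (\<lambda>i\<in>{..<n}. sgn (x i))" for x :: "nat \<Rightarrow> complex"
  have Aopen: "openin (coords n) A" unfolding A_def by (auto simp: openin_PiE)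
  have nz: "x i \<noteq> 0" if "x \<in> A" "i < n" for x i
    using PiE_mem[OF that(1)[unfolded A_def], of i] that(2) by simp
  have \<nu>: "continuous_map (subtopology (coords n) A) (torus_space n) \<nu>"
    unfolding continuous_map_into_torus_space
  proof (intro conjI allI impI funcsetI)
    fix x assume "x \<in> topspace (subtopology (coords n) A)"
    then have "norm (sgn (x i)) = 1" if "i < n" for i using nz[OF _ that] by (simp add: norm_sgn)
    then show "\<nu> x \<in> torus n" unfolding torus_def by (intro PiE_I) (simp_all add: \<nu>_def)
  next
    fix i assume i: "i < n"
    have comp: "continuous_map (subtopology (coords n) A) euclidean (\<lambda>x. x i)"
      using i by (intro continuous_map_from_subtopology continuous_map_product_projection) auto
    show "continuous_map (subtopology (coords n) A) euclidean (\<lambda>x. \<nu> x i)"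
      unfolding continuous_map_euclidean_iff_tendsto
    proof
      fix x assume x: "x \<in> topspace (subtopology (coords n) A)"
      have "((\<lambda>x. x i) \<longlongrightarrow> x i) (atin (subtopology (coords n) A) x)"
        using comp x unfolding continuous_map_euclidean_iff_tendsto by blast
      moreover have "x i \<noteq> 0" using x nz[OF _ i] by simp
      ultimately show "((\<lambda>x. \<nu> x i) \<longlongrightarrow> \<nu> x i) (atin (subtopology (coords n) A) x)"
        using i by (auto simp: \<nu>_def intro!: tendsto_sgn)
    qed
  qed
  define W where "W = {x \<in> topspace (subtopology (coords n) A). endpoint n (\<nu> x) \<in> ball v \<epsilon>}"
  have "openin (subtopology (coords n) A) W"
    unfolding W_def by (rule openin_continuous_map_preimage[OF continuous_map_endpoint[OF \<nu>]]) simp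
  then have Wopen: "openin (coords n) W" using openin_trans_full Aopen by blast
  have WA: "W \<subseteq> A" by (auto simp: W_def)
  have fix_\<nu>: "\<nu> u = u" if "u \<in> torus n" for u
  proof
    fix i show "\<nu> u i = u i"
      using torus_norm[OF that, of i] PiE_arb[OF that[unfolded torus_def], of i]
      by (cases "i < n") (simp_all add: \<nu>_def sgn_div_norm)
  qed
  have PW: "polygons n v \<subseteq> W"
  proof
    fix u assume u: "u \<in> polygons n v"
    then have t: "u \<in> torus n" "endpoint n u = v" by (auto simp: polygons_def)
    have "u i \<noteq> 0" if "i < n" for i using torus_norm[OF t(1) that] by auto
    then have "u \<in> A"
      unfolding A_def using PiE_arb[OF t(1)[unfolded torus_def]] by (intro PiE_I) auto
    then show "u \<in> W" using t \<epsilon> fix_\<nu>[OF t(1)] Aopen[THEN openin_subset] by (auto simp: W_def)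
  qed
  define \<rho> where "\<rho> x = \<tau> (\<nu> x) v" for x
  have "continuous_map (subtopology (coords n) W) (torus_space n) \<rho>"
    unfolding \<rho>_def
  proof (rule continuous_map_parallel_transport[OF \<tau>])
    show "continuous_map (subtopology (coords n) W) (torus_space n) \<nu>"
      by (rule continuous_map_from_subtopology_mono[OF \<nu> WA])
  qed (use \<epsilon> in \<open>auto simp: W_def\<close>)
  then have "continuous_map (subtopology (coords n) W) (coords n) \<rho>"
    unfolding torus_space_def by (rule continuous_map_into_fulltopology)
  moreover have "\<rho> x \<in> polygons n v" if "x \<in> W" for x
  proof -
    have "x \<in> topspace (subtopology (coords n) A)" and x: "endpoint n (\<nu> x) \<in> ball v \<epsilon>"
      using that unfolding W_def by blast+
    then have "\<nu> x \<in> torus n" using \<nu> continuous_map_funspace[OF \<nu>] by (metis PiE_mem Pi_mem topspace_torus_space)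
    moreover have "v \<in> ball v \<epsilon>" using \<epsilon> by simp
    ultimately show ?thesis
      unfolding \<rho>_def using parallel_transportD(2)[OF \<tau> _ x] by blast
  qed
  ultimately have "continuous_map (subtopology (coords n) W) (subtopology (subtopology (coords n) W) (polygons n v)) \<rho>"
    using PW by (auto simp: continuous_map_in_subtopology)
  moreover have "\<rho> u = u" if "u \<in> polygons n v" for u
  proof -
    have u: "u \<in> torus n" "endpoint n u = v" using that by (auto simp: polygons_def)
    have "\<tau> u (endpoint n u) = u"
      by (rule parallel_transportD[OF \<tau> u(1)]) (simp add: u(2) \<epsilon>)
    then show ?thesis using u(2) fix_\<nu>[OF u(1)] by (simp add: \<rho>_def)
  qed
  ultimately have "polygons n v retract_of_space (subtopology (coords n) W)"
    unfolding retract_of_space_def topspace_subtopology_subset[OF openin_subset[OF Wopen]]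
    using PW by blast
  with Wopen show ?thesis by blast
qed

text \<open>The dimension is a term here, so Euclidean space is a product topology and the role of convex open
sets is played by products of convex open sets.\<close>

definition boxes :: "nat \<Rightarrow> (nat \<Rightarrow> complex) set set" where
  "boxes n = {PiE {..<n} B | B. \<forall>i<n. open (B i) \<and> convex (B i)}"

lemma boxes_open: "B \<in> boxes n \<Longrightarrow> openin (coords n) B"
  by (auto simp: boxes_def openin_PiE)

lemma boxes_Int: "B \<in> boxes n \<Longrightarrow> C \<in> boxes n \<Longrightarrow> B \<inter> C \<in> boxes n"
  unfolding boxes_def
proof clarify
  fix B C :: "nat \<Rightarrow> complex set"
  assume "\<forall>i<n. open (B i) \<and> convex (B i)" "\<forall>i<n. open (C i) \<and> convex (C i)"
  then show "\<exists>D. PiE {..<n} B \<inter> PiE {..<n} C = PiE {..<n} D \<and> (\<forall>i<n. open (D i) \<and> convex (D i))"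
    by (intro exI[of _ "\<lambda>i. B i \<inter> C i"]) (auto simp: PiE_Int convex_Int)
qed

lemma boxes_contractible: "B \<in> boxes n \<Longrightarrow> contractible_space (subtopology (coords n) B)"
  unfolding boxes_def
proof clarify
  fix B :: "nat \<Rightarrow> complex set" assume "\<forall>i<n. open (B i) \<and> convex (B i)"
  then have "contractible (B i)" if "i < n" for i using that by (simp add: convex_imp_contractible)
  then show "contractible_space (subtopology (coords n) (PiE {..<n} B))"
    unfolding subtopology_product_topology contractible_space_product_topology by auto
qed

lemma boxes_base:
  assumes "openin (coords n) W" "x \<in> W"
  shows "\<exists>B\<in>boxes n. x \<in> B \<and> B \<subseteq> W"
proof -
  obtain U where U: "\<forall>i\<in>{..<n}. openin (euclidean :: complex topology) (U i)" "x \<in> PiE {..<n} U" "PiE {..<n} U \<subseteq> W"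
    using assms(1)[unfolded openin_product_topology_alt, THEN bspec, OF assms(2)]
    by (elim exE conjE) (rule that)
  have "\<exists>B. open B \<and> convex B \<and> x i \<in> B \<and> B \<subseteq> U i" if "i < n" for i
  proof -
    have "open (U i)" "x i \<in> U i" using U that by (auto simp: PiE_iff)
    then obtain e where "e > 0" "ball (x i) e \<subseteq> U i" using open_contains_ball by blast
    then show ?thesis by (intro exI[of _ "ball (x i) e"]) auto
  qed
  then obtain B where B: "\<And>i. i < n \<Longrightarrow> open (B i) \<and> convex (B i) \<and> x i \<in> B i \<and> B i \<subseteq> U i" by metis
  have mem: "PiE {..<n} B \<in> boxes n" using B by (auto simp: boxes_def)
  have x: "x \<in> PiE {..<n} B" using B U(2) by (auto simp: PiE_iff)
  have "PiE {..<n} B \<subseteq> PiE {..<n} U" using B by (intro PiE_mono) auto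
  from x subset_trans[OF this U(3)] show ?thesis
    by (intro bexI[OF _ mem] conjI)
qed

lemma retract_of_space_Times:
  assumes "S retract_of_space X" "T retract_of_space Y"
  shows "(S \<times> T) retract_of_space (prod_topology X Y)"
proof -
  obtain r s where r: "continuous_map X (subtopology X S) r" "\<And>x. x \<in> S \<Longrightarrow> r x = x"
    and s: "continuous_map Y (subtopology Y T) s" "\<And>x. x \<in> T \<Longrightarrow> s x = x"
    using assms unfolding retract_of_space_def by blast
  have "continuous_map (prod_topology X Y) (prod_topology (subtopology X S) (subtopology Y T)) (\<lambda>z. (r (fst z), s (snd z)))"
    using continuous_map_compose[OF continuous_map_fst r(1)] continuous_map_compose[OF continuous_map_snd s(1)]
    by (intro continuous_map_pairedI) (simp_all add: o_def)
  moreover have "S \<times> T \<subseteq> topspace (prod_topology X Y)"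
    using assms unfolding retract_of_space_def by auto
  ultimately show ?thesis
    unfolding retract_of_space_def subtopology_Times
    using r(2) s(2) by (intro conjI exI[of _ "\<lambda>z. (r (fst z), s (snd z))"]) auto
qed

lemma euler_polygons_Times:
  assumes "parallel_transport n (ball v \<epsilon>) \<tau>" "\<epsilon> > 0" "parallel_transport n' (ball v' \<epsilon>') \<tau>'" "\<epsilon>' > 0"
  shows "\<exists>k. has_euler_characteristic (subtopology (prod_topology (coords n) (coords n')) (polygons n v \<times> polygons n' v')) k"
proof -
  obtain W where W: "openin (coords n) W" "polygons n v retract_of_space (subtopology (coords n) W)"
    using polygons_neighbourhood_retract[OF assms(1,2)] by blast
  obtain W' where W': "openin (coords n') W'" "polygons n' v' retract_of_space (subtopology (coords n') W')"
    using polygons_neighbourhood_retract[OF assms(3,4)] by blast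
  define \<B> where "\<B> = {B \<times> B' | B B'. B \<in> boxes n \<and> B' \<in> boxes n'}"
  show ?thesis
  proof (rule euler_compact_neighbourhood_retract)
    fix B assume "B \<in> \<B>"
    then obtain D D' where B: "B = D \<times> D'" "D \<in> boxes n" "D' \<in> boxes n'" by (auto simp: \<B>_def)
    show "openin (prod_topology (coords n) (coords n')) B"
      using B boxes_open by (simp add: openin_prod_Times_iff)
    have "contractible_space (subtopology (prod_topology (coords n) (coords n')) B)"
      using B boxes_contractible by (simp add: subtopology_Times contractible_space_prod_topology)
    then show "\<exists>k. has_euler_characteristic (subtopology (prod_topology (coords n) (coords n')) B) k"
      by (rule has_euler_characteristic_contractible)
  next
    fix B C assume "B \<in> \<B>" "C \<in> \<B>"
    then obtain D D' E E' where "B = D \<times> D'" "C = E \<times> E'"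
        and D: "D \<in> boxes n" "D' \<in> boxes n'" "E \<in> boxes n" "E' \<in> boxes n'"
      unfolding \<B>_def by blast
    then have "B \<inter> C = (D \<inter> E) \<times> (D' \<inter> E')" by (simp add: Times_Int_Times)
    then show "B \<inter> C \<in> \<B>"
      unfolding \<B>_def using boxes_Int[OF D(1,3)] boxes_Int[OF D(2,4)] by blast
  next
    fix x W assume W: "openin (prod_topology (coords n) (coords n')) W" "x \<in> W"
    then have "(fst x, snd x) \<in> W" by simp
    then have "\<exists>U V. openin (coords n) U \<and> openin (coords n') V \<and> fst x \<in> U \<and> snd x \<in> V \<and> U \<times> V \<subseteq> W"
      by (rule W(1)[unfolded openin_prod_topology_alt, rule_format])
    then obtain U V where UV: "openin (coords n) U" "openin (coords n') V" "fst x \<in> U" "snd x \<in> V" "U \<times> V \<subseteq> W"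
      by (elim exE conjE) (rule that)
    obtain B where B: "B \<in> boxes n" "fst x \<in> B" "B \<subseteq> U" using boxes_base[OF UV(1,3)] by blast
    obtain B' where B': "B' \<in> boxes n'" "snd x \<in> B'" "B' \<subseteq> V" using boxes_base[OF UV(2,4)] by blast
    have mem: "B \<times> B' \<in> \<B>" unfolding \<B>_def using B(1) B'(1) by blast
    have x: "x \<in> B \<times> B'" using B(2) B'(2) by (simp add: mem_Times_iff)
    have "B \<times> B' \<subseteq> W" using Sigma_mono[OF B(3) B'(3)] UV(5) by (rule subset_trans)
    with x show "\<exists>B\<in>\<B>. x \<in> B \<and> B \<subseteq> W" by (intro bexI[OF _ mem] conjI)
  next
    show "compactin (prod_topology (coords n) (coords n')) (polygons n v \<times> polygons n' v')"
      by (simp add: compactin_Times compactin_polygons)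
    show "openin (prod_topology (coords n) (coords n')) (W \<times> W')"
      using W(1) W'(1) by (simp add: openin_prod_Times_iff)
    show "polygons n v \<times> polygons n' v' retract_of_space subtopology (prod_topology (coords n) (coords n')) (W \<times> W')"
      unfolding subtopology_Times by (rule retract_of_space_Times[OF W(2) W'(2)])
  qed
qed

section \<open>Pairs of polygons over a curve of end points\<close>

text \<open>The fibre product, over the end point, of a curve \<open>e\<close> on the circle with two end point maps.\<close>

definition edge_space :: "nat \<Rightarrow> nat \<Rightarrow> (complex \<Rightarrow> complex) \<Rightarrow> (complex \<times> (nat \<Rightarrow> complex) \<times> (nat \<Rightarrow> complex)) topology" where
  "edge_space n2 n3 e =
     subtopology (prod_topology (top_of_set (sphere 0 1)) (prod_topology (torus_space n2) (torus_space n3)))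
       {(w, u, u'). u \<in> polygons n2 (e w) \<and> u' \<in> polygons n3 (e w)}"

lemma topspace_edge_space:
  "topspace (edge_space n2 n3 e) = {(w, u, u'). w \<in> sphere 0 1 \<and> u \<in> polygons n2 (e w) \<and> u' \<in> polygons n3 (e w)}"
  by (auto simp: edge_space_def polygons_def)

lemma continuous_map_edge_space_projections:
  "continuous_map (edge_space n2 n3 e) (top_of_set (sphere 0 1)) fst"
  "continuous_map (edge_space n2 n3 e) (torus_space n2) (\<lambda>z. fst (snd z))"
  "continuous_map (edge_space n2 n3 e) (torus_space n3) (\<lambda>z. snd (snd z))"
  unfolding edge_space_def
  using continuous_map_compose[OF continuous_map_snd continuous_map_fst]
    continuous_map_compose[OF continuous_map_snd continuous_map_snd]
  by (auto intro!: continuous_map_from_subtopology continuous_map_fst simp: o_def)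

lemma continuous_map_into_edge_space:
  assumes "continuous_map X (top_of_set (sphere 0 1)) f" "continuous_map X (torus_space n2) g"
    "continuous_map X (torus_space n3) h"
    "\<And>x. x \<in> topspace X \<Longrightarrow> g x \<in> polygons n2 (e (f x)) \<and> h x \<in> polygons n3 (e (f x))"
  shows "continuous_map X (edge_space n2 n3 e) (\<lambda>x. (f x, g x, h x))"
  unfolding edge_space_def continuous_map_in_subtopology
  using assms by (auto intro!: continuous_map_pairedI)

text \<open>Over the points \<open>w\<close> for which \<open>e w\<close> lies in both balls, both chains of edges are transported to the
end point \<open>e b\<close>; transport back to \<open>e w\<close> is the inverse.\<close>

lemma edge_space_locally_trivial:
  assumes e: "continuous_on (sphere 0 1) e"
    and tr2: "\<And>w. w \<in> sphere 0 1 \<Longrightarrow> \<exists>\<epsilon>>0. \<exists>\<tau>. parallel_transport n2 (ball (e w) \<epsilon>) \<tau>"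
    and tr3: "\<And>w. w \<in> sphere 0 1 \<Longrightarrow> \<exists>\<epsilon>>0. \<exists>\<tau>. parallel_transport n3 (ball (e w) \<epsilon>) \<tau>"
  shows "locally_trivial_fibration (edge_space n2 n3 e) (top_of_set (sphere 0 1)) fst"
  unfolding locally_trivial_fibration_def
proof (intro conjI ballI)
  let ?S = "sphere (0::complex) 1" and ?E = "edge_space n2 n3 e"
  show "continuous_map ?E (top_of_set ?S) fst" by (rule continuous_map_edge_space_projections)
  fix b assume "b \<in> topspace (top_of_set ?S)"
  then have b: "b \<in> ?S" by simp
  obtain \<epsilon>2 \<tau>2 where \<tau>2: "\<epsilon>2 > 0" "parallel_transport n2 (ball (e b) \<epsilon>2) \<tau>2" using tr2[OF b] by blast
  obtain \<epsilon>3 \<tau>3 where \<tau>3: "\<epsilon>3 > 0" "parallel_transport n3 (ball (e b) \<epsilon>3) \<tau>3" using tr3[OF b] by blast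
  define U where "U = ?S \<inter> e -` (ball (e b) \<epsilon>2 \<inter> ball (e b) \<epsilon>3)"
  have "openin (top_of_set ?S) U"
    unfolding U_def by (intro continuous_openin_preimage_gen e) auto
  moreover have bU: "b \<in> U" using b \<tau>2(1) \<tau>3(1) by (simp add: U_def)
  have US: "U \<subseteq> ?S" by (auto simp: U_def)
  define h where "h z = (fst z, (b, \<tau>2 (fst (snd z)) (e b), \<tau>3 (snd (snd z)) (e b)))" for z :: "complex \<times> (nat \<Rightarrow> complex) \<times> (nat \<Rightarrow> complex)"
  define g where "g y = (fst y, \<tau>2 (fst (snd (snd y))) (e (fst y)), \<tau>3 (snd (snd (snd y))) (e (fst y)))"
    for y :: "complex \<times> complex \<times> (nat \<Rightarrow> complex) \<times> (nat \<Rightarrow> complex)"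
  let ?EU = "subtopology ?E {z \<in> topspace ?E. fst z \<in> U}" and ?F = "subtopology ?E {z \<in> topspace ?E. fst z = b}"
  let ?Y = "prod_topology (subtopology (top_of_set ?S) U) ?F"
  have tEU: "topspace ?EU = {z \<in> topspace ?E. fst z \<in> U}" by auto
  have tY: "topspace ?Y = U \<times> {z \<in> topspace ?E. fst z = b}" using US by auto
  have T2: "\<tau>2 u v \<in> polygons n2 v \<and> \<tau>2 (\<tau>2 u v) (endpoint n2 u) = u"
    if "u \<in> torus n2" "endpoint n2 u \<in> ball (e b) \<epsilon>2" "v \<in> ball (e b) \<epsilon>2" for u v
    using parallel_transportD(2,3)[OF \<tau>2(2) that(1,2,3)] by blast
  have T3: "\<tau>3 u v \<in> polygons n3 v \<and> \<tau>3 (\<tau>3 u v) (endpoint n3 u) = u"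
    if "u \<in> torus n3" "endpoint n3 u \<in> ball (e b) \<epsilon>3" "v \<in> ball (e b) \<epsilon>3" for u v
    using parallel_transportD(2,3)[OF \<tau>3(2) that(1,2,3)] by blast
  have R2: "\<tau>2 (\<tau>2 u v) v' = u" if "u \<in> polygons n2 v'" "v' \<in> ball (e b) \<epsilon>2" "v \<in> ball (e b) \<epsilon>2" for u v v'
    using T2[of u v] that by (simp add: polygons_def)
  have R3: "\<tau>3 (\<tau>3 u v) v' = u" if "u \<in> polygons n3 v'" "v' \<in> ball (e b) \<epsilon>3" "v \<in> ball (e b) \<epsilon>3" for u v v'
    using T3[of u v] that by (simp add: polygons_def)
  have ball: "e w \<in> ball (e b) \<epsilon>2" "e w \<in> ball (e b) \<epsilon>3" if "w \<in> U" for w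
    using that by (auto simp: U_def)
  have pr: "continuous_map ?EU (top_of_set ?S) fst" "continuous_map ?EU (torus_space n2) (\<lambda>z. fst (snd z))"
    "continuous_map ?EU (torus_space n3) (\<lambda>z. snd (snd z))"
    by (intro continuous_map_from_subtopology continuous_map_edge_space_projections)+
  have prF: "continuous_map ?F (torus_space n2) (\<lambda>z. fst (snd z))" "continuous_map ?F (torus_space n3) (\<lambda>z. snd (snd z))"
    by (intro continuous_map_from_subtopology continuous_map_edge_space_projections)+
  have "homeomorphic_maps ?EU ?Y h g"
    unfolding homeomorphic_maps_def
  proof (intro conjI ballI)
    show "continuous_map ?EU ?Y h"
      unfolding h_def
    proof (intro continuous_map_pairedI)
      show "continuous_map ?EU (subtopology (top_of_set ?S) U) fst"
        using pr(1) by (auto simp: continuous_map_in_subtopology)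
      have "continuous_map ?EU ?E (\<lambda>z. (b, \<tau>2 (fst (snd z)) (e b), \<tau>3 (snd (snd z)) (e b)))"
      proof (rule continuous_map_into_edge_space)
        show "continuous_map ?EU (top_of_set ?S) (\<lambda>_. b)" using b by (simp add: continuous_map_const)
        show "continuous_map ?EU (torus_space n2) (\<lambda>z. \<tau>2 (fst (snd z)) (e b))"
          using ball bU \<tau>2(1) \<tau>3(1) by (intro continuous_map_parallel_transport[OF \<tau>2(2) pr(2)])
            (auto simp: topspace_edge_space polygons_def)
        show "continuous_map ?EU (torus_space n3) (\<lambda>z. \<tau>3 (snd (snd z)) (e b))"
          using ball bU \<tau>2(1) \<tau>3(1) by (intro continuous_map_parallel_transport[OF \<tau>3(2) pr(3)])
            (auto simp: topspace_edge_space polygons_def)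
        fix z assume "z \<in> topspace ?EU"
        then show "\<tau>2 (fst (snd z)) (e b) \<in> polygons n2 (e b) \<and> \<tau>3 (snd (snd z)) (e b) \<in> polygons n3 (e b)"
          using T2 T3 ball bU \<tau>2(1) \<tau>3(1) by (auto simp: topspace_edge_space polygons_def)
      qed
      then show "continuous_map ?EU ?F (\<lambda>z. (b, \<tau>2 (fst (snd z)) (e b), \<tau>3 (snd (snd z)) (e b)))"
        unfolding continuous_map_in_subtopology by (auto simp: continuous_map_def)
    qed
    have prY: "continuous_map ?Y (subtopology (top_of_set ?S) U) fst" "continuous_map ?Y ?F snd"
      by (auto intro: continuous_map_fst continuous_map_snd)
    have fstS: "continuous_map ?Y (top_of_set ?S) fst"
      by (rule continuous_map_into_fulltopology[OF prY(1)])
    have eY: "continuous_map ?Y euclidean (\<lambda>y. e (fst y))"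
      using continuous_map_compose[OF fstS, of euclidean e] e by (simp add: o_def)
    have cF: "continuous_map ?Y (torus_space n2) (\<lambda>y. fst (snd (snd y)))" "continuous_map ?Y (torus_space n3) (\<lambda>y. snd (snd (snd y)))"
      using continuous_map_compose[OF prY(2) prF(1)] continuous_map_compose[OF prY(2) prF(2)] by (simp_all add: o_def)
    have "continuous_map ?Y ?E g"
      unfolding g_def
    proof (rule continuous_map_into_edge_space[OF fstS])
      show "continuous_map ?Y (torus_space n2) (\<lambda>y. \<tau>2 (fst (snd (snd y))) (e (fst y)))"
        using ball bU \<tau>2(1) \<tau>3(1) by (intro continuous_map_parallel_transport[OF \<tau>2(2) cF(1) eY])
          (auto simp: topspace_edge_space polygons_def)
      show "continuous_map ?Y (torus_space n3) (\<lambda>y. \<tau>3 (snd (snd (snd y))) (e (fst y)))"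
        using ball bU \<tau>2(1) \<tau>3(1) by (intro continuous_map_parallel_transport[OF \<tau>3(2) cF(2) eY])
          (auto simp: topspace_edge_space polygons_def)
      fix y assume "y \<in> topspace ?Y"
      then show "\<tau>2 (fst (snd (snd y))) (e (fst y)) \<in> polygons n2 (e (fst y)) \<and> \<tau>3 (snd (snd (snd y))) (e (fst y)) \<in> polygons n3 (e (fst y))"
        unfolding tY using T2 T3 ball bU \<tau>2(1) \<tau>3(1) by (auto simp: topspace_edge_space polygons_def)
    qed
    then show "continuous_map ?Y ?EU g"
      unfolding continuous_map_in_subtopology using US by (auto simp: continuous_map_def g_def)
  next
    fix z assume "z \<in> topspace ?EU"
    then show "g (h z) = z"
      unfolding tEU using R2[OF _ ball(1) ball(1)] R3[OF _ ball(2) ball(2)] bU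
      by (auto simp: g_def h_def topspace_edge_space)
  next
    fix y assume "y \<in> topspace ?Y"
    then show "h (g y) = y"
      unfolding tY using R2[OF _ ball(1) ball(1)] R3[OF _ ball(2) ball(2)] bU
      by (auto simp: g_def h_def topspace_edge_space)
  qed
  then have "homeomorphic_map ?EU ?Y h" using homeomorphic_map_maps by blast
  moreover have "\<forall>z\<in>topspace ?E. fst z \<in> U \<longrightarrow> fst (h z) = fst z" by (simp add: h_def)
  ultimately show "\<exists>U h. openin (top_of_set ?S) U \<and> b \<in> U \<and>
        homeomorphic_map (subtopology ?E {z \<in> topspace ?E. fst z \<in> U})
          (prod_topology (subtopology (top_of_set ?S) U) (subtopology ?E {z \<in> topspace ?E. fst z = b})) h \<and>
        (\<forall>z\<in>topspace ?E. fst z \<in> U \<longrightarrow> fst (h z) = fst z)"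
    using bU by blast
qed

lemma edge_space_fibre_euler:
  assumes b: "b \<in> sphere 0 1"
    and "\<exists>\<epsilon>>0. \<exists>\<tau>. parallel_transport n2 (ball (e b) \<epsilon>) \<tau>"
    and "\<exists>\<epsilon>>0. \<exists>\<tau>. parallel_transport n3 (ball (e b) \<epsilon>) \<tau>"
  shows "\<exists>k. has_euler_characteristic (subtopology (edge_space n2 n3 e) {z \<in> topspace (edge_space n2 n3 e). fst z = b}) k"
proof -
  let ?P = "polygons n2 (e b) \<times> polygons n3 (e b)"
  let ?X = "subtopology (prod_topology (coords n2) (coords n3)) ?P"
  let ?E = "edge_space n2 n3 e"
  let ?F = "subtopology ?E {z \<in> topspace ?E. fst z = b}"
  have PT: "polygons n v \<subseteq> torus n" for n v by (auto simp: polygons_def)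
  then have sub: "?P \<subseteq> torus n2 \<times> torus n3" by auto
  have X: "?X = subtopology (prod_topology (torus_space n2) (torus_space n3)) ?P"
    unfolding torus_space_def subtopology_Times[symmetric] subtopology_subtopology
    using sub by (simp add: Int_absorb1)
  have "continuous_map ?F (prod_topology (torus_space n2) (torus_space n3)) snd"
    by (auto intro!: continuous_map_from_subtopology continuous_map_snd simp: edge_space_def)
  then have 1: "continuous_map ?F ?X snd"
    unfolding X continuous_map_in_subtopology by (auto simp: topspace_edge_space)
  have pr: "continuous_map ?X (torus_space n2) fst" "continuous_map ?X (torus_space n3) snd"
    unfolding X by (intro continuous_map_from_subtopology continuous_map_fst continuous_map_snd)+
  have "continuous_map ?X ?E (\<lambda>x. (b, fst x, snd x))"
    by (rule continuous_map_into_edge_space[OF _ pr]) (use b in \<open>auto simp: continuous_map_const\<close>)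
  then have 2: "continuous_map ?X ?F (\<lambda>x. (b, x))"
    unfolding continuous_map_in_subtopology by (auto simp: continuous_map_def)
  have "homeomorphic_maps ?F ?X snd (\<lambda>x. (b, x))"
    unfolding homeomorphic_maps_def using 1 2 by auto
  then have "?X homeomorphic_space ?F"
    using homeomorphic_maps_imp_homeomorphic_space homeomorphic_space_sym by blast
  then have "?X homotopy_equivalent_space ?F" by (rule homeomorphic_imp_homotopy_equivalent_space)
  moreover obtain k where "has_euler_characteristic ?X k"
    using euler_polygons_Times assms(2,3) by blast
  ultimately show ?thesis using has_euler_characteristic_homotopy_equivalent by blast
qed

text \<open>Everything is carried along the homeomorphism: the chart of \<open>E\<close> is preceded by \<open>\<phi>\<close> and followed by \<open>\<psi>\<close>
on the fibre.\<close>

lemma locally_trivial_fibration_homeomorphic: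
  assumes \<phi>: "homeomorphic_maps M E \<phi> \<psi>" and lt: "locally_trivial_fibration E B q"
    and qp: "\<And>x. x \<in> topspace M \<Longrightarrow> q (\<phi> x) = p x"
  shows "locally_trivial_fibration M B p"
  unfolding locally_trivial_fibration_def
proof (intro conjI ballI)
  have c\<phi>: "continuous_map M E \<phi>" and c\<psi>: "continuous_map E M \<psi>"
    and inv: "\<And>x. x \<in> topspace M \<Longrightarrow> \<psi> (\<phi> x) = x" "\<And>e. e \<in> topspace E \<Longrightarrow> \<phi> (\<psi> e) = e"
    using \<phi> by (auto simp: homeomorphic_maps_def)
  have \<phi>E: "\<phi> x \<in> topspace E" if "x \<in> topspace M" for x
    using continuous_map_funspace[OF c\<phi>] that by (rule Pi_mem)
  have \<psi>M: "\<psi> x \<in> topspace M" if "x \<in> topspace E" for x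
    using continuous_map_funspace[OF c\<psi>] that by (rule Pi_mem)
  have pq: "p (\<psi> e) = q e" if "e \<in> topspace E" for e
    using qp[OF \<psi>M[OF that]] inv(2)[OF that] by simp
  have "continuous_map E B q" using lt by (simp add: locally_trivial_fibration_def)
  then have "continuous_map M B (q \<circ> \<phi>)" by (rule continuous_map_compose[OF c\<phi>])
  then show "continuous_map M B p" by (rule continuous_map_eq) (simp add: qp)
  fix b assume "b \<in> topspace B"
  then obtain U h where U: "openin B U" "b \<in> U"
    and h: "homeomorphic_map (subtopology E {e \<in> topspace E. q e \<in> U})
          (prod_topology (subtopology B U) (subtopology E {e \<in> topspace E. q e = b})) h"
    and fh: "\<forall>e\<in>topspace E. q e \<in> U \<longrightarrow> fst (h e) = q e"
    using lt unfolding locally_trivial_fibration_def by blast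
  have restr: "homeomorphic_maps (subtopology M {x \<in> topspace M. P (p x)}) (subtopology E {e \<in> topspace E. P (q e)}) \<phi> \<psi>" for P
    by (rule homeomorphic_maps_subtopologies_alt[OF \<phi>]) (auto simp: qp pq \<phi>E \<psi>M)
  have "homeomorphic_maps (prod_topology (subtopology B U) (subtopology E {e \<in> topspace E. q e = b}))
     (prod_topology (subtopology B U) (subtopology M {x \<in> topspace M. p x = b}))
     (\<lambda>(x, y). (id x, \<psi> y)) (\<lambda>(x, y). (id x, \<phi> y))"
    unfolding homeomorphic_maps_prod
    using homeomorphic_maps_id[THEN iffD2, OF refl] restr[of "\<lambda>t. t = b", THEN homeomorphic_maps_sym[THEN iffD1]]
    by (intro disjI2 conjI)
  then have k: "homeomorphic_map (prod_topology (subtopology B U) (subtopology E {e \<in> topspace E. q e = b}))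
     (prod_topology (subtopology B U) (subtopology M {x \<in> topspace M. p x = b})) (\<lambda>(x, y). (id x, \<psi> y))"
    by (rule homeomorphic_maps_map[THEN iffD1, THEN conjunct1])
  have "homeomorphic_map (subtopology M {x \<in> topspace M. p x \<in> U}) (subtopology E {e \<in> topspace E. q e \<in> U}) \<phi>"
    using restr[of "\<lambda>t. t \<in> U"] by (rule homeomorphic_maps_map[THEN iffD1, THEN conjunct1])
  from homeomorphic_map_compose[OF homeomorphic_map_compose[OF this h] k]
  have "homeomorphic_map (subtopology M {x \<in> topspace M. p x \<in> U})
     (prod_topology (subtopology B U) (subtopology M {x \<in> topspace M. p x = b})) ((\<lambda>(x, y). (id x, \<psi> y)) \<circ> (h \<circ> \<phi>))" .
  moreover have "\<forall>x\<in>topspace M. p x \<in> U \<longrightarrow> fst (((\<lambda>(x, y). (id x, \<psi> y)) \<circ> (h \<circ> \<phi>)) x) = p x"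
    using fh qp \<phi>E by (simp add: case_prod_beta)
  ultimately show "\<exists>U h. openin B U \<and> b \<in> U \<and>
      homeomorphic_map (subtopology M {x \<in> topspace M. p x \<in> U})
        (prod_topology (subtopology B U) (subtopology M {x \<in> topspace M. p x = b})) h \<and>
      (\<forall>x\<in>topspace M. p x \<in> U \<longrightarrow> fst (h x) = p x)"
    using U by (intro exI conjI)
qed

section \<open>The quotient by rotations as a space of edge vectors\<close>

definition edges :: "nat \<Rightarrow> (nat \<Rightarrow> complex) \<Rightarrow> nat \<Rightarrow> complex" where
  "edges n y = (\<lambda>i\<in>{..<n}. y (Suc i) - y i)"

definition vertices :: "nat \<Rightarrow> (nat \<Rightarrow> complex) \<Rightarrow> nat \<Rightarrow> complex" where
  "vertices n u = (\<lambda>i\<in>{..n}. \<Sum>j<i. u j)"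

lemma free_configs_iff:
  "x \<in> free_configs d \<longleftrightarrow> x \<in> extensional {..length d} \<and> (\<forall>i<length d. norm (x (Suc i) - x i) = d ! i)"
  by (simp add: free_configs_def PiE_iff dist_norm norm_minus_commute)

lemma edges_in_torus: "y \<in> free_configs (replicate n 1) \<Longrightarrow> edges n y \<in> torus n"
  unfolding torus_def by (intro PiE_I) (simp_all add: free_configs_iff edges_def)

lemma endpoint_edges: "endpoint n (edges n y) = y n - y 0"
  unfolding endpoint_def edges_def by (simp add: sum_lessThan_telescope)

lemma vertices_endpoint: "vertices n u n = endpoint n u"
  by (simp add: vertices_def endpoint_def)

lemma vertices_in_free_configs: "u \<in> torus n \<Longrightarrow> vertices n u \<in> free_configs (replicate n 1)"
  by (simp add: free_configs_iff vertices_def torus_norm)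

lemma vertices_edges:
  assumes "y \<in> extensional {..n}" "y 0 = 0" shows "vertices n (edges n y) = y"
proof
  fix i show "vertices n (edges n y) i = y i"
  proof (cases "i \<le> n")
    case True
    then have "(\<Sum>j<i. edges n y j) = (\<Sum>j<i. y (Suc j) - y j)"
      by (intro sum.cong) (simp_all add: edges_def)
    then show ?thesis using True assms(2) by (simp add: vertices_def sum_lessThan_telescope)
  next
    case False
    then show ?thesis using assms(1) by (simp add: vertices_def extensional_def)
  qed
qed

lemma edges_vertices:
  assumes "u \<in> torus n" shows "edges n (vertices n u) = u"
proof
  fix i show "edges n (vertices n u) i = u i"
    using PiE_arb[OF assms[unfolded torus_def], of i]
    by (cases "i < n") (simp_all add: edges_def vertices_def)
qed

lemma rotate_config_rotate_config: "rotate_config n s (rotate_config n t x) = rotate_config n (s * t) x"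
  by (auto simp: rotate_config_def fun_eq_iff)

lemma rotate_config_1: "x \<in> extensional {..n} \<Longrightarrow> rotate_config n 1 x = x"
  by (auto simp: rotate_config_def fun_eq_iff extensional_def)

lemma rotate_config_apply: "i \<le> n \<Longrightarrow> rotate_config n t x i = t * x i"
  by (simp add: rotate_config_def)

lemma rotate_in_free_configs:
  assumes "x \<in> free_configs d" "norm t = 1" shows "rotate_config (length d) t x \<in> free_configs d"
  unfolding free_configs_iff
proof (intro conjI allI impI)
  show "rotate_config (length d) t x \<in> extensional {..length d}" by (simp add: rotate_config_def)
  fix i assume i: "i < length d"
  have "rotate_config (length d) t x (Suc i) - rotate_config (length d) t x i = t * (x (Suc i) - x i)"
    using i by (simp add: rotate_config_apply algebra_simps)
  then show "norm (rotate_config (length d) t x (Suc i) - rotate_config (length d) t x i) = d ! i"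
    using assms i by (simp add: norm_mult free_configs_iff)
qed

lemma topspace_free_config_space: "topspace (free_config_space d) = free_configs d"
  by (auto simp: free_config_space_def free_configs_def)

lemma topspace_C_space:
  "(x, y, z) \<in> topspace (C_space d1 d2 d3) \<longleftrightarrow>
     x \<in> free_configs d1 \<and> y \<in> free_configs d2 \<and> z \<in> free_configs d3 \<and> x 0 = 0 \<and> y 0 = 0 \<and> z 0 = 0 \<and>
     x (length d1) = y (length d2) \<and> y (length d2) = z (length d3)"
  by (auto simp: C_space_def topspace_free_config_space)

lemma continuous_map_into_free_config_space:
  assumes "\<And>x. x \<in> topspace X \<Longrightarrow> f x \<in> free_configs d"
    "\<And>i. i \<le> length d \<Longrightarrow> continuous_map X euclidean (\<lambda>x. f x i)"
  shows "continuous_map X (free_config_space d) f"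
proof -
  have "continuous_map X (product_topology (\<lambda>_. euclidean) {..length d}) f"
    unfolding continuous_map_componentwise using assms by (auto simp: free_configs_iff)
  then show ?thesis
    unfolding free_config_space_def continuous_map_in_subtopology using assms(1) by auto
qed

lemma continuous_map_free_config_component:
  "i \<le> length d \<Longrightarrow> continuous_map (free_config_space d) euclidean (\<lambda>x. x i)"
  unfolding free_config_space_def
  by (intro continuous_map_from_subtopology continuous_map_product_projection) simp

lemma continuous_map_C_space_components:
  "i \<le> length d1 \<Longrightarrow> continuous_map (C_space d1 d2 d3) euclidean (\<lambda>c. fst c i)"
  "i \<le> length d2 \<Longrightarrow> continuous_map (C_space d1 d2 d3) euclidean (\<lambda>c. fst (snd c) i)"
  "i \<le> length d3 \<Longrightarrow> continuous_map (C_space d1 d2 d3) euclidean (\<lambda>c. snd (snd c) i)"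
proof -
  let ?P = "prod_topology (free_config_space d1) (prod_topology (free_config_space d2) (free_config_space d3))"
  have 1: "continuous_map ?P (free_config_space d1) fst" by (rule continuous_map_fst)
  have 2: "continuous_map ?P (free_config_space d2) (fst \<circ> snd)"
    by (rule continuous_map_compose[OF continuous_map_snd continuous_map_fst])
  have 3: "continuous_map ?P (free_config_space d3) (snd \<circ> snd)"
    by (rule continuous_map_compose[OF continuous_map_snd continuous_map_snd])
  show "i \<le> length d1 \<Longrightarrow> continuous_map (C_space d1 d2 d3) euclidean (\<lambda>c. fst c i)"
    using continuous_map_compose[OF 1 continuous_map_free_config_component, of i]
    unfolding C_space_def o_def by (rule continuous_map_from_subtopology)
  show "i \<le> length d2 \<Longrightarrow> continuous_map (C_space d1 d2 d3) euclidean (\<lambda>c. fst (snd c) i)"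
    using continuous_map_compose[OF 2 continuous_map_free_config_component, of i]
    unfolding C_space_def o_def by (rule continuous_map_from_subtopology)
  show "i \<le> length d3 \<Longrightarrow> continuous_map (C_space d1 d2 d3) euclidean (\<lambda>c. snd (snd c) i)"
    using continuous_map_compose[OF 3 continuous_map_free_config_component, of i]
    unfolding C_space_def o_def by (rule continuous_map_from_subtopology)
qed

definition rotate_triple :: "nat \<Rightarrow> nat \<Rightarrow> complex \<Rightarrow> triple_config \<Rightarrow> triple_config" where
  "rotate_triple n2 n3 t = (\<lambda>(x, y, z). (rotate_config 2 t x, rotate_config n2 t y, rotate_config n3 t z))"

text \<open>The quotient by rotations is identified with the fibre product of edge vectors over the curve
\<open>tip\<close>: if the first edge of the first linkage is turned to the positive real axis and the image
of the configuration under the angle map is \<open>w\<close>, then its second edge is \<open>- b * cnj w\<close> and its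
terminal vertex is \<open>tip w\<close>.\<close>

locale two_edge_linkage =
  fixes a b :: real and n2 n3 :: nat
  assumes a: "a > 0" and b: "b > 0"
begin

abbreviation "C \<equiv> C_space [a, b] (replicate n2 1) (replicate n3 1)"
abbreviation "orbit \<equiv> SO2_orbit [a, b] (replicate n2 1) (replicate n3 1)"
abbreviation "M \<equiv> M_space [a, b] (replicate n2 1) (replicate n3 1)"

definition tip :: "complex \<Rightarrow> complex" where "tip w = of_real a - of_real b * cnj w"

abbreviation "E \<equiv> edge_space n2 n3 tip"

text \<open>The rotation that turns the first edge of the first linkage to the positive real axis.\<close>

definition straighten :: "triple_config \<Rightarrow> complex" where
  "straighten c = cnj (fst c 1) / of_real a"

definition read_edges :: "triple_config \<Rightarrow> complex \<times> (nat \<Rightarrow> complex) \<times> (nat \<Rightarrow> complex)" where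
  "read_edges c = (- cnj (straighten c * (fst c 2 - fst c 1)) / of_real b,
     edges n2 (rotate_config n2 (straighten c) (fst (snd c))),
     edges n3 (rotate_config n3 (straighten c) (snd (snd c))))"

definition first_arm :: "complex \<Rightarrow> nat \<Rightarrow> complex" where
  "first_arm w = (\<lambda>i\<in>{..2}. if i = 0 then 0 else if i = 1 then of_real a else tip w)"

definition build :: "complex \<times> (nat \<Rightarrow> complex) \<times> (nat \<Rightarrow> complex) \<Rightarrow> triple_config" where
  "build = (\<lambda>(w, u, u'). (first_arm w, vertices n2 u, vertices n3 u'))"

lemma C_iff:
  "(x, y, z) \<in> topspace C \<longleftrightarrow>
     x \<in> extensional {..2} \<and> norm (x 1) = a \<and> norm (x 2 - x 1) = b \<and>
     y \<in> free_configs (replicate n2 1) \<and> z \<in> free_configs (replicate n3 1) \<and> x 0 = 0 \<and> y 0 = 0 \<and> z 0 = 0 \<and>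
     x 2 = y n2 \<and> y n2 = z n3"
proof -
  have "(\<forall>i<length [a, b]. norm (x (Suc i) - x i) = [a, b] ! i) \<longleftrightarrow> norm (x 1 - x 0) = a \<and> norm (x 2 - x 1) = b"
    by (simp add: numeral_2_eq_2 All_less_Suc conj_commute)
  then show ?thesis
    unfolding topspace_C_space free_configs_iff[of x] by (auto simp: numeral_2_eq_2)
qed

lemma norm_straighten:
  assumes "c \<in> topspace C" shows "norm (straighten c) = 1"
proof -
  obtain x y z where c: "c = (x, y, z)" by (cases c)
  then show ?thesis using assms a by (simp add: C_iff straighten_def norm_divide)
qed

lemma straighten_first_edge:
  assumes "c \<in> topspace C" shows "straighten c * fst c 1 = of_real a"
proof -
  obtain x y z where c: "c = (x, y, z)" by (cases c)
  then have n: "norm (x 1) = a" using assms by (simp add: C_iff)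
  have "cnj (x 1) * x 1 = (of_real a)\<^sup>2" unfolding n[symmetric] by (metis complex_norm_square mult.commute of_real_power)
  then show ?thesis using a by (simp add: c straighten_def power2_eq_square)
qed

lemma orbit_eq: "orbit c = {rotate_triple n2 n3 t c | t. norm t = 1}"
  by (cases c) (simp add: SO2_orbit_def rotate_triple_def numeral_2_eq_2)

lemma rotate_triple_rotate_triple: "rotate_triple n2 n3 s (rotate_triple n2 n3 t c) = rotate_triple n2 n3 (s * t) c"
  by (cases c) (simp add: rotate_triple_def rotate_config_rotate_config)

lemma rotate_triple_1: "c \<in> topspace C \<Longrightarrow> rotate_triple n2 n3 1 c = c"
  by (cases c) (simp add: rotate_triple_def C_iff free_configs_iff rotate_config_1)

lemma orbit_rotate:
  assumes "norm t = 1" shows "orbit (rotate_triple n2 n3 t c) = orbit c"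
proof (intro equalityI subsetI)
  fix d assume "d \<in> orbit (rotate_triple n2 n3 t c)"
  then obtain s where "norm s = 1" "d = rotate_triple n2 n3 (s * t) c"
    unfolding orbit_eq rotate_triple_rotate_triple by blast
  then show "d \<in> orbit c"
    unfolding orbit_eq using assms by (auto intro!: exI[of _ "s * t"] simp: norm_mult)
next
  fix d assume "d \<in> orbit c"
  then obtain s where s: "norm s = 1" "d = rotate_triple n2 n3 s c" unfolding orbit_eq by blast
  have "t \<noteq> 0" using assms by auto
  then have "d = rotate_triple n2 n3 (s / t) (rotate_triple n2 n3 t c)"
    by (simp add: s rotate_triple_rotate_triple)
  then show "d \<in> orbit (rotate_triple n2 n3 t c)"
    unfolding orbit_eq using assms s(1) by (auto intro!: exI[of _ "s / t"] simp: norm_divide)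
qed

lemma read_edges_rotate:
  assumes "norm t = 1" shows "read_edges (rotate_triple n2 n3 t c) = read_edges c"
proof -
  obtain x y z where c: "c = (x, y, z)" by (cases c)
  have t: "cnj t * t = 1" using assms by (metis complex_norm_square mult.commute of_real_1 one_power2)
  have st: "straighten (rotate_triple n2 n3 t c) = cnj t * straighten c"
    by (simp add: c straighten_def rotate_triple_def rotate_config_apply)
  have "straighten (rotate_triple n2 n3 t c) * (t * x 2 - t * x 1) = (cnj t * t) * (straighten c * (x 2 - x 1))"
    unfolding st by (simp add: algebra_simps)
  then have 1: "straighten (rotate_triple n2 n3 t c) * (t * x 2 - t * x 1) = straighten c * (x 2 - x 1)"
    by (simp add: t)
  have 2: "straighten (rotate_triple n2 n3 t c) * t = straighten c"
    unfolding st using t by (simp add: mult.commute mult.left_commute)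
  show ?thesis
    using 1 2 unfolding read_edges_def
    by (simp add: c rotate_triple_def rotate_config_apply rotate_config_rotate_config)
qed

lemma tip_read_edges:
  assumes "(x, y, z) \<in> topspace C"
  shows "tip (fst (read_edges (x, y, z))) = straighten (x, y, z) * x 2"
proof -
  have "of_real b * cnj (fst (read_edges (x, y, z))) = - (straighten (x, y, z) * (x 2 - x 1))"
    using b by (simp add: read_edges_def)
  then have "tip (fst (read_edges (x, y, z))) = of_real a + straighten (x, y, z) * (x 2 - x 1)"
    by (simp add: tip_def)
  then show ?thesis
    using straighten_first_edge[OF assms] by (simp add: algebra_simps)
qed

lemma read_edges_in_E:
  assumes c: "c \<in> topspace C" shows "read_edges c \<in> topspace E"
proof -
  obtain x y z where xyz: "c = (x, y, z)" by (cases c)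
  note C = c[unfolded xyz C_iff]
  let ?s = "straighten c"
  have s: "norm ?s = 1" by (rule norm_straighten[OF c])
  have w: "norm (fst (read_edges c)) = 1"
  proof -
    have "norm (fst (read_edges c)) = norm ?s * norm (x 2 - x 1) / \<bar>b\<bar>"
      by (simp only: xyz read_edges_def fst_conv norm_divide norm_minus_cancel complex_mod_cnj norm_mult norm_of_real)
    moreover have "norm (x 2 - x 1) = b" using C by blast
    ultimately show ?thesis using s b by simp
  qed
  have f: "rotate_config n2 ?s y \<in> free_configs (replicate n2 1)" "rotate_config n3 ?s z \<in> free_configs (replicate n3 1)"
    using rotate_in_free_configs[of y "replicate n2 1" ?s] rotate_in_free_configs[of z "replicate n3 1" ?s] C s by simp_all
  have "edges n2 (rotate_config n2 ?s y) \<in> torus n2" "edges n3 (rotate_config n3 ?s z) \<in> torus n3"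
    using edges_in_torus[OF f(1)] edges_in_torus[OF f(2)] .
  moreover have "endpoint n2 (edges n2 (rotate_config n2 ?s y)) = tip (fst (read_edges c))"
     "endpoint n3 (edges n3 (rotate_config n3 ?s z)) = tip (fst (read_edges c))"
    using C tip_read_edges[OF c[unfolded xyz]] by (simp_all add: endpoint_edges rotate_config_apply xyz)
  ultimately show ?thesis
    using w unfolding topspace_edge_space by (simp add: read_edges_def polygons_def xyz)
qed

lemma build_read_edges:
  assumes c: "c \<in> topspace C" shows "build (read_edges c) = rotate_triple n2 n3 (straighten c) c"
proof -
  obtain x y z where xyz: "c = (x, y, z)" by (cases c)
  note C = c[unfolded xyz C_iff]
  let ?s = "straighten c"
  have "first_arm (fst (read_edges c)) = rotate_config 2 ?s x"
  proof
    fix i :: nat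
    consider "i = 0" | "i = 1" | "i = 2" | "i > 2" by linarith
    then show "first_arm (fst (read_edges c)) i = rotate_config 2 ?s x i"
    proof cases
      case 1 then show ?thesis using C by (simp add: first_arm_def rotate_config_apply)
    next
      case 2 then show ?thesis
        using straighten_first_edge[OF c] by (simp add: first_arm_def rotate_config_apply xyz)
    next
      case 3 then show ?thesis
        using tip_read_edges[OF c[unfolded xyz]] by (simp add: first_arm_def rotate_config_apply xyz)
    next
      case 4 then show ?thesis by (simp add: first_arm_def rotate_config_def)
    qed
  qed
  moreover have "vertices n2 (edges n2 (rotate_config n2 ?s y)) = rotate_config n2 ?s y"
    "vertices n3 (edges n3 (rotate_config n3 ?s z)) = rotate_config n3 ?s z"
    using C by (intro vertices_edges; simp add: rotate_config_def)+
  ultimately show ?thesis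
    by (simp add: build_def read_edges_def rotate_triple_def xyz)
qed

lemma build_in_C:
  assumes e: "e \<in> topspace E" shows "build e \<in> topspace C"
proof -
  obtain w u u' where wu: "e = (w, u, u')" by (cases e)
  note E = e[unfolded wu topspace_edge_space polygons_def, simplified]
  show ?thesis
    unfolding build_def wu prod.case C_iff
    using E a b vertices_in_free_configs[of u n2] vertices_in_free_configs[of u' n3]
    by (simp add: first_arm_def vertices_endpoint tip_def norm_mult) (simp add: vertices_def)
qed

lemma read_edges_build:
  assumes e: "e \<in> topspace E" shows "read_edges (build e) = e"
proof -
  obtain w u u' where wu: "e = (w, u, u')" by (cases e)
  note E = e[unfolded wu topspace_edge_space polygons_def, simplified]
  have s: "straighten (build e) = 1" using a by (simp add: straighten_def build_def wu first_arm_def)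
  have "vertices n u \<in> extensional {..n}" for n u by (simp add: vertices_def)
  then show ?thesis
    using E b unfolding read_edges_def s
    by (simp add: build_def wu first_arm_def tip_def rotate_config_1 edges_vertices)
qed

lemma continuous_read_edges: "continuous_map C E read_edges"
proof -
  have lim: "((\<lambda>c. fst c i) \<longlongrightarrow> fst c0 i) (atin C c0)" if "i \<le> 2" "c0 \<in> topspace C" for i c0
    using continuous_map_C_space_components(1)[of i "[a, b]"] that
    unfolding continuous_map_euclidean_iff_tendsto by simp
  have limy: "((\<lambda>c. fst (snd c) i) \<longlongrightarrow> fst (snd c0) i) (atin C c0)" if "i \<le> n2" "c0 \<in> topspace C" for i c0
    using continuous_map_C_space_components(2)[of i "replicate n2 1"] that
    unfolding continuous_map_euclidean_iff_tendsto by simp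
  have limz: "((\<lambda>c. snd (snd c) i) \<longlongrightarrow> snd (snd c0) i) (atin C c0)" if "i \<le> n3" "c0 \<in> topspace C" for i c0
    using continuous_map_C_space_components(3)[of i "replicate n3 1"] that
    unfolding continuous_map_euclidean_iff_tendsto by simp
  have lims: "(straighten \<longlongrightarrow> straighten c0) (atin C c0)" if "c0 \<in> topspace C" for c0
    unfolding straighten_def using a that by (intro tendsto_intros lim) auto
  have "continuous_map C E (\<lambda>c. (- cnj (straighten c * (fst c 2 - fst c 1)) / of_real b,
     edges n2 (rotate_config n2 (straighten c) (fst (snd c))),
     edges n3 (rotate_config n3 (straighten c) (snd (snd c)))))"
  proof (rule continuous_map_into_edge_space)
    have "continuous_map C euclidean (\<lambda>c. - cnj (straighten c * (fst c 2 - fst c 1)) / of_real b)"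
      unfolding continuous_map_euclidean_iff_tendsto using b by (auto intro!: tendsto_intros lim lims)
    then show "continuous_map C (top_of_set (sphere 0 1)) (\<lambda>c. - cnj (straighten c * (fst c 2 - fst c 1)) / of_real b)"
      unfolding continuous_map_in_subtopology using read_edges_in_E
      by (auto simp: read_edges_def topspace_edge_space)
    show "continuous_map C (torus_space n2) (\<lambda>c. edges n2 (rotate_config n2 (straighten c) (fst (snd c))))"
      unfolding continuous_map_into_torus_space continuous_map_euclidean_iff_tendsto
    proof (intro conjI funcsetI allI impI ballI)
      fix c assume "c \<in> topspace C"
      then show "edges n2 (rotate_config n2 (straighten c) (fst (snd c))) \<in> torus n2"
        using read_edges_in_E[of c] by (simp add: read_edges_def topspace_edge_space polygons_def)
    next
      fix i c assume i: "i < n2" and c: "c \<in> topspace C"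
      then show "((\<lambda>c. edges n2 (rotate_config n2 (straighten c) (fst (snd c))) i) \<longlongrightarrow>
          edges n2 (rotate_config n2 (straighten c) (fst (snd c))) i) (atin C c)"
        by (simp add: edges_def rotate_config_apply) (intro tendsto_intros limy lims; simp)
    qed
    show "continuous_map C (torus_space n3) (\<lambda>c. edges n3 (rotate_config n3 (straighten c) (snd (snd c))))"
      unfolding continuous_map_into_torus_space continuous_map_euclidean_iff_tendsto
    proof (intro conjI funcsetI allI impI ballI)
      fix c assume "c \<in> topspace C"
      then show "edges n3 (rotate_config n3 (straighten c) (snd (snd c))) \<in> torus n3"
        using read_edges_in_E[of c] by (simp add: read_edges_def topspace_edge_space polygons_def)
    next
      fix i c assume i: "i < n3" and c: "c \<in> topspace C"
      then show "((\<lambda>c. edges n3 (rotate_config n3 (straighten c) (snd (snd c))) i) \<longlongrightarrow>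
          edges n3 (rotate_config n3 (straighten c) (snd (snd c))) i) (atin C c)"
        by (simp add: edges_def rotate_config_apply) (intro tendsto_intros limz lims; simp)
    qed
    fix c assume "c \<in> topspace C"
    then show "edges n2 (rotate_config n2 (straighten c) (fst (snd c))) \<in> polygons n2 (tip (- cnj (straighten c * (fst c 2 - fst c 1)) / of_real b)) \<and>
       edges n3 (rotate_config n3 (straighten c) (snd (snd c))) \<in> polygons n3 (tip (- cnj (straighten c * (fst c 2 - fst c 1)) / of_real b))"
      using read_edges_in_E[of c] by (simp add: read_edges_def topspace_edge_space)
  qed
  then show ?thesis unfolding read_edges_def[abs_def] .
qed

lemma continuous_build: "continuous_map E C build"
proof -
  note pr = continuous_map_edge_space_projections[of n2 n3 tip]
  have w: "continuous_map E euclidean fst" by (rule continuous_map_into_fulltopology[OF pr(1)])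
  have u: "continuous_map E euclidean (\<lambda>e. fst (snd e) j)" if "j < n2" for j
    using pr(2) that by (simp add: continuous_map_into_torus_space)
  have u': "continuous_map E euclidean (\<lambda>e. snd (snd e) j)" if "j < n3" for j
    using pr(3) that by (simp add: continuous_map_into_torus_space)
  have b1: "first_arm (fst e) \<in> free_configs [a, b] \<and> vertices n2 (fst (snd e)) \<in> free_configs (replicate n2 1) \<and>
      vertices n3 (snd (snd e)) \<in> free_configs (replicate n3 1)" if "e \<in> topspace E" for e
    using build_in_C[OF that] by (cases e) (simp add: build_def topspace_C_space)
  have "continuous_map E (free_config_space [a, b]) (\<lambda>e. first_arm (fst e))"
  proof (rule continuous_map_into_free_config_space)
    fix i assume "i \<le> length [a, b]"
    then have i: "i \<le> 2" by simp
    have "(\<lambda>e. tip (fst e)) = (\<lambda>w. of_real a - of_real b * cnj w) \<circ> fst" by (simp add: tip_def fun_eq_iff)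
    moreover have "continuous_map euclidean euclidean (\<lambda>w. of_real a - of_real b * cnj w)"
      by (simp add: continuous_intros)
    ultimately have "continuous_map E euclidean (\<lambda>e. tip (fst e))"
      using continuous_map_compose[OF w] by metis
    then show "continuous_map E euclidean (\<lambda>e. first_arm (fst e) i)"
      using i by (simp add: first_arm_def)
  qed (use b1 in blast)
  moreover have "continuous_map E (free_config_space (replicate n2 1)) (\<lambda>e. vertices n2 (fst (snd e)))"
  proof (rule continuous_map_into_free_config_space)
    fix i assume "i \<le> length (replicate n2 (1::real))"
    then have "i \<le> n2" by simp
    moreover from this have "continuous_map E euclidean (\<lambda>e. \<Sum>j<i. fst (snd e) j)"
      by (intro continuous_map_sum u) auto
    ultimately show "continuous_map E euclidean (\<lambda>e. vertices n2 (fst (snd e)) i)" by (simp add: vertices_def)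
  qed (use b1 in blast)
  moreover have "continuous_map E (free_config_space (replicate n3 1)) (\<lambda>e. vertices n3 (snd (snd e)))"
  proof (rule continuous_map_into_free_config_space)
    fix i assume "i \<le> length (replicate n3 (1::real))"
    then have "i \<le> n3" by simp
    moreover from this have "continuous_map E euclidean (\<lambda>e. \<Sum>j<i. snd (snd e) j)"
      by (intro continuous_map_sum u') auto
    ultimately show "continuous_map E euclidean (\<lambda>e. vertices n3 (snd (snd e)) i)" by (simp add: vertices_def)
  qed (use b1 in blast)
  ultimately have "continuous_map E (prod_topology (free_config_space [a, b])
      (prod_topology (free_config_space (replicate n2 1)) (free_config_space (replicate n3 1))))
      (\<lambda>e. (first_arm (fst e), vertices n2 (fst (snd e)), vertices n3 (snd (snd e))))"
    by (intro continuous_map_pairedI)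
  moreover have eq: "build = (\<lambda>e. (first_arm (fst e), vertices n2 (fst (snd e)), vertices n3 (snd (snd e))))"
    by (simp add: build_def fun_eq_iff)
  ultimately have "continuous_map E (prod_topology (free_config_space [a, b])
      (prod_topology (free_config_space (replicate n2 1)) (free_config_space (replicate n3 1)))) build" by simp
  moreover have img: "build e \<in> {(x, y, z). x 0 = 0 \<and> y 0 = 0 \<and> z 0 = 0 \<and>
          x (length [a, b]) = y (length (replicate n2 (1::real))) \<and> y (length (replicate n2 (1::real))) = z (length (replicate n3 (1::real)))}"
    if "e \<in> topspace E" for e
    using build_in_C[OF that] by (cases "build e") (simp add: topspace_C_space)
  ultimately show ?thesis
    unfolding C_space_def continuous_map_in_subtopology by (intro conjI funcsetI img)
qed

definition to_edges :: "triple_config set \<Rightarrow> complex \<times> (nat \<Rightarrow> complex) \<times> (nat \<Rightarrow> complex)" where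
  "to_edges Q = read_edges (SOME c. c \<in> topspace C \<and> orbit c = Q)"

lemma to_edges_orbit:
  assumes c: "c \<in> topspace C" shows "to_edges (orbit c) = read_edges c"
proof -
  define c' where "c' = (SOME d. d \<in> topspace C \<and> orbit d = orbit c)"
  have c': "c' \<in> topspace C \<and> orbit c' = orbit c"
    unfolding c'_def by (rule someI[of _ c]) (simp add: c)
  have "c \<in> orbit c" unfolding orbit_eq using rotate_triple_1[OF c] by (auto intro!: exI[of _ 1])
  then have "c \<in> orbit c'" using c' by simp
  then obtain t where "norm t = 1" "c = rotate_triple n2 n3 t c'" unfolding orbit_eq by blast
  then have "read_edges c = read_edges c'" using read_edges_rotate by simp
  then show ?thesis by (simp add: to_edges_def c'_def)
qed

text \<open>\<open>read_edges\<close> is constant on orbits, so it descends to the quotient. Rebuilding a configuration from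
its edges gives its straightened representative in the same orbit.\<close>

lemma M_homeomorphic_E: "homeomorphic_maps M E to_edges (orbit \<circ> build)"
proof -
  have quot: "quotient_map C M orbit" unfolding M_space_def by (rule quotient_map_quotient_topology)
  have topM: "topspace M = orbit ` topspace C" unfolding M_space_def by (rule topspace_quotient_topology)
  have "continuous_map C E (to_edges \<circ> orbit)"
    by (rule continuous_map_eq[OF continuous_read_edges]) (simp add: to_edges_orbit)
  then have "continuous_map M E to_edges" by (rule continuous_compose_quotient_map[OF quot])
  moreover have "continuous_map E M (orbit \<circ> build)"
    by (rule continuous_map_compose[OF continuous_build quotient_imp_continuous_map[OF quot]])
  moreover have "(orbit \<circ> build) (to_edges Q) = Q" if Q: "Q \<in> topspace M" for Q
  proof -
    obtain c where "c \<in> topspace C" "Q = orbit c" using Q unfolding topM by (rule imageE)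
    then show ?thesis
      by (simp add: to_edges_orbit build_read_edges orbit_rotate norm_straighten)
  qed
  moreover have "to_edges ((orbit \<circ> build) e) = e" if "e \<in> topspace E" for e
    using that by (simp add: to_edges_orbit build_in_C read_edges_build)
  ultimately show ?thesis unfolding homeomorphic_maps_def by blast
qed

lemma fst_to_edges:
  assumes "Q \<in> topspace M" shows "fst (to_edges Q) = p_map Q"
proof -
  have topM: "topspace M = orbit ` topspace C" unfolding M_space_def by (rule topspace_quotient_topology)
  obtain c where c: "c \<in> topspace C" "Q = orbit c" using assms unfolding topM by (rule imageE)
  obtain x y z where xyz: "c = (x, y, z)" by (cases c)
  note C = c(1)[unfolded xyz C_iff]
  define q where "q = (x 2 - x 1) / (x 1 - x 0)"
  have n: "norm (x 1) = a" "norm (x 2 - x 1) = b" and x0: "x 0 = 0" using C by blast+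
  have nz: "x 1 \<noteq> 0" using n(1) a by auto
  have q: "q = (x 2 - x 1) / x 1" by (simp add: q_def x0)
  have nq: "norm q = b / a" unfolding q by (simp only: norm_divide n)
  then have q0: "q \<noteq> 0" using a b by auto
  have s: "straighten c = of_real a / x 1"
    using straighten_first_edge[OF c(1)] nz by (simp add: xyz field_simps)
  have "cis (pi - Arg q) = - cnj (cis (Arg q))"
    using cis_mult[of pi "- Arg q"] by (simp add: cis_cnj)
  also have "cis (Arg q) = q / of_real (norm q)"
    using cis_Arg[OF q0] unfolding sgn_eq .
  also have "\<dots> = straighten c * (x 2 - x 1) / of_real b"
    unfolding nq s unfolding q using a b nz by (simp add: field_simps)
  also have "- cnj (straighten c * (x 2 - x 1) / of_real b) = - cnj (straighten c * (x 2 - x 1)) / of_real b"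
    by simp
  finally have "cis (pi - Arg q) = fst (read_edges c)" by (simp add: read_edges_def xyz)
  then show ?thesis
    using p_map_orbit[OF c(1)[unfolded xyz] a] c by (simp add: to_edges_orbit xyz q_def)
qed

end

theorem theorem6p2:
  fixes a b :: real and n2 n3 :: nat
  assumes "a > 0" and "b > 0" and "n2 > 0" and "n3 > 0"
    and "((\<forall>k::int. odd k \<longrightarrow> real_of_int k \<notin> {\<bar>a - b\<bar>..a + b}) \<and> odd n2 \<and> odd n3) \<or>
         ((\<forall>k::int. even k \<longrightarrow> real_of_int k \<notin> {\<bar>a - b\<bar>..a + b}) \<and> even n2 \<and> even n3) \<or>
         ((\<forall>k::int. real_of_int k \<notin> {\<bar>a - b\<bar>..a + b}) \<and> (even n2 \<longleftrightarrow> odd n3))"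
  shows "locally_trivial_fibration
           (M_space [a, b] (replicate n2 1) (replicate n3 1))
           (top_of_set (sphere (0::complex) 1)) p_map
         \<and> has_euler_characteristic (M_space [a, b] (replicate n2 1) (replicate n3 1)) 0"
proof -
  interpret two_edge_linkage a b n2 n3 by unfold_locales (fact assms)+
  have tip_norm: "norm (tip w) \<in> {\<bar>a - b\<bar>..a + b}" if "w \<in> sphere 0 1" for w
  proof -
    have n: "norm (of_real a :: complex) = a" "norm (of_real b * cnj w) = b"
      using that assms(1,2) by (simp_all add: norm_mult)
    show ?thesis
      using norm_triangle_ineq4[of "of_real a" "of_real b * cnj w"]
        norm_triangle_ineq3[of "of_real a" "of_real b * cnj w"]
      unfolding tip_def n by simp
  qed
  \<comment> \<open>A chain of \<open>n\<close> parallel unit edges ending at \<open>tip w\<close> would put an integer of the parity of \<open>n\<close> into the interval.\<close>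
  have transport: "\<exists>\<epsilon>>0. \<exists>\<tau>. parallel_transport n (ball (tip w) \<epsilon>) \<tau>"
    if n: "n > 0" and avoid: "\<And>k::int. (even k \<longleftrightarrow> even n) \<Longrightarrow> real_of_int k \<notin> {\<bar>a - b\<bar>..a + b}"
      and w: "w \<in> sphere 0 1" for n w
  proof (rule parallel_transport_exists[OF n])
    fix u assume u: "u \<in> torus n" "endpoint n u = tip w"
    show "norm (\<Sum>i<n. (u i)\<^sup>2) < n"
    proof (rule ccontr)
      assume "\<not> norm (\<Sum>i<n. (u i)\<^sup>2) < n"
      then obtain k :: int where k: "norm (endpoint n u) = real_of_int \<bar>k\<bar>" "even k \<longleftrightarrow> even n"
        using torus_collinear_endpoint[OF u(1)] by blast
      then have "real_of_int \<bar>k\<bar> \<in> {\<bar>a - b\<bar>..a + b}" using tip_norm[OF w] u(2) by simp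
      moreover have "even \<bar>k\<bar> \<longleftrightarrow> even n" using k(2) by simp
      ultimately show False using avoid by blast
    qed
  qed
  have tr2: "\<exists>\<epsilon>>0. \<exists>\<tau>. parallel_transport n2 (ball (tip w) \<epsilon>) \<tau>" if "w \<in> sphere 0 1" for w
    using assms(3,5) that by (intro transport) auto
  have tr3: "\<exists>\<epsilon>>0. \<exists>\<tau>. parallel_transport n3 (ball (tip w) \<epsilon>) \<tau>" if "w \<in> sphere 0 1" for w
    using assms(4,5) that by (intro transport) auto
  have "continuous_on (sphere 0 1) tip" unfolding tip_def by (intro continuous_intros)
  then have lt: "locally_trivial_fibration E (top_of_set (sphere 0 1)) fst"
    using tr2 tr3 by (rule edge_space_locally_trivial)
  have "has_euler_characteristic E 0"
    by (rule euler_characteristic_circle_fibration[OF lt]) (intro edge_space_fibre_euler tr2 tr3)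
  moreover have "E homotopy_equivalent_space M"
    using M_homeomorphic_E homeomorphic_maps_imp_homeomorphic_space homeomorphic_space_sym
      homeomorphic_imp_homotopy_equivalent_space by blast
  ultimately have "has_euler_characteristic M 0"
    by (rule has_euler_characteristic_homotopy_equivalent[rotated])
  moreover have "locally_trivial_fibration M (top_of_set (sphere 0 1)) p_map"
    using M_homeomorphic_E lt fst_to_edges by (rule locally_trivial_fibration_homeomorphic)
  ultimately show ?thesis by blast
qed

end
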